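(* Let $P$ be a finite set with two partial orders $<$ and $<'$ such that $<'$ is weaker than $<$ and such that $\mathcal J(P,<)\subset\mathcal J(P,<')$ is closed under the operation $*_{P,<'}$. Then: (1) The relative poset polytope $\mathcal R(P,<,<')$ is normal. (2) $\mathcal R(P,<,<')$ is Ehrhart-equivalent to the order polytope $\mathcal O(P,<)$ and to the chain polytope $\mathcal C(P,<)$. (3) Let $\tilde I$ be an initial ideal of $I_{P,<,<'}$ such that $I^m_{P,<}$ is an initial ideal of $\tilde I$. Then the zero set of $\tilde I$ in $\mathbb P(\mathbb C^{\mathcal J(P,<)})$ is semitoric: there is a polyhedral subdivision of $\mathcal R(P,<,<')$ all of whose parts are relative poset polytopes, and the irreducible components of this zero set are the toric varieties of the parts of this subdivision.
   Context: An order ideal of a poset is a lower set; $\mathcal J(P,<)$ denotes the set of order ideals of a finite poset $(P,<)$. An order $<'$ on $P$ is weaker than $<$ (and $<$ is stronger than $<'$) if $p<'q$ implies $p<q$ (equality of orders allowed); then $\mathcal J(P,<)\subset\mathcal J(P,<')$. For $A\subset P$, $\max_< A$ is the set of $<$-maximal elements of $A$ and $\mathbf 1_A\in\mathbb R^P$ is the indicator vector. For $J_1,J_2\in\mathcal J(P,<')$, $J_1*_{P,<'}J_2$ is the order ideal of $(P,<')$ generated by $(J_1\cap J_2)\cap(\max_{<'}J_1\cup\max_{<'}J_2)$. If $<'$ is weaker than $<$ and $\mathcal J(P,<)$ is closed under $*_{P,<'}$, the relative poset polytope $\mathcal R(P,<,<')\subset\mathbb R^P$ is the convex hull of the points $\mathbf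 1_{\max_{<'}J}$, $J\in\mathcal J(P,<)$. The order polytope $\mathcal O(P,<)\subset\mathbb R^P$ is the set of $x$ with $0\le x_p\le1$ for all $p$ and $x_p\le x_q$ whenever $p>q$. The chain polytope $\mathcal C(P,<)$ is the set of $x\in\mathbb R^P$ with all $x_p\ge0$ and $x_{p_1}+\dots+x_{p_k}\le1$ for every chain $p_1<\dots<p_k$. A lattice polytope $Q$ is normal if for every integer $k>0$ every integer point of $kQ$ is a sum of $k$ (not necessarily distinct) integer points of $Q$. Two lattice polytopes $Q,Q'$ are Ehrhart-equivalent if $mQ$ and $mQ'$ have the same number of integer points for every integer $m\ge0$. A polyhedral subdivision of a polytope $Q$ is a set of polytopes (parts) of the same dimension as $Q$ whose union is $Q$ and which together with all their faces form a polyhedral complex. The toric variety of a lattice polytope is the projective toric variety of its normal fan. A variety is semitoric if all its irreducible components are toric varieties. $\mathbb C[\mathcal J(P,<)]$ is the polynomial ring in variables $X_J$, $J\in\mathcal J(P,<)$, viewed as the homogeneous coordinate ring of $\mathbb P(\mathbb C^{\mathcal J(P,<)})$. $I_{P,<,<'}$ is the kernel of the homomorphism $\mathbb C[\mathcal J(P,<)]\to\mathbb C[\{z_p\}_{p\in P},t]$, $X_J\mapsto t\prod_{p\in\max_{<'}J}z_p$; its zero set is the toric variety of $\mathcal R(P,<,<')$. $I^m_{P,<}$ is the monomial ideal generated by the products $X_{J_1}X_{J_2}$ with $J_1,J_2\in\mathcal J(P,<)$ incomparable under inclusion. For an ideal $I$ in a polynomial ring over $\mathbb C$ in $N$ variables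 and $w\in\mathbb R^N$, $\mathrm{in}_w p$ is the sum of the terms of a polynomial $p$ of minimal $w$-weight (the $i$th variable having weight $w_i$), and $\mathrm{in}_wI$ is the linear span of $\{\mathrm{in}_wp:p\in I\}$, which is an ideal. Ideals of the form $\mathrm{in}_w I$ are called initial ideals of $I$. *)

theory Defs
  imports "HOL-Analysis.Analysis" "HOL-Library.Poly_Mapping"
begin

section \<open>Order ideals\<close>

text \<open>
  A poset is a set \<open>P\<close> with a reflexive order relation \<open>r\<close> satisfying \<^term>\<open>partial_order_on P r\<close>;
  \<open>(p, q) \<in> r\<close> means \<open>p \<le> q\<close>. The set \<open>P\<close> is an arbitrary subset of a finite type \<open>'p\<close>,
  so that the empty poset is covered. The space \<open>\<real>\<^sup>P\<close> is realised inside \<^typ>\<open>real ^ 'p\<close> as the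
  subspace of vectors vanishing outside \<open>P\<close>.
\<close>

definition order_ideals :: "'p set \<Rightarrow> 'p rel \<Rightarrow> 'p set set"
  where "order_ideals P r = {J. J \<subseteq> P \<and> (\<forall>q\<in>J. \<forall>p. (p, q) \<in> r \<longrightarrow> p \<in> J)}"

definition max_elems :: "'p rel \<Rightarrow> 'p set \<Rightarrow> 'p set"
  where "max_elems r A = {p\<in>A. \<not> (\<exists>q\<in>A. (p, q) \<in> r \<and> p \<noteq> q)}"

definition ideal_star :: "'p set \<Rightarrow> 'p rel \<Rightarrow> 'p set \<Rightarrow> 'p set \<Rightarrow> 'p set"
  where "ideal_star P r J1 J2 =
    (\<lambda>J. J \<in> order_ideals P r) hull ((J1 \<inter> J2) \<inter> (max_elems r J1 \<union> max_elems r J2))"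

definition relative_orders :: "'p set \<Rightarrow> 'p rel \<Rightarrow> 'p rel \<Rightarrow> bool"
  where "relative_orders P r r' \<longleftrightarrow>
    partial_order_on P r \<and> partial_order_on P r' \<and> r' \<subseteq> r \<and>
    (\<forall>J1\<in>order_ideals P r. \<forall>J2\<in>order_ideals P r. ideal_star P r' J1 J2 \<in> order_ideals P r)"


section \<open>Polytopes\<close>

definition indicator_vec :: "'p set \<Rightarrow> real ^ 'p::finite"
  where "indicator_vec A = (\<chi> p. if p \<in> A then 1 else 0)"

definition rel_poset_polytope :: "'p::finite set \<Rightarrow> 'p rel \<Rightarrow> 'p rel \<Rightarrow> (real ^ 'p) set"
  where "rel_poset_polytope P r r' =
    convex hull ((\<lambda>J. indicator_vec (max_elems r' J)) ` order_ideals P r)"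

definition is_rel_poset_polytope :: "'p::finite set \<Rightarrow> (real ^ 'p) set \<Rightarrow> bool"
  where "is_rel_poset_polytope P Q \<longleftrightarrow>
    (\<exists>r r'. relative_orders P r r' \<and> Q = rel_poset_polytope P r r')"

definition order_polytope :: "'p::finite set \<Rightarrow> 'p rel \<Rightarrow> (real ^ 'p) set"
  where "order_polytope P r =
    {x. (\<forall>p. p \<notin> P \<longrightarrow> x $ p = 0) \<and> (\<forall>p\<in>P. 0 \<le> x $ p \<and> x $ p \<le> 1) \<and>
        (\<forall>p\<in>P. \<forall>q\<in>P. (q, p) \<in> r \<and> q \<noteq> p \<longrightarrow> x $ p \<le> x $ q)}"

definition chain_polytope :: "'p::finite set \<Rightarrow> 'p rel \<Rightarrow> (real ^ 'p) set"
  where "chain_polytope P r =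
    {x. (\<forall>p. p \<notin> P \<longrightarrow> x $ p = 0) \<and> (\<forall>p\<in>P. 0 \<le> x $ p) \<and>
        (\<forall>C. C \<subseteq> P \<and> C \<in> Chains r \<longrightarrow> (\<Sum>p\<in>C. x $ p) \<le> 1)}"

definition integer_points :: "(real ^ 'n) set"
  where "integer_points = {x. \<forall>i. x $ i \<in> \<int>}"

definition lattice_polytope :: "(real ^ 'n::finite) set \<Rightarrow> bool"
  where "lattice_polytope Q \<longleftrightarrow> (\<exists>V. finite V \<and> V \<subseteq> integer_points \<and> Q = convex hull V)"

definition dilate :: "nat \<Rightarrow> (real ^ 'n::finite) set \<Rightarrow> (real ^ 'n) set"
  where "dilate k Q = (\<lambda>x. real k *\<^sub>R x) ` Q"

definition normal_polytope :: "(real ^ 'n::finite) set \<Rightarrow> bool"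
  where "normal_polytope Q \<longleftrightarrow> lattice_polytope Q \<and>
    (\<forall>k>0. \<forall>x \<in> dilate k Q \<inter> integer_points.
       \<exists>y :: nat \<Rightarrow> real ^ 'n. (\<forall>i<k. y i \<in> Q \<inter> integer_points) \<and> x = (\<Sum>i<k. y i))"

definition ehrhart_equivalent :: "(real ^ 'n::finite) set \<Rightarrow> (real ^ 'n) set \<Rightarrow> bool"
  where "ehrhart_equivalent Q Q' \<longleftrightarrow> lattice_polytope Q \<and> lattice_polytope Q' \<and>
    (\<forall>m. card (dilate m Q \<inter> integer_points) = card (dilate m Q' \<inter> integer_points))"

definition polyhedral_complex :: "'a::euclidean_space set set \<Rightarrow> bool"
  where "polyhedral_complex K \<longleftrightarrow> finite K \<and> (\<forall>F\<in>K. polytope F) \<and>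
    (\<forall>F\<in>K. \<forall>G. G face_of F \<longrightarrow> G \<in> K) \<and>
    (\<forall>F\<in>K. \<forall>G\<in>K. F \<inter> G face_of F \<and> F \<inter> G face_of G)"

definition polyhedral_subdivision :: "'a::euclidean_space set \<Rightarrow> 'a set set \<Rightarrow> bool"
  where "polyhedral_subdivision Q \<Theta> \<longleftrightarrow>
    (\<forall>A\<in>\<Theta>. polytope A \<and> aff_dim A = aff_dim Q) \<and> \<Union>\<Theta> = Q \<and>
    polyhedral_complex {F. \<exists>A\<in>\<Theta>. F face_of A}"


section \<open>Polynomials and initial ideals\<close>

text \<open>
  Polynomials over \<open>\<complex>\<close> with variables of type \<open>'v\<close>, as finitely supported functions on exponent
  vectors; the ring structure is the convolution product of \<^theory>\<open>HOL-Library.Poly_Mapping\<close>.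
\<close>

type_synonym 'v cpoly = "('v \<Rightarrow>\<^sub>0 nat) \<Rightarrow>\<^sub>0 complex"

definition const_poly :: "complex \<Rightarrow> 'v cpoly"
  where "const_poly c = Poly_Mapping.single 0 c"

definition var_poly :: "'v \<Rightarrow> 'v cpoly"
  where "var_poly v = Poly_Mapping.single (Poly_Mapping.single v 1) 1"

definition poly_ring :: "'v set \<Rightarrow> 'v cpoly set"
  where "poly_ring V = {f. \<forall>m\<in>Poly_Mapping.keys f. Poly_Mapping.keys m \<subseteq> V}"

definition subst_poly :: "(complex \<Rightarrow> 'b::comm_semiring_1) \<Rightarrow> ('v \<Rightarrow> 'b) \<Rightarrow> 'v cpoly \<Rightarrow> 'b"
  where "subst_poly c g f =
    (\<Sum>m\<in>Poly_Mapping.keys f. c (Poly_Mapping.lookup f m) *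
       (\<Prod>v\<in>Poly_Mapping.keys m. g v ^ Poly_Mapping.lookup m v))"

abbreviation eval_poly :: "('v \<Rightarrow> complex) \<Rightarrow> 'v cpoly \<Rightarrow> complex"
  where "eval_poly x \<equiv> subst_poly (\<lambda>c. c) x"

definition homogeneous :: "nat \<Rightarrow> 'v cpoly \<Rightarrow> bool"
  where "homogeneous d f \<longleftrightarrow>
    (\<forall>m\<in>Poly_Mapping.keys f. (\<Sum>v\<in>Poly_Mapping.keys m. Poly_Mapping.lookup m v) = d)"

definition ideal_in :: "'v set \<Rightarrow> 'v cpoly set \<Rightarrow> bool"
  where "ideal_in V I \<longleftrightarrow> I \<subseteq> poly_ring V \<and> 0 \<in> I \<and>
    (\<forall>f\<in>I. \<forall>g\<in>I. f + g \<in> I) \<and> (\<forall>a\<in>poly_ring V. \<forall>f\<in>I. a * f \<in> I)"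

definition monom_weight :: "('v \<Rightarrow> real) \<Rightarrow> ('v \<Rightarrow>\<^sub>0 nat) \<Rightarrow> real"
  where "monom_weight w m = (\<Sum>v\<in>Poly_Mapping.keys m. real (Poly_Mapping.lookup m v) * w v)"

definition initial_form :: "('v \<Rightarrow> real) \<Rightarrow> 'v cpoly \<Rightarrow> 'v cpoly"
  where "initial_form w f =
    (\<Sum>m | m \<in> Poly_Mapping.keys f \<and>
           (\<forall>m'\<in>Poly_Mapping.keys f. monom_weight w m \<le> monom_weight w m').
       Poly_Mapping.single m (Poly_Mapping.lookup f m))"

definition initial_ideal :: "('v \<Rightarrow> real) \<Rightarrow> 'v cpoly set \<Rightarrow> 'v cpoly set"
  where "initial_ideal w I = module.span (\<lambda>c f. const_poly c * f) (initial_form w ` I)"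

definition is_initial_ideal_of :: "'v cpoly set \<Rightarrow> 'v cpoly set \<Rightarrow> bool"
  where "is_initial_ideal_of I' I \<longleftrightarrow> (\<exists>w. I' = initial_ideal w I)"

text \<open>
  The target ring \<open>\<complex>[{z\<^sub>p}, t]\<close> has variables of type \<^typ>\<open>'p option\<close>, where \<^term>\<open>None\<close>
  stands for \<open>t\<close> and \<^term>\<open>Some p\<close> for \<open>z\<^sub>p\<close>.
\<close>

definition toric_ideal :: "'p set \<Rightarrow> 'p rel \<Rightarrow> 'p rel \<Rightarrow> 'p set cpoly set"
  where "toric_ideal P r r' =
    {f \<in> poly_ring (order_ideals P r).
       subst_poly const_poly
         (\<lambda>J. var_poly None * (\<Prod>p\<in>max_elems r' J. var_poly (Some p))) f = 0}"

definition incomparable_ideal :: "'p set \<Rightarrow> 'p rel \<Rightarrow> 'p set cpoly set"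
  where "incomparable_ideal P r =
    ideal_in (order_ideals P r) hull
      {var_poly J1 * var_poly J2 | J1 J2.
         J1 \<in> order_ideals P r \<and> J2 \<in> order_ideals P r \<and> \<not> J1 \<subseteq> J2 \<and> \<not> J2 \<subseteq> J1}"


section \<open>Varieties as spaces with functions\<close>

text \<open>
  A variety over \<open>\<complex>\<close> is represented by its set of closed points with the Zariski topology, together
  with its sheaf of regular functions: the second component maps an open set \<open>U\<close> to the functions
  regular on \<open>U\<close>. Regular functions are total in HOL; their values outside \<open>U\<close> are irrelevant.
\<close>

type_synonym 'a variety = "'a topology \<times> ('a set \<Rightarrow> ('a \<Rightarrow> complex) set)"

definition isomorphic_varieties :: "'a variety \<Rightarrow> 'b variety \<Rightarrow> bool"
  where "isomorphic_varieties X Y \<longleftrightarrow>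
    (\<exists>h. homeomorphic_map (fst X) (fst Y) h \<and>
         (\<forall>U. openin (fst Y) U \<longrightarrow>
            (\<forall>f. f \<in> snd Y U \<longleftrightarrow> f \<circ> h \<in> snd X {x \<in> topspace (fst X). h x \<in> U})))"

definition irreducible_subset :: "'a topology \<Rightarrow> 'a set \<Rightarrow> bool"
  where "irreducible_subset X C \<longleftrightarrow> C \<noteq> {} \<and> C \<subseteq> topspace X \<and>
    (\<forall>A B. closedin X A \<and> closedin X B \<and> C \<subseteq> A \<union> B \<longrightarrow> C \<subseteq> A \<or> C \<subseteq> B)"

definition irreducible_components :: "'a topology \<Rightarrow> 'a set set"
  where "irreducible_components X =
    {C. irreducible_subset X C \<and> (\<forall>D. irreducible_subset X D \<and> C \<subseteq> D \<longrightarrow> D = C)}"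


subsection \<open>Projective varieties\<close>

text \<open>
  A point of \<open>\<P>(\<complex>\<^sup>V)\<close> is the set of all its vectors of homogeneous coordinates.
\<close>

definition proj_point :: "('v \<Rightarrow> complex) \<Rightarrow> ('v \<Rightarrow> complex) set"
  where "proj_point x = {(\<lambda>v. c * x v) | c. c \<noteq> 0}"

definition proj_space :: "'v set \<Rightarrow> ('v \<Rightarrow> complex) set set"
  where "proj_space V = proj_point ` {x. (\<forall>v. v \<notin> V \<longrightarrow> x v = 0) \<and> x \<noteq> (\<lambda>v. 0)}"

definition zero_set :: "'v set \<Rightarrow> 'v cpoly set \<Rightarrow> ('v \<Rightarrow> complex) set set"
  where "zero_set V I = {l \<in> proj_space V. \<forall>f\<in>I. \<forall>x\<in>l. eval_poly x f = 0}"

definition proj_zariski :: "'v set \<Rightarrow> ('v \<Rightarrow> complex) set topology"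
  where "proj_zariski V = topology_generated_by
    {proj_space V - zero_set V {f} | f. f \<in> poly_ring V \<and> (\<exists>d. homogeneous d f)}"

definition proj_variety ::
    "'v set \<Rightarrow> ('v \<Rightarrow> complex) set set \<Rightarrow> ('v \<Rightarrow> complex) set variety"
  where "proj_variety V Z =
    (subtopology (proj_zariski V) Z,
     \<lambda>U. {h. \<forall>l\<in>U. \<exists>W d f g.
            openin (subtopology (proj_zariski V) Z) W \<and> l \<in> W \<and> W \<subseteq> U \<and>
            f \<in> poly_ring V \<and> g \<in> poly_ring V \<and> homogeneous d f \<and> homogeneous d g \<and>
            (\<forall>k\<in>W. \<forall>x\<in>k. eval_poly x g \<noteq> 0 \<and> h k = eval_poly x f / eval_poly x g)})"


subsection \<open>Toric varieties\<close>

text \<open>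
  The lattice is \<open>\<int>\<^sup>n\<close>, identified with its dual by the standard inner product. Cones
  may contain lines: for a polytope that is not full-dimensional, the cones of the normal fan share a
  lineality space, and their dual cones lie in the linear span of differences of points of the
  polytope. The construction below then yields the toric variety of the quotient fan.
\<close>

definition normal_cone :: "(real ^ 'n::finite) set \<Rightarrow> (real ^ 'n) set \<Rightarrow> (real ^ 'n) set"
  where "normal_cone Q F = {u. \<forall>y\<in>F. \<forall>x\<in>Q. u \<bullet> y \<le> u \<bullet> x}"

definition normal_fan :: "(real ^ 'n::finite) set \<Rightarrow> (real ^ 'n) set set"
  where "normal_fan Q = {normal_cone Q F | F. F face_of Q \<and> F \<noteq> {}}"

definition dual_monoid :: "(real ^ 'n::finite) set \<Rightarrow> (real ^ 'n) set"
  where "dual_monoid \<sigma> = {m \<in> integer_points. \<forall>u\<in>\<sigma>. 0 \<le> m \<bullet> u}"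

text \<open>
  The points of the affine chart \<open>U\<^sub>\<sigma> = Spec \<complex>[S\<^sub>\<sigma>]\<close> are the monoid homomorphisms
  from \<open>S\<^sub>\<sigma>\<close> to \<open>(\<complex>, \<cdot>)\<close>, where \<open>S\<^sub>\<sigma>\<close> is \<^term>\<open>dual_monoid \<sigma>\<close>. They are extended by \<open>0\<close> outside
  of \<open>S\<^sub>\<sigma>\<close>.
\<close>

definition chart :: "(real ^ 'n::finite) set \<Rightarrow> (real ^ 'n \<Rightarrow> complex) set"
  where "chart \<sigma> = {\<gamma>. \<gamma> 0 = 1 \<and>
    (\<forall>a\<in>dual_monoid \<sigma>. \<forall>b\<in>dual_monoid \<sigma>. \<gamma> (a + b) = \<gamma> a * \<gamma> b) \<and>
    (\<forall>a. a \<notin> dual_monoid \<sigma> \<longrightarrow> \<gamma> a = 0)}"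

text \<open>
  Two charts are glued along the chart of the intersection of their cones: points are identified iff
  they are restrictions of the same point of that chart. The points of the toric variety of a fan
  are the equivalence classes.
\<close>

type_synonym 'n toric_point = "((real ^ 'n) set \<times> (real ^ 'n \<Rightarrow> complex)) set"

definition glue :: "(real ^ 'n::finite) set set \<Rightarrow> ((real ^ 'n) set \<times> (real ^ 'n \<Rightarrow> complex)) rel"
  where "glue \<Sigma> = {((\<sigma>, \<gamma>), (\<sigma>', \<gamma>')). \<sigma> \<in> \<Sigma> \<and> \<gamma> \<in> chart \<sigma> \<and> \<sigma>' \<in> \<Sigma> \<and> \<gamma>' \<in> chart \<sigma>' \<and>
    (\<exists>\<delta>\<in>chart (\<sigma> \<inter> \<sigma>').
       (\<forall>m\<in>dual_monoid \<sigma>. \<delta> m = \<gamma> m) \<and> (\<forall>m\<in>dual_monoid \<sigma>'. \<delta> m = \<gamma>' m))}"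

definition toric_points :: "(real ^ 'n::finite) set set \<Rightarrow> 'n toric_point set"
  where "toric_points \<Sigma> = (SIGMA \<sigma>:\<Sigma>. chart \<sigma>) // glue \<Sigma>"

definition monoid_algebra :: "(real ^ 'n::finite) set \<Rightarrow> ((real ^ 'n) \<Rightarrow>\<^sub>0 complex) set"
  where "monoid_algebra S = {f. Poly_Mapping.keys f \<subseteq> S}"

definition eval_char :: "(real ^ 'n::finite \<Rightarrow> complex) \<Rightarrow> ((real ^ 'n) \<Rightarrow>\<^sub>0 complex) \<Rightarrow> complex"
  where "eval_char \<gamma> f = (\<Sum>m\<in>Poly_Mapping.keys f. Poly_Mapping.lookup f m * \<gamma> m)"

definition toric_zariski :: "(real ^ 'n::finite) set set \<Rightarrow> 'n toric_point topology"
  where "toric_zariski \<Sigma> = topology_generated_by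
    {{\<xi> \<in> toric_points \<Sigma>. \<exists>\<gamma>. (\<sigma>, \<gamma>) \<in> \<xi> \<and> eval_char \<gamma> f \<noteq> 0} | \<sigma> f.
       \<sigma> \<in> \<Sigma> \<and> f \<in> monoid_algebra (dual_monoid \<sigma>)}"

definition fan_variety :: "(real ^ 'n::finite) set set \<Rightarrow> 'n toric_point variety"
  where "fan_variety \<Sigma> =
    (toric_zariski \<Sigma>,
     \<lambda>U. {h. \<forall>\<xi>\<in>U. \<exists>W. \<exists>\<sigma>\<in>\<Sigma>. \<exists>f\<in>monoid_algebra (dual_monoid \<sigma>).
            \<exists>g\<in>monoid_algebra (dual_monoid \<sigma>).
            openin (toric_zariski \<Sigma>) W \<and> \<xi> \<in> W \<and> W \<subseteq> U \<and>
            (\<forall>\<eta>\<in>W. \<exists>\<gamma>. (\<sigma>, \<gamma>) \<in> \<eta> \<and> eval_char \<gamma> g \<noteq> 0 \<and>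
                         h \<eta> = eval_char \<gamma> f / eval_char \<gamma> g)})"

definition toric_variety :: "(real ^ 'n::finite) set \<Rightarrow> 'n toric_point variety"
  where "toric_variety Q = fan_variety (normal_fan Q)"

text \<open>
  The type argument fixes the ambient lattice \<open>\<int>\<^sup>n\<close> of the polytopes, which may have any dimension
  up to \<open>n\<close>.
\<close>

definition semitoric :: "'n::finite itself \<Rightarrow> 'v set \<Rightarrow> ('v \<Rightarrow> complex) set set \<Rightarrow> bool"
  where "semitoric _ V Z \<longleftrightarrow>
    (\<forall>C \<in> irreducible_components (subtopology (proj_zariski V) Z).
       \<exists>Q :: (real ^ 'n) set. lattice_polytope Q \<and>
         isomorphic_varieties (proj_variety V C) (toric_variety Q))"

end

theory Submission
  imports Defs "HOL-Computational_Algebra.Polynomial"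
begin

text \<open>
  Write \<open>v J\<close> for the indicator vector of \<open>max\<^sub><\<^sub>' J\<close>. The identity \<open>v J + v K = v (J \<union> K) + v (J * K)\<close> lets one replace
  incomparable ideals by comparable ones, so every point of the cone over the polytope is a combination of
  the vectors \<open>v J\<close> along a chain of ideals. This combination is unique, and it is integral for lattice points.
  Hence the chains give a unimodular triangulation, and the number of lattice points of a dilate is a number of
  multichains, which does not involve \<open><'\<close>. The order and chain polytopes are the cases where \<open><'\<close> is equality and \<open><\<close>.

  Let \<open>w\<close> be the weight that defines the initial ideal. Were \<open>w J + w K > w (J \<union> K) + w (J * K)\<close> for some incomparable
  \<open>J\<close> and \<open>K\<close>, then the initial ideal would contain the monomial of the comparable pair. Hence \<open>w\<close> extends to a concave
  function, linear on each simplex of the triangulation. Each of its domains of linearity is spanned by a set of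
  ideals that contains a maximal chain and is closed under \<open>\<union>\<close> and \<open>*\<close>; such a set consists of the order ideals of an
  order stronger than \<open><\<close>. The zero set of the initial ideal is the union of the toric varieties of these domains.
\<close>

section \<open>Maximal elements and order ideals\<close>

text \<open>The link between polytopes and ideals is that an exponent vector of a monomial in the
  variables \<open>X_J\<close> is itself a weight on order ideals: its degree is the
  \<open>total\<close>, its image monomial the \<open>bary\<close>, its \<open>w\<close>-weight the
  \<open>wtotal\<close>. Straightening therefore serves twice: with weight zero it yields normality
  and lattice point counts, with weight \<open>w\<close> it decides which binomials of the toric
  ideal degenerate to monomials. Zero sets are compared through binomials and through sums over
  monomials with equal image, without Groebner bases or radicals. The identification with abstract
  toric varieties is carried out once, for a configuration of lattice points
  (\<open>lattice_config\<close>), and applied to every cell. Its decisive assumption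
  \<open>saturated\<close> is normality of the cell: it makes every lattice point of a dual monoid a
  quotient of monomials in the projective coordinates, so that the projective charts become the
  charts of the normal fan. A cell supplies it because, with its own order, it is again a relative
  poset.\<close>

lemma max_elems_above:
  assumes po: "partial_order_on P r" and A: "A \<subseteq> P" "finite A" and q: "q \<in> A"
  shows "\<exists>p\<in>max_elems r A. (q, p) \<in> r"
  using q
proof (induction "card {x\<in>A. (q, x) \<in> r}" arbitrary: q rule: less_induct)
  case less
  note po' = partial_order_onD[OF po]
  show ?case
  proof (cases "q \<in> max_elems r A")
    case True
    then show ?thesis using less.prems A po'(1) by (auto simp: refl_on_def)
  next
    case False
    then obtain s where s: "s \<in> A" "(q, s) \<in> r" "q \<noteq> s"
      using less.prems by (auto simp: max_elems_def)
    have sub: "{x\<in>A. (s, x) \<in> r} \<subseteq> {x\<in>A. (q, x) \<in> r}"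
      using s po'(2) by (auto dest: transD)
    moreover have "q \<in> {x\<in>A. (q, x) \<in> r}" "q \<notin> {x\<in>A. (s, x) \<in> r}"
      using less.prems A po' s by (auto simp: refl_on_def dest: antisymD)
    ultimately have "card {x\<in>A. (s, x) \<in> r} < card {x\<in>A. (q, x) \<in> r}"
      by (intro psubset_card_mono) (use A in auto)
    from less.hyps[OF this s(1)] obtain p where "p \<in> max_elems r A" "(s, p) \<in> r" by auto
    then show ?thesis using s po'(2) by (auto dest: transD)
  qed
qed

lemma order_ideals_Un: "J \<in> order_ideals P r \<Longrightarrow> K \<in> order_ideals P r \<Longrightarrow> J \<union> K \<in> order_ideals P r"
  by (auto simp: order_ideals_def)

lemma order_ideals_Int: "J \<in> order_ideals P r \<Longrightarrow> K \<in> order_ideals P r \<Longrightarrow> J \<inter> K \<in> order_ideals P r"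
  by (auto simp: order_ideals_def)

lemma order_ideals_empty: "{} \<in> order_ideals P r"
  by (auto simp: order_ideals_def)

lemma order_ideals_subset: "J \<in> order_ideals P r \<Longrightarrow> J \<subseteq> P"
  by (auto simp: order_ideals_def)

lemma order_ideals_top: "partial_order_on P r \<Longrightarrow> P \<in> order_ideals P r"
  using partial_order_onD(4)[of P r] by (auto simp: order_ideals_def)

lemma ideal_star_eq:
  assumes po: "partial_order_on P r"
    and J: "J1 \<in> order_ideals P r" "J2 \<in> order_ideals P r"
  shows "ideal_star P r J1 J2 =
    {p. \<exists>q \<in> J1 \<inter> J2 \<inter> (max_elems r J1 \<union> max_elems r J2). (p, q) \<in> r}" (is "_ = ?S")
  unfolding ideal_star_def
proof (rule hull_unique)
  note po' = partial_order_onD[OF po]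
  show "J1 \<inter> J2 \<inter> (max_elems r J1 \<union> max_elems r J2) \<subseteq> ?S"
    using J po'(1) by (fastforce simp: refl_on_def order_ideals_def)
  show "?S \<in> order_ideals P r"
    using J po'(2,4) by (fastforce simp: order_ideals_def dest: transD)
  fix T assume T: "J1 \<inter> J2 \<inter> (max_elems r J1 \<union> max_elems r J2) \<subseteq> T" "T \<in> order_ideals P r"
  then show "?S \<subseteq> T" unfolding order_ideals_def by fast
qed

section \<open>Relative posets\<close>

locale relative_poset =
  fixes P :: "'p::finite set" and r r' :: "'p rel"
  assumes rel: "relative_orders P r r'"
begin

abbreviation "\<L> \<equiv> order_ideals P r"
abbreviation "mx \<equiv> max_elems r'"
abbreviation "star \<equiv> ideal_star P r'"

definition v :: "'p set \<Rightarrow> real ^ 'p"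
  where "v J = indicator_vec (mx J)"

lemma po: "partial_order_on P r" and po': "partial_order_on P r'" and weaker: "r' \<subseteq> r"
  and star_closed: "J \<in> \<L> \<Longrightarrow> K \<in> \<L> \<Longrightarrow> star J K \<in> \<L>"
  using rel by (auto simp: relative_orders_def)

lemma ideal_weaker: "J \<in> \<L> \<Longrightarrow> J \<in> order_ideals P r'"
  using weaker by (auto simp: order_ideals_def)

lemma r'_trans: "(a, b) \<in> r' \<Longrightarrow> (b, c) \<in> r' \<Longrightarrow> (a, c) \<in> r'"
  using partial_order_onD(2)[OF po'] by (auto dest: transD)

lemma r'_refl: "a \<in> P \<Longrightarrow> (a, a) \<in> r'"
  using partial_order_onD(1)[OF po'] by (auto simp: refl_on_def)

lemma idealD: "J \<in> \<L> \<Longrightarrow> q \<in> J \<Longrightarrow> (p, q) \<in> r' \<Longrightarrow> p \<in> J"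
  using weaker by (auto simp: order_ideals_def)

lemma top_ideal: "P \<in> \<L>" using order_ideals_top[OF po] .

lemma mx_above: "J \<in> \<L> \<Longrightarrow> q \<in> J \<Longrightarrow> \<exists>p\<in>mx J. (q, p) \<in> r'"
  by (rule max_elems_above[OF po']) (auto dest: order_ideals_subset)

lemma mxD: "p \<in> mx J \<Longrightarrow> p \<in> J" by (auto simp: max_elems_def)

lemma mx_restrict: "p \<in> mx J \<Longrightarrow> p \<in> K \<Longrightarrow> K \<subseteq> J \<Longrightarrow> p \<in> mx K"
  by (auto simp: max_elems_def)

lemma mx_subset_imp: "J \<in> \<L> \<Longrightarrow> K \<in> \<L> \<Longrightarrow> mx J \<subseteq> K \<Longrightarrow> J \<subseteq> K"
  using mx_above idealD by blast

lemma mx_empty [simp]: "mx {} = {}" by (auto simp: max_elems_def)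

lemma mx_inj: "J \<in> \<L> \<Longrightarrow> K \<in> \<L> \<Longrightarrow> mx J = mx K \<Longrightarrow> J = K"
  using mx_subset_imp[of J K] mx_subset_imp[of K J] mxD by blast

lemma v_nth: "v J $ p = (if p \<in> mx J then 1 else 0)"
  by (simp add: v_def indicator_vec_def)

lemma v_empty [simp]: "v {} = 0"
  by (simp add: vec_eq_iff v_nth)

lemma v_inj: "inj_on v \<L>"
proof (rule inj_onI)
  fix J K assume JK: "J \<in> \<L>" "K \<in> \<L>" "v J = v K"
  then have "mx J = mx K" by (auto simp: vec_eq_iff v_nth set_eq_iff split: if_splits)
  then show "J = K" using JK mx_inj by blast
qed

lemma v_integer: "v J \<in> integer_points"
  by (auto simp: integer_points_def v_nth)

section \<open>Maximal elements of unions and star products\<close>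

lemma mem_star:
  assumes "J \<in> \<L>" "K \<in> \<L>"
  shows "p \<in> star J K \<longleftrightarrow> (\<exists>q \<in> J \<inter> K \<inter> (mx J \<union> mx K). (p, q) \<in> r')"
  using ideal_star_eq[OF po' ideal_weaker[OF assms(1)] ideal_weaker[OF assms(2)]] by auto

lemma star_gen: "J \<in> \<L> \<Longrightarrow> K \<in> \<L> \<Longrightarrow> p \<in> J \<Longrightarrow> p \<in> K \<Longrightarrow> p \<in> mx J \<or> p \<in> mx K \<Longrightarrow> p \<in> star J K"
  using mem_star r'_refl order_ideals_subset by blast

lemma star_subset: "J \<in> \<L> \<Longrightarrow> K \<in> \<L> \<Longrightarrow> star J K \<subseteq> J \<inter> K"
  using mem_star idealD by blast

text \<open>All maximal elements of the smaller ideal lie in both ideals, so the star contains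
  generators of the whole smaller ideal.\<close>

lemma star_absorb: 
  assumes "J \<in> \<L>" "K \<in> \<L>" "J \<subseteq> K" shows "star J K = J" "star K J = J"
  using mx_subset_imp[of J "star J K"] mx_subset_imp[of J "star K J"] star_closed[of J K] star_closed[of K J]
    star_gen[of J K] star_gen[of K J] mxD star_subset[of J K] star_subset[of K J] assms by blast+

text \<open>An element of \<open>K\<close> above \<open>p\<close> forces \<open>p\<close> itself
  into the ideal \<open>K\<close>. Hence maximality in the union splits into maximality in those of
  the two ideals that contain \<open>p\<close>.\<close>

lemma mx_Un: 
  assumes "J \<in> \<L>" "K \<in> \<L>"
  shows "p \<in> mx (J \<union> K) \<longleftrightarrow> p \<in> J \<union> K \<and> (p \<in> J \<longrightarrow> p \<in> mx J) \<and> (p \<in> K \<longrightarrow> p \<in> mx K)"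
  using idealD[OF assms(1)] idealD[OF assms(2)] by (auto simp: max_elems_def)

text \<open>A generator is maximal in one of the two ideals and stays maximal in the star, which
  lies in both; every other element of the star lies below a generator.\<close>

lemma mx_star:
  assumes "J \<in> \<L>" "K \<in> \<L>"
  shows "p \<in> mx (star J K) \<longleftrightarrow> p \<in> J \<inter> K \<inter> (mx J \<union> mx K)"
proof
  assume p: "p \<in> mx (star J K)"
  then obtain q where q: "q \<in> J \<inter> K \<inter> (mx J \<union> mx K)" "(p, q) \<in> r'"
    using mem_star[OF assms] mxD by blast
  then have "q \<in> star J K" using star_gen[OF assms] by blast
  then show "p \<in> J \<inter> K \<inter> (mx J \<union> mx K)" using p q by (auto simp: max_elems_def)
next
  assume p: "p \<in> J \<inter> K \<inter> (mx J \<union> mx K)"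
  then have "p \<in> star J K" using star_gen[OF assms] by blast
  then show "p \<in> mx (star J K)"
    using p star_subset[OF assms] mx_restrict[of p J "star J K"] mx_restrict[of p K "star J K"] by blast
qed

text \<open>If \<open>p\<close> lies in both ideals, the union takes the conjunction of the two
  maximality conditions and the star their disjunction, so the two counts agree. If \<open>p\<close>
  lies in only one ideal, only the union sees it.\<close>

lemma v_Un_star:
  assumes "J \<in> \<L>" "K \<in> \<L>"
  shows "v (J \<union> K) + v (star J K) = v J + v K"
  by (auto simp: vec_eq_iff v_nth mx_Un[OF assms] mx_star[OF assms] dest: mxD)

section \<open>Straightening\<close>

definition weights :: "('p set \<Rightarrow> real) set"
  where "weights = {c. (\<forall>J. 0 \<le> c J) \<and> (\<forall>J. J \<notin> \<L> \<longrightarrow> c J = 0)}"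

text \<open>Polymorphic in the values, so that it covers real weights as well as natural
  multiplicities.\<close>

definition chain_supp :: "('p set \<Rightarrow> 'a::zero) \<Rightarrow> bool"
  where "chain_supp c \<longleftrightarrow> (\<forall>J K. c J \<noteq> 0 \<and> c K \<noteq> 0 \<longrightarrow> J \<subseteq> K \<or> K \<subseteq> J)"

definition total :: "('p set \<Rightarrow> real) \<Rightarrow> real" where "total c = (\<Sum>J\<in>\<L>. c J)"
definition bary :: "('p set \<Rightarrow> real) \<Rightarrow> real ^ 'p" where "bary c = (\<Sum>J\<in>\<L>. c J *\<^sub>R v J)"
definition wtotal :: "('p set \<Rightarrow> real) \<Rightarrow> ('p set \<Rightarrow> real) \<Rightarrow> real" where "wtotal w c = (\<Sum>J\<in>\<L>. c J * w J)"

text \<open>Concavity of \<open>w\<close>, tested on the exchange of a pair for its union and star.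
  The zero weight satisfies it, so straightening without a weight is a special case.\<close>

definition superadd :: "('p set \<Rightarrow> real) \<Rightarrow> bool"
  where "superadd w \<longleftrightarrow> (\<forall>J\<in>\<L>. \<forall>K\<in>\<L>. w J + w K \<le> w (J \<union> K) + w (star J K))"

text \<open>Among all admissible weights choose one that maximises the sum of \<open>3 ^ card J\<close>: straightening an incomparable pair
  would increase it, because \<open>J \<union> K\<close> is larger than both members of the pair.\<close>

lemma straighten:
  assumes w: "superadd w" and c: "c \<in> weights"
  shows "\<exists>c'\<in>weights. chain_supp c' \<and> total c' = total c \<and> bary c' = bary c \<and> wtotal w c \<le> wtotal w c'"
proof -
  \<comment> \<open>Weights become vectors so that the admissible ones form a compact set; an
    extremal choice then replaces a proof that repeated straightening of real coefficients
    terminates.\<close>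
  define S where "S = {x :: real ^ 'p set. (\<forall>J. 0 \<le> x $ J) \<and> (\<forall>J. J \<notin> \<L> \<longrightarrow> x $ J = 0) \<and>
     total (\<lambda>J. x $ J) = total c \<and> bary (\<lambda>J. x $ J) = bary c \<and> wtotal w c \<le> wtotal w (\<lambda>J. x $ J)}"
  have "closed S"
    unfolding S_def total_def bary_def wtotal_def imp_conv_disj
    by (intro closed_Collect_conj closed_Collect_all closed_Collect_disj closed_Collect_le
         closed_Collect_eq closed_Collect_const continuous_intros)
  moreover have "bounded S"
  proof -
    have "S \<subseteq> cbox 0 (\<chi> J. total c)"
    proof
      fix x assume x: "x \<in> S"
      have "x $ J \<le> total c" for J
      proof (cases "J \<in> \<L>")
        case True
        then have "x $ J \<le> (\<Sum>J\<in>\<L>. x $ J)"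
          by (intro member_le_sum) (use x in \<open>auto simp: S_def\<close>)
        then show ?thesis using x by (auto simp: S_def total_def)
      next
        case False
        then show ?thesis using x c by (auto simp: S_def total_def weights_def intro!: sum_nonneg)
      qed
      then show "x \<in> cbox 0 (\<chi> J. total c)" using x by (auto simp: S_def mem_box_cart)
    qed
    then show ?thesis using bounded_cbox bounded_subset by blast
  qed
  ultimately have "compact S" by (simp add: compact_eq_bounded_closed)
  moreover have "(\<chi> J. c J) \<in> S"
    using c by (simp add: S_def weights_def total_def bary_def wtotal_def)
  moreover have "continuous_on S (\<lambda>x. \<Sum>J\<in>\<L>. x $ J * 3 ^ card J)"
    by (intro continuous_intros)
  ultimately obtain x where x: "x \<in> S"
      and mx: "\<And>y. y \<in> S \<Longrightarrow> (\<Sum>J\<in>\<L>. y $ J * 3 ^ card J) \<le> (\<Sum>J\<in>\<L>. x $ J * 3 ^ card J)"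
    using continuous_attains_sup[of S "\<lambda>x. \<Sum>J\<in>\<L>. x $ J * 3 ^ card J"] by blast
  have "chain_supp (\<lambda>J. x $ J)"
  proof (rule ccontr)
    assume "\<not> chain_supp (\<lambda>J. x $ J)"
    then obtain J K where JK: "x $ J \<noteq> 0" "x $ K \<noteq> 0" "\<not> J \<subseteq> K" "\<not> K \<subseteq> J"
      by (auto simp: chain_supp_def)
    have L: "J \<in> \<L>" "K \<in> \<L>" using JK x by (auto simp: S_def)
    have L2: "J \<union> K \<in> \<L>" "star J K \<in> \<L>" using L order_ideals_Un star_closed by auto
    \<comment> \<open>The largest amount of the pair that can be exchanged while both coefficients
      stay nonnegative.\<close>
    define e where "e = min (x $ J) (x $ K)"
    have e: "e > 0" "e \<le> x $ J" "e \<le> x $ K"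
      using JK x by (auto simp: e_def S_def less_le)
    define y where "y = x + e *\<^sub>R (axis (J \<union> K) 1 + axis (star J K) 1 - axis J 1 - axis K 1)"
    have sum_y: "(\<Sum>I\<in>\<L>. y $ I *\<^sub>R g I) = (\<Sum>I\<in>\<L>. x $ I *\<^sub>R g I) + e *\<^sub>R (g (J \<union> K) + g (star J K) - g J - g K)"
      for g :: "'p set \<Rightarrow> 'b::real_vector"
    proof -
      have delta: "(\<Sum>I\<in>\<L>. axis A (1::real) $ I *\<^sub>R g I) = g A" if "A \<in> \<L>" for A
      proof -
        have "(\<Sum>I\<in>\<L>. axis A (1::real) $ I *\<^sub>R g I) = (\<Sum>I\<in>\<L>. if I = A then g I else 0)"
          by (intro sum.cong) (auto simp: axis_def)
        then show ?thesis using that by simp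
      qed
      have "(\<Sum>I\<in>\<L>. y $ I *\<^sub>R g I) = (\<Sum>I\<in>\<L>. x $ I *\<^sub>R g I + e *\<^sub>R (axis (J \<union> K) (1::real) $ I *\<^sub>R g I
           + axis (star J K) (1::real) $ I *\<^sub>R g I - axis J (1::real) $ I *\<^sub>R g I - axis K (1::real) $ I *\<^sub>R g I))"
        unfolding y_def by (intro sum.cong refl) (simp add: algebra_simps)
      also have "\<dots> = (\<Sum>I\<in>\<L>. x $ I *\<^sub>R g I) + e *\<^sub>R (g (J \<union> K) + g (star J K) - g J - g K)"
        by (simp add: sum.distrib sum_subtractf scaleR_right.sum[symmetric] delta L L2)
      finally show ?thesis .
    qed
    have "y \<in> S"
    proof -
      have "0 \<le> y $ I" for I
      proof -
        have "0 \<le> x $ I" using x by (simp add: S_def)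
        moreover have "y $ I = x $ I + e * ((if I = J \<union> K then 1 else 0) + (if I = star J K then 1 else 0)
            - (if I = J then 1 else 0) - (if I = K then 1 else 0))"
          by (simp add: y_def axis_def)
        moreover have "e * ((if I = J then 1 else 0) + (if I = K then 1 else 0)) \<le> x $ I"
          using e JK \<open>0 \<le> x $ I\<close> by (cases "I = J"; cases "I = K") auto
        moreover have "0 \<le> e * ((if I = J \<union> K then 1 else 0) + (if I = star J K then 1 else 0))"
          using e by simp
        ultimately show ?thesis unfolding distrib_left right_diff_distrib by linarith
      qed
      moreover have "y $ I = 0" if "I \<notin> \<L>" for I
      proof -
        have "I \<noteq> J" "I \<noteq> K" "I \<noteq> J \<union> K" "I \<noteq> star J K" using that L L2 by blast+
        then show ?thesis using x that by (simp add: y_def axis_def S_def)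
      qed
      moreover have "total (\<lambda>I. y $ I) = total c"
        using sum_y[of "\<lambda>_. 1::real"] x by (simp add: total_def S_def)
      moreover have "bary (\<lambda>I. y $ I) = bary c"
        using sum_y[of v] v_Un_star[OF L] x by (simp add: bary_def S_def)
      moreover have "wtotal w c \<le> wtotal w (\<lambda>I. y $ I)"
      proof -
        have "w J + w K \<le> w (J \<union> K) + w (star J K)" using w L by (simp add: superadd_def)
        then have "0 \<le> e * (w (J \<union> K) + w (star J K) - w J - w K)"
          using e by (intro mult_nonneg_nonneg) linarith+
        then show ?thesis using sum_y[of w] x by (simp add: wtotal_def S_def)
      qed
      ultimately show ?thesis by (simp add: S_def)
    qed
    \<comment> \<open>Each power on the left is at most a third of
      \<open>3 ^ card (J \<union> K)\<close>, so their sum stays below it.\<close>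
    moreover have "(3::real) ^ card J + 3 ^ card K < 3 ^ card (J \<union> K) + 3 ^ card (star J K)"
    proof -
      have "card J < card (J \<union> K)" "card K < card (J \<union> K)"
        using JK by (auto intro!: psubset_card_mono)
      then have "(3::real) ^ Suc (card J) \<le> 3 ^ card (J \<union> K)" "(3::real) ^ Suc (card K) \<le> 3 ^ card (J \<union> K)"
        by (intro power_increasing; simp)+
      moreover have "(0::real) < 3 ^ card (J \<union> K)" "(0::real) < 3 ^ card (star J K)" by simp_all
      ultimately show ?thesis unfolding power_Suc by linarith
    qed
    then have "0 < e * (3 ^ card (J \<union> K) + 3 ^ card (star J K) - 3 ^ card J - 3 ^ card K)"
      using e by (intro mult_pos_pos) auto
    ultimately show False using mx[of y] sum_y[of "\<lambda>J. 3 ^ card J :: real"] by simp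
  qed
  then show ?thesis using x
    by (intro bexI[of _ "\<lambda>J. x $ J"]) (auto simp: S_def weights_def)
qed

section \<open>Uniqueness and integrality of chain representations\<close>

lemma bary_nth: "bary c $ p = (\<Sum>J\<in>\<L>. if p \<in> mx J then c J else 0)"
  by (auto simp: bary_def v_nth intro!: sum.cong)

lemma bary_nth_ne0:
  assumes "c \<in> weights"
  shows "bary c $ p \<noteq> 0 \<longleftrightarrow> (\<exists>J. c J \<noteq> 0 \<and> p \<in> mx J)"
proof -
  have "bary c $ p = 0 \<longleftrightarrow> (\<forall>J\<in>\<L>. (if p \<in> mx J then c J else 0) = 0)"
    unfolding bary_nth using assms by (intro sum_nonneg_eq_0_iff) (auto simp: weights_def)
  then show ?thesis using assms by (auto simp: weights_def)
qed

lemma total_eq_0: "c \<in> weights \<Longrightarrow> total c = 0 \<longleftrightarrow> (\<forall>J. c J = 0)"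
  unfolding total_def by (subst sum_nonneg_eq_0_iff) (auto simp: weights_def)

lemma chain_Union_mem:
  fixes C :: "'p set set"
  assumes "C \<noteq> {}" "\<And>J K. J \<in> C \<Longrightarrow> K \<in> C \<Longrightarrow> J \<subseteq> K \<or> K \<subseteq> J"
  shows "\<Union>C \<in> C"
proof -
  have "finite C" by simp
  then show ?thesis using assms
  proof (induction C rule: finite_ne_induct)
    case (insert A C)
    then have "\<Union>C \<in> C" by blast
    then have "A \<subseteq> \<Union>C \<or> \<Union>C \<subseteq> A" using insert.prems by blast
    then show ?case using \<open>\<Union>C \<in> C\<close> by (auto simp: Un_absorb1 Un_absorb2)
  qed auto
qed

text \<open>Nonnegative terms cannot cancel, so the nonzero coordinates of the barycentre generate
  the union of all ideals in the support. In a chain this union is the largest member, which can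
  therefore be read off from the barycentre.\<close>

lemma chain_top:
  assumes c: "c \<in> weights" "chain_supp c" and ne: "total c \<noteq> 0"
  shows "c {p. \<exists>q. bary c $ q \<noteq> 0 \<and> (p, q) \<in> r'} \<noteq> 0"
proof -
  have "{J. c J \<noteq> 0} \<noteq> {}" using ne total_eq_0[OF c(1)] by auto
  then have "\<Union>{J. c J \<noteq> 0} \<in> {J. c J \<noteq> 0}"
    using c(2) by (intro chain_Union_mem) (auto simp: chain_supp_def)
  moreover have "\<Union>{J. c J \<noteq> 0} = {p. \<exists>q. bary c $ q \<noteq> 0 \<and> (p, q) \<in> r'}"
  proof -
    have J: "p \<in> J \<longleftrightarrow> (\<exists>q\<in>mx J. (p, q) \<in> r')" if "c J \<noteq> 0" for p J
    proof -
      have "J \<in> \<L>" using that c by (auto simp: weights_def)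
      then show ?thesis using mx_above idealD mxD by blast
    qed
    have "\<Union>{J. c J \<noteq> 0} = {p. \<exists>J. c J \<noteq> 0 \<and> p \<in> J}" by auto
    also have "\<dots> = {p. \<exists>J. c J \<noteq> 0 \<and> (\<exists>q\<in>mx J. (p, q) \<in> r')}"
      by (intro Collect_cong ex_cong1 conj_cong refl J)
    also have "\<dots> = {p. \<exists>q. (\<exists>J. c J \<noteq> 0 \<and> q \<in> mx J) \<and> (p, q) \<in> r'}" by auto
    finally show ?thesis unfolding bary_nth_ne0[OF c(1)] .
  qed
  ultimately show ?thesis by simp
qed

text \<open>Greedy comparison: by \<open>chain_top\<close> both supports have the same largest ideal
  \<open>T\<close>, and removing a common multiple of \<open>T\<close> shortens at least one of
  them.\<close>

lemma chain_unique:
  assumes "c \<in> weights" "chain_supp c" "d \<in> weights" "chain_supp d" "total c = total d" "bary c = bary d"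
  shows "c = d"
  using assms
proof (induction "card {J. c J \<noteq> 0} + card {J. d J \<noteq> 0}" arbitrary: c d rule: less_induct)
  case less
  show ?case
  proof (cases "total c = 0")
    case True
    then show ?thesis using total_eq_0[of c] total_eq_0[of d] less.prems by auto
  next
    case False
    define T where "T = {p. \<exists>q. bary c $ q \<noteq> 0 \<and> (p, q) \<in> r'}"
    have T: "c T \<noteq> 0" "d T \<noteq> 0"
      using chain_top[of c] chain_top[of d] less.prems False by (auto simp: T_def)
    then have TL: "T \<in> \<L>" using less.prems by (auto simp: weights_def)
    \<comment> \<open>The minimum keeps both remainders nonnegative and removes \<open>T\<close>
      from at least one support.\<close>
    define m where "m = min (c T) (d T)"
    define c' d' where "c' = c(T := c T - m)" and "d' = d(T := d T - m)"
    have sub: "{J. c' J \<noteq> 0} \<subseteq> {J. c J \<noteq> 0}" "{J. d' J \<noteq> 0} \<subseteq> {J. d J \<noteq> 0}"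
      using T by (auto simp: c'_def d'_def)
    have upd: "(\<Sum>J\<in>\<L>. (f(T := f T - m)) J *\<^sub>R g J) = (\<Sum>J\<in>\<L>. f J *\<^sub>R g J) - m *\<^sub>R g T"
      for f :: "'p set \<Rightarrow> real" and g :: "'p set \<Rightarrow> 'b::real_vector"
      using TL by (simp add: sum.remove[of "\<L>" T] algebra_simps)
    have "c' = d'"
    proof (rule less.hyps)
      show "c' \<in> weights" "d' \<in> weights"
        using less.prems TL by (auto simp: c'_def d'_def weights_def m_def)
      show "chain_supp c'" "chain_supp d'"
        using less.prems sub unfolding chain_supp_def by blast+
      show "total c' = total d'"
        using less.prems upd[of c "\<lambda>_. 1::real"] upd[of d "\<lambda>_. 1::real"]
        by (simp add: c'_def d'_def total_def)
      show "bary c' = bary d'"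
        using less.prems upd[of c v] upd[of d v] by (simp add: c'_def d'_def bary_def)
      have "c' T = 0 \<or> d' T = 0" by (auto simp: c'_def d'_def m_def)
      then have "{J. c' J \<noteq> 0} \<subset> {J. c J \<noteq> 0} \<or> {J. d' J \<noteq> 0} \<subset> {J. d J \<noteq> 0}"
        using sub T by auto
      then show "card {J. c' J \<noteq> 0} + card {J. d' J \<noteq> 0} < card {J. c J \<noteq> 0} + card {J. d J \<noteq> 0}"
        using sub card_mono[OF finite sub(1)] card_mono[OF finite sub(2)]
          psubset_card_mono[of "{J. c J \<noteq> 0}" "{J. c' J \<noteq> 0}"]
          psubset_card_mono[of "{J. d J \<noteq> 0}" "{J. d' J \<noteq> 0}"]
        by (elim disjE) auto
    qed
    show ?thesis
    proof
      fix J
      have "c' J = d' J" using \<open>c' = d'\<close> by simp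
      then show "c J = d J" by (cases "J = T") (auto simp: c'_def d'_def)
    qed
  qed
qed

text \<open>Descend along the chain. A member \<open>J\<close> has a maximal element
  \<open>p\<close> outside all smaller members, so coordinate \<open>p\<close> of the barycentre is
  the coefficient of \<open>J\<close> plus coefficients of larger ideals, which are already
  integral. The empty ideal has no maximal element; its coefficient comes from the total.\<close>

lemma chain_integral:
  assumes c: "c \<in> weights" "chain_supp c" and t: "total c \<in> \<int>" and b: "bary c \<in> integer_points"
  shows "c J \<in> \<int>"
proof -
  have ne: "c J \<in> \<int>" if "J \<noteq> {}" for J
    using that
  proof (induction "card (- J)" arbitrary: J rule: less_induct)
    case less
    show ?case
    proof (cases "c J = 0")
      case False
      then have J: "J \<in> \<L>" using c by (auto simp: weights_def)
      define C where "C = {K. c K \<noteq> 0 \<and> K \<subset> J}"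
      have CL: "C \<subseteq> \<L>" using c by (auto simp: weights_def C_def)
      have "\<Union>C \<in> C \<or> C = {}"
      proof -
        have "I \<subseteq> K \<or> K \<subseteq> I" if "I \<in> C" "K \<in> C" for I K
          using that c(2) by (simp add: C_def chain_supp_def)
        then show ?thesis using chain_Union_mem[of C] by blast
      qed
      moreover have "K \<subset> J" if "K \<in> C" for K using that by (simp add: C_def)
      moreover have "{} \<subset> J" using less.prems by blast
      ultimately have "\<Union>C \<subset> J" "\<Union>C \<in> \<L>"
        using CL order_ideals_empty[of P r] by (metis Union_empty, metis Union_empty subsetD)
      then obtain p where p: "p \<in> mx J" "p \<notin> \<Union>C"
        using mx_subset_imp[OF J, of "\<Union>C"] by blast
      have "bary c $ p = c J + (\<Sum>K\<in>\<L>-{J}. if p \<in> mx K then c K else 0)"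
        unfolding bary_nth using J p by (subst sum.remove[of _ J]) auto
      moreover have "(\<Sum>K\<in>\<L>-{J}. if p \<in> mx K then c K else 0) \<in> \<int>"
      proof (intro Ints_sum)
        fix K assume K: "K \<in> \<L> - {J}"
        show "(if p \<in> mx K then c K else 0) \<in> \<int>"
        proof (cases "p \<in> mx K \<and> c K \<noteq> 0")
          case True
          then have "K \<notin> C" using p mxD by blast
          then have "J \<subset> K" using True False c(2) K by (auto simp: C_def chain_supp_def)
          then have "card (- K) < card (- J)" by (intro psubset_card_mono) auto
          then show ?thesis using less.hyps[of K] \<open>J \<subset> K\<close> True by auto
        qed auto
      qed
      moreover have "bary c $ p \<in> \<int>" using b by (auto simp: integer_points_def)
      ultimately show ?thesis by (metis Ints_diff add_diff_cancel_right')
    qed auto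
  qed
  have "total c = c {} + (\<Sum>K\<in>\<L>-{{}}. c K)"
    unfolding total_def by (subst sum.remove[of _ "{}"]) (auto simp: order_ideals_empty)
  moreover have "(\<Sum>K\<in>\<L>-{{}}. c K) \<in> \<int>" using ne by (intro Ints_sum) auto
  ultimately have "c {} \<in> \<int>" using t by (metis Ints_diff add_diff_cancel_right')
  then show ?thesis using ne by (cases "J = {}") auto
qed

lemma superadd_zero: "superadd (\<lambda>_. 0)" by (simp add: superadd_def)

lemma straighten_nat:
  assumes w: "superadd w" and c: "c \<in> weights" and k: "total c = real k" and b: "bary c \<in> integer_points"
  shows "\<exists>m::'p set \<Rightarrow> nat. (\<lambda>J. real (m J)) \<in> weights \<and> chain_supp m \<and> sum m \<L> = k \<and>
    bary (\<lambda>J. real (m J)) = bary c \<and> wtotal w c \<le> wtotal w (\<lambda>J. real (m J))"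
proof -
  obtain d where d: "d \<in> weights" "chain_supp d" "total d = total c" "bary d = bary c" "wtotal w c \<le> wtotal w d"
    using straighten[OF w c] by blast
  have "d J \<in> \<nat>" for J
  proof -
    have "d J \<in> \<int>" using chain_integral[of d J] d k b by simp
    moreover have "0 \<le> d J" using d by (simp add: weights_def)
    ultimately show ?thesis by (simp add: Nats_altdef2)
  qed
  then have "\<forall>J. \<exists>m. d J = real m" by (meson Nats_cases)
  then have "\<exists>m. \<forall>J. d J = real (m J)" by (rule choice)
  then obtain m where m: "d = (\<lambda>J. real (m J))" by auto
  moreover have "sum m \<L> = k" using d k m by (simp add: total_def flip: of_nat_sum)
  ultimately show ?thesis using d by (intro exI[of _ m]) (auto simp: chain_supp_def)
qed

end

section \<open>Normality and Ehrhart equivalence\<close>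

lemma convex_hull_image:
  fixes v :: "'i \<Rightarrow> 'a::real_vector"
  assumes "finite M" "inj_on v M"
  shows "convex hull (v ` M) = {\<Sum>J\<in>M. c J *\<^sub>R v J | c. (\<forall>J\<in>M. 0 \<le> c J) \<and> sum c M = 1}"
proof -
  have "convex hull (v ` M) = {y. \<exists>u. (\<forall>x\<in>v ` M. 0 \<le> u x) \<and> sum u (v ` M) = 1 \<and> (\<Sum>x\<in>v ` M. u x *\<^sub>R x) = y}"
    by (rule convex_hull_finite) (use assms in auto)
  also have "\<dots> = {\<Sum>J\<in>M. c J *\<^sub>R v J | c. (\<forall>J\<in>M. 0 \<le> c J) \<and> sum c M = 1}" (is "?A = ?B")
  proof (intro equalityI subsetI)
    fix y assume "y \<in> ?A"
    then obtain u where u: "\<forall>x\<in>v ` M. 0 \<le> u x" "sum u (v ` M) = 1" "(\<Sum>x\<in>v ` M. u x *\<^sub>R x) = y" by blast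
    have "sum (u \<circ> v) M = 1" "(\<Sum>J\<in>M. (u \<circ> v) J *\<^sub>R v J) = y"
      using u(2,3) sum.reindex[OF assms(2), of u] sum.reindex[OF assms(2), of "\<lambda>x. u x *\<^sub>R x"] by (simp_all add: o_def)
    moreover have "\<forall>J\<in>M. 0 \<le> (u \<circ> v) J" using u by simp
    ultimately show "y \<in> ?B" by blast
  next
    fix y assume "y \<in> ?B"
    then obtain c where c: "\<forall>J\<in>M. 0 \<le> c J" "sum c M = 1" "y = (\<Sum>J\<in>M. c J *\<^sub>R v J)" by blast
    define u where "u = c \<circ> the_inv_into M v"
    have u: "u (v J) = c J" if "J \<in> M" for J
      using that assms by (simp add: u_def the_inv_into_f_f)
    have "sum u (v ` M) = 1" "(\<Sum>x\<in>v ` M. u x *\<^sub>R x) = y"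
      using c u by (simp_all add: sum.reindex[OF assms(2)] cong: sum.cong)
    moreover have "\<forall>x\<in>v ` M. 0 \<le> u x" using c u by auto
    ultimately show "y \<in> ?A" by blast
  qed
  finally show ?thesis .
qed

context relative_poset
begin

lemma sum_nonneg_extend:
  assumes "\<forall>J\<in>\<L>. 0 \<le> c J"
  obtains d where "d \<in> weights" "total d = sum c \<L>" "bary d = (\<Sum>J\<in>\<L>. c J *\<^sub>R v J)"
    "\<And>J. J \<in> \<L> \<Longrightarrow> d J = c J"
proof
  show "(\<lambda>J. if J \<in> \<L> then c J else 0) \<in> weights" using assms by (auto simp: weights_def)
qed (auto simp: total_def bary_def intro!: sum.cong)

lemma polytope_eq: "rel_poset_polytope P r r' = {bary c | c. c \<in> weights \<and> total c = 1}"
proof -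
  have "rel_poset_polytope P r r' = convex hull (v ` \<L>)"
    by (simp add: rel_poset_polytope_def v_def)
  also have "\<dots> = {bary c | c. c \<in> weights \<and> total c = 1}"
  proof (subst convex_hull_image[OF finite v_inj], intro equalityI subsetI)
    fix y assume "y \<in> {\<Sum>J\<in>\<L>. c J *\<^sub>R v J | c. (\<forall>J\<in>\<L>. 0 \<le> c J) \<and> sum c \<L> = 1}"
    then obtain c where c: "\<forall>J\<in>\<L>. 0 \<le> c J" "sum c \<L> = 1" "y = (\<Sum>J\<in>\<L>. c J *\<^sub>R v J)" by auto
    obtain d where d: "d \<in> weights" "total d = sum c \<L>" "bary d = (\<Sum>J\<in>\<L>. c J *\<^sub>R v J)"
      using sum_nonneg_extend[OF c(1)] by metis
    show "y \<in> {bary c | c. c \<in> weights \<and> total c = 1}"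
      unfolding c(3) d(3)[symmetric] using d(1,2) c(2) by auto
  qed (auto simp: bary_def total_def weights_def)
  finally show ?thesis .
qed

lemma bary_scale: "bary (\<lambda>J. a * c J) = a *\<^sub>R bary c"
  by (simp add: bary_def scaleR_sum_right)

lemma total_scale: "total (\<lambda>J. a * c J) = a * total c"
  by (simp add: total_def sum_distrib_left)

lemma dilate_eq: "dilate k (rel_poset_polytope P r r') = {bary c | c. c \<in> weights \<and> total c = real k}"
proof (intro equalityI subsetI)
  fix x assume "x \<in> dilate k (rel_poset_polytope P r r')"
  then obtain c where c: "c \<in> weights" "total c = 1" "x = real k *\<^sub>R bary c"
    by (auto simp: dilate_def polytope_eq)
  then show "x \<in> {bary c | c. c \<in> weights \<and> total c = real k}"
    by (auto intro!: exI[of _ "\<lambda>J. real k * c J"] simp: bary_scale total_scale weights_def)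
next
  fix x assume "x \<in> {bary c | c. c \<in> weights \<and> total c = real k}"
  then obtain c where c: "c \<in> weights" "total c = real k" "x = bary c" by auto
  show "x \<in> dilate k (rel_poset_polytope P r r')"
  proof (cases "k = 0")
    \<comment> \<open>Division by \<open>k\<close> fails here, but a nonnegative weight with total 0
      vanishes and the dilate of a nonempty polytope by 0 is the origin.\<close>
    case True
    then have "\<forall>J. c J = 0" using c total_eq_0 by simp
    then have "x = 0" using c by (simp add: bary_def)
    moreover have "rel_poset_polytope P r r' \<noteq> {}"
      unfolding rel_poset_polytope_def using top_ideal by auto
    ultimately show ?thesis using True by (auto simp: dilate_def)
  next
    case False
    have "(\<lambda>J. (1 / real k) * c J) \<in> weights" using c by (auto simp: weights_def)
    moreover have "total (\<lambda>J. (1 / real k) * c J) = 1" unfolding total_scale using c False by simp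
    ultimately have "bary (\<lambda>J. (1 / real k) * c J) \<in> rel_poset_polytope P r r'"
      unfolding polytope_eq by blast
    moreover have "x = real k *\<^sub>R bary (\<lambda>J. (1 / real k) * c J)"
      unfolding bary_scale using c False by simp
    ultimately show ?thesis by (auto simp: dilate_def)
  qed
qed

lemma lattice: "lattice_polytope (rel_poset_polytope P r r')"
  unfolding lattice_polytope_def rel_poset_polytope_def
  using v_integer by (intro exI[of _ "(\<lambda>J. indicator_vec (mx J)) ` \<L>"]) (auto simp: v_def)

lemma v_in_polytope: "J \<in> \<L> \<Longrightarrow> v J \<in> rel_poset_polytope P r r'"
  unfolding rel_poset_polytope_def v_def by (intro hull_inc) auto

lemma lattice_point_nat:
  assumes "x \<in> dilate k (rel_poset_polytope P r r')" "x \<in> integer_points"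
  shows "\<exists>m::'p set \<Rightarrow> nat. (\<lambda>J. real (m J)) \<in> weights \<and> chain_supp m \<and> sum m \<L> = k \<and>
    bary (\<lambda>J. real (m J)) = x"
  using assms straighten_nat[OF superadd_zero] unfolding dilate_eq by fastforce

text \<open>Turns multiplicities into a sequence of length \<open>k\<close>, the form in which
  normality asks for the summands.\<close>

lemma nat_weight_list:
  fixes m :: "'a \<Rightarrow> nat"
  assumes "finite A" "sum m A = k"
  shows "\<exists>f. (\<forall>i<k. f i \<in> A) \<and> (\<Sum>i<k. g (f i)) = (\<Sum>J\<in>A. real (m J) *\<^sub>R g J :: 'b::real_vector)"
  using assms
proof (induction A arbitrary: k rule: finite_induct)
  case (insert a A)
  obtain f where f: "\<forall>i<sum m A. f i \<in> A" "(\<Sum>i<sum m A. g (f i)) = (\<Sum>J\<in>A. real (m J) *\<^sub>R g J)"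
    using insert.IH by blast
  have k: "k = sum m A + m a" using insert by simp
  define f' where "f' i = (if i < sum m A then f i else a)" for i
  have "(\<Sum>i<k. g (f' i)) = (\<Sum>i<sum m A. g (f' i)) + (\<Sum>i\<in>{sum m A..<k}. g (f' i))"
    by (subst sum.union_disjoint[symmetric]) (auto simp: k intro!: sum.cong)
  also have "(\<Sum>i<sum m A. g (f' i)) = (\<Sum>i<sum m A. g (f i))" by (simp add: f'_def)
  also have "(\<Sum>i\<in>{sum m A..<k}. g (f' i)) = real (m a) *\<^sub>R g a"
  proof -
    have "(\<Sum>i\<in>{sum m A..<k}. g (f' i)) = (\<Sum>i\<in>{sum m A..<k}. g a)" by (intro sum.cong) (auto simp: f'_def)
    then show ?thesis by (simp add: k sum_constant_scaleR)
  qed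
  finally have "(\<Sum>i<k. g (f' i)) = (\<Sum>J\<in>insert a A. real (m J) *\<^sub>R g J)" using f insert by simp
  moreover have "\<forall>i<k. f' i \<in> insert a A" using f by (auto simp: f'_def)
  ultimately show ?case by blast
qed auto

lemma normal: "normal_polytope (rel_poset_polytope P r r')"
  unfolding normal_polytope_def
proof (intro conjI allI impI ballI lattice)
  fix k :: nat and x assume "x \<in> dilate k (rel_poset_polytope P r r') \<inter> integer_points"
  then obtain m :: "'p set \<Rightarrow> nat" where m: "sum m \<L> = k" "bary (\<lambda>J. real (m J)) = x"
    using lattice_point_nat by blast
  obtain f where f: "\<forall>i<k. f i \<in> \<L>" "(\<Sum>i<k. v (f i)) = (\<Sum>J\<in>\<L>. real (m J) *\<^sub>R v J)"
    using nat_weight_list[OF finite m(1), of v] by blast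
  have "\<forall>i<k. v (f i) \<in> rel_poset_polytope P r r' \<inter> integer_points"
    using f(1) v_in_polytope v_integer by blast
  moreover have "x = (\<Sum>i<k. v (f i))" using f m by (simp add: bary_def)
  ultimately show "\<exists>y. (\<forall>i<k. y i \<in> rel_poset_polytope P r r' \<inter> integer_points) \<and> x = sum y {..<k}"
    by (intro exI[of _ "\<lambda>i. v (f i)"]) auto
qed

end

text \<open>Placed outside the locale and stated in terms of \<open>r\<close> alone, so that one and
  the same number counts the lattice points for every admissible \<open>r'\<close>.\<close>

definition multichains :: "'p::finite set \<Rightarrow> 'p rel \<Rightarrow> nat \<Rightarrow> ('p set \<Rightarrow> nat) set"
  where "multichains P r k = {m. (\<forall>J. J \<notin> order_ideals P r \<longrightarrow> m J = 0) \<and>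
    (\<forall>J K. m J \<noteq> 0 \<and> m K \<noteq> 0 \<longrightarrow> J \<subseteq> K \<or> K \<subseteq> J) \<and> sum m (order_ideals P r) = k}"

context relative_poset
begin

lemma lattice_points_bij:
  "bij_betw (\<lambda>m. bary (\<lambda>J. real (m J))) (multichains P r k)
     (dilate k (rel_poset_polytope P r r') \<inter> integer_points)"
proof (rule bij_betw_imageI)
  have W: "(\<lambda>J. real (m J)) \<in> weights" if "m \<in> multichains P r k" for m
    using that by (auto simp: multichains_def weights_def)
  have C: "chain_supp (\<lambda>J. real (m J))" if "m \<in> multichains P r k" for m
    using that by (simp add: multichains_def chain_supp_def)
  have T: "total (\<lambda>J. real (m J)) = real k" if "m \<in> multichains P r k" for m
    using that by (auto simp: multichains_def total_def)
  show "inj_on (\<lambda>m. bary (\<lambda>J. real (m J))) (multichains P r k)"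
  proof (rule inj_onI)
    fix m n assume mn: "m \<in> multichains P r k" "n \<in> multichains P r k"
      "bary (\<lambda>J. real (m J)) = bary (\<lambda>J. real (n J))"
    then have "(\<lambda>J. real (m J)) = (\<lambda>J. real (n J))"
      using T by (intro chain_unique W C) auto
    then show "m = n" by (metis ext of_nat_eq_iff)
  qed
  show "(\<lambda>m. bary (\<lambda>J. real (m J))) ` multichains P r k = dilate k (rel_poset_polytope P r r') \<inter> integer_points"
  proof (intro equalityI subsetI)
    fix x assume "x \<in> (\<lambda>m. bary (\<lambda>J. real (m J))) ` multichains P r k"
    then obtain m where m: "m \<in> multichains P r k" "x = bary (\<lambda>J. real (m J))" by auto
    have "x \<in> integer_points" using m(2) by (auto simp: integer_points_def bary_nth intro!: Ints_sum)
    then show "x \<in> dilate k (rel_poset_polytope P r r') \<inter> integer_points"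
      using m W[OF m(1)] T[OF m(1)] by (auto simp: dilate_eq)
  next
    fix x assume "x \<in> dilate k (rel_poset_polytope P r r') \<inter> integer_points"
    then obtain m :: "'p set \<Rightarrow> nat" where m: "(\<lambda>J. real (m J)) \<in> weights" "chain_supp m" "sum m \<L> = k"
      "bary (\<lambda>J. real (m J)) = x"
      using lattice_point_nat by blast
    then have "m \<in> multichains P r k" by (simp add: multichains_def weights_def chain_supp_def)
    then show "x \<in> (\<lambda>m. bary (\<lambda>J. real (m J))) ` multichains P r k" using m(4) by auto
  qed
qed

lemma card_lattice_points:
  "card (dilate k (rel_poset_polytope P r r') \<inter> integer_points) = card (multichains P r k)"
  using bij_betw_same_card[OF lattice_points_bij] by simp

end

lemma ehrhart_same_order:
  assumes "relative_orders P r r1" "relative_orders P r r2"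
  shows "ehrhart_equivalent (rel_poset_polytope P r r1) (rel_poset_polytope P r r2)"
proof -
  interpret a: relative_poset P r r1 using assms by (simp add: relative_poset_def)
  interpret b: relative_poset P r r2 using assms by (simp add: relative_poset_def)
  show ?thesis
    by (simp add: ehrhart_equivalent_def a.lattice b.lattice a.card_lattice_points b.card_lattice_points)
qed

section \<open>The order polytope and the chain polytope as relative poset polytopes\<close>

text \<open>Under equality every element is maximal, so the star is the intersection.\<close>

lemma relative_orders_discrete:
  assumes "partial_order_on P r" shows "relative_orders P r (Id_on P)"
proof -
  note p = partial_order_onD[OF assms]
  have po: "partial_order_on P (Id_on P)"
    by (auto simp: partial_order_on_def preorder_on_def refl_on_def trans_def antisym_def)
  have "ideal_star P (Id_on P) J K = J \<inter> K" if "J \<in> order_ideals P r" "K \<in> order_ideals P r" for J K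
  proof -
    have "J \<in> order_ideals P (Id_on P)" "K \<in> order_ideals P (Id_on P)" "J \<subseteq> P"
      using that by (auto simp: order_ideals_def)
    then show ?thesis by (subst ideal_star_eq[OF po]) (auto simp: max_elems_def)
  qed
  then show ?thesis using assms po p(1) order_ideals_Int by (auto simp: relative_orders_def refl_on_def)
qed

lemma relative_orders_refl:
  assumes "partial_order_on P r" shows "relative_orders P r r"
proof -
  note p = partial_order_onD[OF assms]
  have "ideal_star P r J K \<in> order_ideals P r" if "J \<in> order_ideals P r" "K \<in> order_ideals P r" for J K
    unfolding ideal_star_eq[OF assms that] order_ideals_def
    using p(2,4) by (auto dest: transD)
  then show ?thesis using assms by (auto simp: relative_orders_def)
qed

text \<open>Puts back the layer removed in the two peeling arguments below; with the empty ideal,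
  whose vector is 0, it also raises the total to the prescribed value.\<close>

lemma weights_add_point:
  fixes P :: "'p::finite set"
  assumes "relative_poset P r r'" "c \<in> relative_poset.weights P r" "J \<in> order_ideals P r" "0 \<le> e"
  shows "\<exists>d \<in> relative_poset.weights P r. relative_poset.total P r d = relative_poset.total P r c + e \<and>
    relative_poset.bary P r r' d = relative_poset.bary P r r' c + e *\<^sub>R indicator_vec (max_elems r' J)"
proof -
  interpret relative_poset P r r' by fact
  define d where "d = c(J := c J + e)"
  have "(\<Sum>K\<in>\<L>. d K *\<^sub>R g K) = (\<Sum>K\<in>\<L>. c K *\<^sub>R g K) + e *\<^sub>R g J" for g :: "'p set \<Rightarrow> 'b::real_vector"
    using assms(3) by (simp add: d_def sum.remove[of "\<L>" J] algebra_simps)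
  from this[of v] this[of "\<lambda>_. 1::real"] show ?thesis
    using assms by (intro bexI[of _ d]) (auto simp: total_def bary_def v_def d_def weights_def)
qed

text \<open>Level sets: the support of a point is an order ideal, and subtracting its smallest
  coordinate times the indicator of the support makes the support smaller. What remains of the bound
  at the end becomes the coefficient of the empty ideal.\<close>

lemma order_polytope_eq:
  fixes P :: "'p::finite set"
  assumes po: "partial_order_on P r"
  shows "order_polytope P r = rel_poset_polytope P r (Id_on P)"
proof
  note p = partial_order_onD[OF po]
  interpret relative_poset P r "Id_on P"
    using relative_orders_discrete[OF po] by (simp add: relative_poset_def)
  have mx: "mx J = J" for J by (auto simp: max_elems_def)
  show "rel_poset_polytope P r (Id_on P) \<subseteq> order_polytope P r"
    unfolding rel_poset_polytope_def
  proof (rule hull_minimal)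
    show "(\<lambda>J. indicator_vec (mx J)) ` \<L> \<subseteq> order_polytope P r"
      by (auto simp: order_polytope_def indicator_vec_def mx order_ideals_def)
    show "convex (order_polytope P r)"
      unfolding convex_alt order_polytope_def
      by (auto simp: convex_bound_le intro!: add_mono mult_left_mono)
  qed
  \<comment> \<open>The upper bound \<open>l\<close> is a variable because the remainder satisfies
    the same inequalities with bound \<open>l - e\<close>.\<close>
  have peel: "\<exists>c\<in>weights. total c = l \<and> bary c = x"
    if "\<forall>p. p \<notin> P \<longrightarrow> x $ p = 0" "\<forall>p\<in>P. 0 \<le> x $ p \<and> x $ p \<le> l"
      "\<forall>p\<in>P. \<forall>q\<in>P. (q, p) \<in> r \<and> q \<noteq> p \<longrightarrow> x $ p \<le> x $ q" "0 \<le> l" for x :: "real ^ 'p" and l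
    using that
  proof (induction "card {p. x $ p \<noteq> 0}" arbitrary: x l rule: less_induct)
    case less
    define J where "J = {p. x $ p \<noteq> 0}"
    show ?case
    proof (cases "J = {}")
      case True
      then have "x = 0" by (auto simp: J_def vec_eq_iff)
      have "(\<lambda>_. 0) \<in> weights" "total (\<lambda>_. 0) = 0" "bary (\<lambda>_. 0) = 0" by (auto simp: weights_def total_def bary_def)
      with weights_add_point[OF relative_poset_axioms this(1) order_ideals_empty less.prems(4)] show ?thesis
        using \<open>x = 0\<close> by (auto simp: mx indicator_vec_def vec_eq_iff)
    next
      case False
      have JP: "J \<subseteq> P" using less.prems by (auto simp: J_def)
      have JL: "J \<in> \<L>"
        unfolding order_ideals_def
      proof (intro CollectI conjI JP ballI allI impI)
        fix q p assume "q \<in> J" "(p, q) \<in> r"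
        then have "p \<in> P" "q \<in> P" using p(4) by auto
        then have "0 < x $ q" "x $ q \<le> x $ p"
          using \<open>q \<in> J\<close> less.prems \<open>(p, q) \<in> r\<close> by (force simp: J_def less_le, metis order_refl)
        then show "p \<in> J" by (auto simp: J_def)
      qed
      obtain s where s: "s \<in> J" "\<And>p. p \<in> J \<Longrightarrow> x $ s \<le> x $ p"
        using ex_min_if_finite[of "(\<lambda>p. x $ p) ` J"] False by (auto simp: not_less)
      define e where "e = x $ s"
      have e: "0 < e" "e \<le> l" using s JP less.prems by (auto simp: e_def J_def less_le)
      define y where "y = x - e *\<^sub>R indicator_vec J"
      have y: "y $ p = (if p \<in> J then x $ p - e else 0)" for p
        by (auto simp: y_def indicator_vec_def J_def)
      have "{p. y $ p \<noteq> 0} \<subset> {p. x $ p \<noteq> 0}"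
        using s by (auto simp: y J_def e_def split: if_splits)
      then have lt: "card {p. y $ p \<noteq> 0} < card {p. x $ p \<noteq> 0}" by (intro psubset_card_mono) auto
      have "\<exists>c\<in>weights. total c = l - e \<and> bary c = y"
      proof (rule less.hyps[OF lt])
        show "\<forall>p. p \<notin> P \<longrightarrow> y $ p = 0" using JP by (auto simp: y)
        show "\<forall>p\<in>P. 0 \<le> y $ p \<and> y $ p \<le> l - e" using less.prems s e by (auto simp: y e_def)
        show "0 \<le> l - e" using e by simp
        show "\<forall>p\<in>P. \<forall>q\<in>P. (q, p) \<in> r \<and> q \<noteq> p \<longrightarrow> y $ p \<le> y $ q"
          using less.prems(3) s(2) JL by (auto simp: y e_def order_ideals_def)
      qed
      then obtain c where "c \<in> weights" "total c = l - e" "bary c = y" by blast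
      with weights_add_point[OF relative_poset_axioms this(1) JL, of e] e show ?thesis
        by (auto simp: y_def mx)
    qed
  qed
  show "order_polytope P r \<subseteq> rel_poset_polytope P r (Id_on P)"
  proof
    fix x assume "x \<in> order_polytope P r"
    then show "x \<in> rel_poset_polytope P r (Id_on P)"
      using peel[of x 1] by (auto simp: order_polytope_def polytope_eq)
  qed
qed

text \<open>The layer to peel off is the antichain of maximal elements of the support, with its
  smallest coordinate \<open>e\<close> as coefficient. Every chain in the support extends to one
  that meets this antichain, so all chain bounds drop by \<open>e\<close>.\<close>

lemma chain_polytope_eq:
  fixes P :: "'p::finite set"
  assumes po: "partial_order_on P r"
  shows "chain_polytope P r = rel_poset_polytope P r r"
proof
  note p = partial_order_onD[OF po]
  interpret relative_poset P r r
    using relative_orders_refl[OF po] by (simp add: relative_poset_def)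
  show "rel_poset_polytope P r r \<subseteq> chain_polytope P r"
    unfolding rel_poset_polytope_def
  proof (rule hull_minimal)
    show "(\<lambda>J. indicator_vec (mx J)) ` \<L> \<subseteq> chain_polytope P r"
    proof
      fix x :: "real ^ 'p" assume "x \<in> (\<lambda>J. indicator_vec (mx J)) ` \<L>"
      then obtain J where J: "J \<in> \<L>" "x = indicator_vec (mx J)" by auto
      have "(\<Sum>p\<in>C. x $ p) \<le> 1" if C: "C \<subseteq> P" "C \<in> Chains r" for C
      proof -
        have "C \<inter> mx J \<subseteq> {p}" if "p \<in> C \<inter> mx J" for p
          using that C unfolding Chains_def max_elems_def by blast
        then have "card (C \<inter> mx J) \<le> 1"
          by (metis all_not_in_conv card.empty card_mono finite.emptyI finite.insertI
              is_singletonI is_singleton_altdef nat_le_linear not_one_le_zero)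
        moreover have "(\<Sum>p\<in>C. x $ p) = real (card (C \<inter> mx J))"
          unfolding J by (simp add: indicator_vec_def sum.If_cases Int_def)
        ultimately show ?thesis by simp
      qed
      then show "x \<in> chain_polytope P r"
        using J mxD by (auto simp: chain_polytope_def indicator_vec_def order_ideals_def)
    qed
    show "convex (chain_polytope P r)"
      unfolding convex_alt chain_polytope_def
      by (auto simp: sum.distrib convex_bound_le simp flip: sum_distrib_left intro!: add_nonneg_nonneg mult_nonneg_nonneg)
  qed
  have peel: "\<exists>c\<in>weights. total c = l \<and> bary c = x"
    if "\<forall>p. p \<notin> P \<longrightarrow> x $ p = 0" "\<forall>p. 0 \<le> x $ p"
      "\<forall>C. C \<subseteq> P \<and> C \<in> Chains r \<longrightarrow> (\<Sum>p\<in>C. x $ p) \<le> l" for x :: "real ^ 'p" and l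
    using that
  proof (induction "card {p. x $ p \<noteq> 0}" arbitrary: x l rule: less_induct)
    case less
    define S where "S = {p. x $ p \<noteq> 0}"
    have l: "0 \<le> l" using less.prems(3)[rule_format, of "{}"] by (auto simp: Chains_def)
    show ?case
    proof (cases "S = {}")
      case True
      then have "x = 0" by (auto simp: S_def vec_eq_iff)
      have "(\<lambda>_. 0) \<in> weights" "total (\<lambda>_. 0) = 0" "bary (\<lambda>_. 0) = 0" by (auto simp: weights_def total_def bary_def)
      with weights_add_point[OF relative_poset_axioms this(1) order_ideals_empty l] show ?thesis
        using \<open>x = 0\<close> by (auto simp: indicator_vec_def vec_eq_iff)
    next
      case False
      have SP: "S \<subseteq> P" using less.prems by (auto simp: S_def)
      define J where "J = {p. \<exists>q\<in>S. (p, q) \<in> r}"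
      have JL: "J \<in> \<L>" using p(2,4) by (auto simp: order_ideals_def J_def dest: transD)
      have above: "\<exists>a\<in>mx S. (q, a) \<in> r" if "q \<in> S" for q
        by (rule max_elems_above[OF po SP finite that])
      have SJ: "S \<subseteq> J" using SP r'_refl by (auto simp: J_def)
      have mxJ: "mx J = mx S"
      proof (intro equalityI subsetI)
        fix q assume q: "q \<in> mx J"
        then have "q \<in> S" using SJ by (auto simp: max_elems_def J_def) 
        then show "q \<in> mx S" using mx_restrict[OF q _ SJ] by auto
      next
        fix q assume q: "q \<in> mx S"
        show "q \<in> mx J"
        proof (rule ccontr)
          assume "q \<notin> mx J"
          then obtain s where s: "s \<in> J" "(q, s) \<in> r" "q \<noteq> s" using q SJ by (auto simp: max_elems_def)
          then obtain t where t: "t \<in> S" "(s, t) \<in> r" by (auto simp: J_def)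
          then have "(q, t) \<in> r" using s r'_trans by blast
          then have "t = q" using q t by (auto simp: max_elems_def)
          then show False using s t p(3) by (auto dest: antisymD)
        qed
      qed
      have "mx S \<noteq> {}" using False above by fastforce
      then obtain s where s: "s \<in> mx S" "\<And>p. p \<in> mx S \<Longrightarrow> x $ s \<le> x $ p"
        using ex_min_if_finite[of "(\<lambda>p. x $ p) ` mx S"] by (auto simp: not_less)
      define e where "e = x $ s"
      have e: "0 < e" using s mxD[OF s(1)] less.prems by (auto simp: e_def S_def less_le)
      define y where "y = x - e *\<^sub>R indicator_vec (mx S)"
      have y: "y $ p = (if p \<in> mx S then x $ p - e else x $ p)" for p
        by (auto simp: y_def indicator_vec_def)
      have "{p. y $ p \<noteq> 0} \<subseteq> {p. x $ p \<noteq> 0}" "y $ s = 0" "x $ s \<noteq> 0"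
        using s e mxD[of _ S] by (auto simp: y S_def e_def split: if_splits)
      then have lt: "card {p. y $ p \<noteq> 0} < card {p. x $ p \<noteq> 0}" by (intro psubset_card_mono) auto
      have "\<exists>c\<in>weights. total c = l - e \<and> bary c = y"
      proof (rule less.hyps[OF lt])
        show "\<forall>p. p \<notin> P \<longrightarrow> y $ p = 0" using less.prems(1) SP mxD by (auto simp: y)
        show ynn: "\<forall>p. 0 \<le> y $ p" using less.prems s e by (auto simp: y e_def)
        show "\<forall>C. C \<subseteq> P \<and> C \<in> Chains r \<longrightarrow> (\<Sum>p\<in>C. y $ p) \<le> l - e"
        proof (intro allI impI)
          fix C0 assume C0: "C0 \<subseteq> P \<and> C0 \<in> Chains r"
          \<comment> \<open>Members outside the support contribute nothing, and those inside lie
            below a maximal element of \<open>S\<close>.\<close>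
          define C where "C = C0 \<inter> S"
          have C: "C \<subseteq> P" "C \<in> Chains r" "C \<subseteq> S" using C0 by (auto simp: C_def Chains_def)
          have y0: "y $ p = 0" if "p \<notin> S" for p using that mxD by (auto simp: y S_def)
          have eq: "(\<Sum>p\<in>C0. y $ p) = (\<Sum>p\<in>C. y $ p)"
            unfolding C_def using y0 by (intro sum.mono_neutral_right) auto
          have yx: "y $ p \<le> x $ p" for p using e by (simp add: y)
          \<comment> \<open>The chain is prolonged by a maximal element of the support above its
            top; the bound for the longer chain leaves room for the subtraction of
            \<open>e\<close>.\<close>
          have "\<exists>a\<in>mx S. insert a C \<in> Chains r"
          proof (cases "C = {}")
            case True
            then show ?thesis using s(1) r'_refl SP mxD[OF s(1)]
              by (intro bexI[of _ s]) (auto simp: Chains_def)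
          next
            case False
            obtain q where q: "q \<in> mx C" using max_elems_above[OF po C(1) finite] False by blast
            then obtain a where a: "a \<in> mx S" "(q, a) \<in> r" using above[of q] mxD C(3) by blast
            have "(t, a) \<in> r" if "t \<in> C" for t
            proof -
              have "(t, q) \<in> r \<or> (q, t) \<in> r" using C(2) that q by (auto simp: Chains_def max_elems_def)
              then have "(t, q) \<in> r" using q that C(1) r'_refl by (auto simp: max_elems_def)
              then show ?thesis using a r'_trans by blast
            qed
            then have "insert a C \<in> Chains r" using C(2) a(2) SP mxD[OF a(1)] r'_refl by (auto simp: Chains_def)
            then show ?thesis using a by blast
          qed
          then obtain a where a: "a \<in> mx S" "insert a C \<in> Chains r" by blast
          have "(\<Sum>p\<in>C. y $ p) \<le> (\<Sum>p\<in>insert a C. y $ p)"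
            using ynn by (intro sum_mono2) auto
          also have "\<dots> = y $ a + (\<Sum>p\<in>C - {a}. y $ p)"
            by (simp add: sum.insert_remove)
          also have "\<dots> \<le> (x $ a - e) + (\<Sum>p\<in>C - {a}. x $ p)"
            using a yx by (intro add_mono sum_mono) (auto simp: y)
          also have "\<dots> = (\<Sum>p\<in>insert a C. x $ p) - e"
            by (simp add: sum.insert_remove)
          also have "\<dots> \<le> l - e"
            using less.prems(3) a(2) C(1) SP mxD[OF a(1)] by auto
          finally show "(\<Sum>p\<in>C0. y $ p) \<le> l - e" using eq by simp
        qed
      qed
      then obtain c where "c \<in> weights" "total c = l - e" "bary c = y" by blast
      with weights_add_point[OF relative_poset_axioms this(1) JL, of e] e show ?thesis
        by (auto simp: y_def mxJ)
    qed
  qed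
  show "chain_polytope P r \<subseteq> rel_poset_polytope P r r"
  proof
    fix x assume x: "x \<in> chain_polytope P r"
    have "0 \<le> x $ p" for p using x by (cases "p \<in> P") (auto simp: chain_polytope_def)
    then have "\<forall>p. 0 \<le> x $ p" by blast
    then show "x \<in> rel_poset_polytope P r r"
      using x peel[of x 1] by (auto simp: chain_polytope_def polytope_eq)
  qed
qed

section \<open>Cells of the regular subdivision\<close>

text \<open>A face \<open>G\<close> of \<open>B\<close>, cut down to the common face
  \<open>A \<inter> B\<close>, is a face of \<open>A\<close>; intersecting it with a face
  \<open>F\<close> of \<open>A\<close> gives a face of \<open>A\<close> inside \<open>F\<close>. So
  only intersections of parts have to be examined.\<close>

lemma polyhedral_complex_faces:
  assumes fin: "finite \<Theta>" and chart_pt: "\<And>A. A \<in> \<Theta> \<Longrightarrow> polytope A"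
    and face: "\<And>A B. A \<in> \<Theta> \<Longrightarrow> B \<in> \<Theta> \<Longrightarrow> A \<inter> B face_of A"
  shows "polyhedral_complex {F. \<exists>A\<in>\<Theta>. F face_of A}"
  unfolding polyhedral_complex_def
proof (intro conjI ballI allI impI)
  have "{F. \<exists>A\<in>\<Theta>. F face_of A} = (\<Union>A\<in>\<Theta>. {F. F face_of A})" by auto
  then show "finite {F. \<exists>A\<in>\<Theta>. F face_of A}"
    using fin chart_pt by (simp add: finite_polytope_faces)
  show "polytope F" if "F \<in> {F. \<exists>A\<in>\<Theta>. F face_of A}" for F
    using that chart_pt face_of_polytope_polytope by blast
  show "G \<in> {F. \<exists>A\<in>\<Theta>. F face_of A}" if "F \<in> {F. \<exists>A\<in>\<Theta>. F face_of A}" "G face_of F" for F G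
    using that face_of_trans by blast
  have *: "F \<inter> G face_of F" if F: "A \<in> \<Theta>" "F face_of A" and G: "B \<in> \<Theta>" "G face_of B" for F G A B
  proof -
    have BA: "A \<inter> B face_of A" "A \<inter> B face_of B" using face[of A B] face[of B A] F G by (auto simp: Int_commute)
    have "G \<inter> (A \<inter> B) face_of B" using face_of_Int[OF G(2) BA(2)] .
    then have "G \<inter> (A \<inter> B) face_of A \<inter> B" by (rule face_of_subset) auto
    then have "G \<inter> (A \<inter> B) face_of A" using BA(1) face_of_trans by blast
    then have "F \<inter> (G \<inter> (A \<inter> B)) face_of A" using face_of_Int[OF F(2)] by blast
    moreover have "F \<inter> (G \<inter> (A \<inter> B)) = F \<inter> G"
      using face_of_imp_subset[OF F(2)] face_of_imp_subset[OF G(2)] by blast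
    ultimately have "F \<inter> G face_of A" by simp
    then show ?thesis by (rule face_of_subset) (use face_of_imp_subset[OF F(2)] in auto)
  qed
  fix F G assume "F \<in> {F. \<exists>A\<in>\<Theta>. F face_of A}" "G \<in> {F. \<exists>A\<in>\<Theta>. F face_of A}"
  then show "F \<inter> G face_of F" "F \<inter> G face_of G"
    using *[of _ F _ G] *[of _ G _ F] by (auto simp: Int_commute)
qed

lemma axis_expansion:
  fixes x :: "real ^ 'n"
  assumes "\<And>p. p \<notin> A \<Longrightarrow> x $ p = 0"
  shows "x = (\<Sum>p\<in>A. x $ p *\<^sub>R axis p 1)"
proof -
  have "x $ i = (\<Sum>p\<in>A. x $ p *\<^sub>R axis p 1) $ i" for i
  proof -
    have "(\<Sum>p\<in>A. x $ p *\<^sub>R axis p 1) $ i = (\<Sum>p\<in>A. if p = i then x $ p else 0)"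
      unfolding sum_component by (intro sum.cong) (auto simp: axis_def)
    then show ?thesis using assms[of i] by simp
  qed
  then show ?thesis unfolding vec_eq_iff by blast
qed

section \<open>Maximal chains of ideals and affine interpolation\<close>

context relative_poset
begin

text \<open>These are the maximal chains of ideals, or equivalently the linear extensions of
  \<open>r\<close>. Losing one point at a time is the form that inductions along the chain
  use.\<close>

definition full_chain :: "'p set set \<Rightarrow> bool"
  where "full_chain G \<longleftrightarrow> G \<subseteq> \<L> \<and> P \<in> G \<and> (\<forall>J\<in>G. \<forall>K\<in>G. J \<subseteq> K \<or> K \<subseteq> J) \<and>
    (\<forall>K\<in>G. K \<noteq> {} \<longrightarrow> (\<exists>p\<in>K. K - {p} \<in> G))"

text \<open>Let \<open>J0\<close> be the largest member of the chain strictly below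
  \<open>J\<close>. Removing an \<open>r\<close>-maximal element of \<open>J - J0\<close> from
  \<open>J\<close> leaves an ideal, since anything of \<open>J\<close> above that element also lies
  outside \<open>J0\<close>; it still contains \<open>J0\<close>.\<close>

lemma chain_refine:
  assumes "J \<in> \<L>" "C \<subseteq> \<L>" "\<And>I K. I \<in> C \<Longrightarrow> K \<in> C \<Longrightarrow> I \<subseteq> K \<or> K \<subseteq> I" "\<And>K. K \<in> C \<Longrightarrow> K \<subseteq> J"
  shows "\<exists>G. G \<subseteq> \<L> \<and> J \<in> G \<and> C \<subseteq> G \<and> (\<forall>I\<in>G. \<forall>K\<in>G. I \<subseteq> K \<or> K \<subseteq> I) \<and>
    (\<forall>K\<in>G. K \<subseteq> J \<and> (K \<noteq> {} \<longrightarrow> (\<exists>p\<in>K. K - {p} \<in> G)))"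
  using assms
proof (induction "card J" arbitrary: J C rule: less_induct)
  case less
  show ?case
  proof (cases "J = {}")
    case True
    then have "C \<subseteq> {{}}" using less.prems(4) by blast
    then show ?thesis using True less.prems(1) by (intro exI[of _ "{{}}"]) auto
  next
    case False
    define C' where "C' = C - {J}"
    define J0 where "J0 = \<Union>C'"
    have "C' = {} \<or> J0 \<in> C'"
      using chain_Union_mem[of C'] less.prems(3) by (auto simp: C'_def J0_def)
    moreover have "C' \<subseteq> \<L>" "K \<subset> J" if "K \<in> C'" for K
      using that less.prems(2,4) by (auto simp: C'_def)
    moreover have "J0 = {}" if "C' = {}" using that by (simp add: J0_def)
    ultimately have J0: "J0 \<subset> J" "J0 \<in> \<L>"
      using False order_ideals_empty[of P r] by blast+
    have JP: "J \<subseteq> P" using less.prems(1) order_ideals_subset by blast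
    obtain p where p: "p \<in> max_elems r (J - J0)"
      using max_elems_above[OF po _ finite, of "J - J0"] J0(1) JP by blast
    have pJ: "p \<in> J" "p \<notin> J0" using p by (auto simp: max_elems_def)
    have L: "J - {p} \<in> \<L>"
      unfolding order_ideals_def
    proof (intro CollectI conjI ballI allI impI)
      fix q s assume q: "q \<in> J - {p}" "(s, q) \<in> r"
      have "s \<in> J" using q less.prems(1) by (auto simp: order_ideals_def)
      moreover have "s \<noteq> p"
      proof
        assume "s = p"
        then have "q \<notin> J0" using q pJ J0(2) by (auto simp: order_ideals_def)
        then show False using p q \<open>s = p\<close> by (auto simp: max_elems_def)
      qed
      ultimately show "s \<in> J - {p}" by simp
    qed (use JP in auto)
    have a: "card (J - {p}) < card J" using pJ by (intro psubset_card_mono) auto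
    have b: "C' \<subseteq> \<L>" using less.prems(2) by (auto simp: C'_def)
    have c: "I \<subseteq> K \<or> K \<subseteq> I" if "I \<in> C'" "K \<in> C'" for I K using that less.prems(3) by (simp add: C'_def)
    have d: "K \<subseteq> J - {p}" if "K \<in> C'" for K using that J0 pJ by (auto simp: J0_def)
    have "\<exists>G. G \<subseteq> \<L> \<and> J - {p} \<in> G \<and> C' \<subseteq> G \<and> (\<forall>I\<in>G. \<forall>K\<in>G. I \<subseteq> K \<or> K \<subseteq> I) \<and>
      (\<forall>K\<in>G. K \<subseteq> J - {p} \<and> (K \<noteq> {} \<longrightarrow> (\<exists>p\<in>K. K - {p} \<in> G)))"
      by (rule less.hyps[OF a L b c d])
    then obtain G where G: "G \<subseteq> \<L>" "J - {p} \<in> G" "C' \<subseteq> G" "\<forall>I\<in>G. \<forall>K\<in>G. I \<subseteq> K \<or> K \<subseteq> I"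
      "\<forall>K\<in>G. K \<subseteq> J - {p} \<and> (K \<noteq> {} \<longrightarrow> (\<exists>p\<in>K. K - {p} \<in> G))"
      by (elim exE conjE)
    have 1: "\<exists>q\<in>K. K - {q} \<in> insert J G" if "K \<in> insert J G" "K \<noteq> {}" for K
      using that G(2,5) pJ by blast
    have 2: "insert J G \<subseteq> \<L>" using G(1) less.prems(1) by blast
    have 3: "C \<subseteq> insert J G" using G(3) by (auto simp: C'_def)
    have 4: "K \<subseteq> J" if "K \<in> insert J G" for K using that G(5) by blast
    have 5: "I \<subseteq> K \<or> K \<subseteq> I" if "I \<in> insert J G" "K \<in> insert J G" for I K
      using that G(4) 4 by blast
    show ?thesis
      by (intro exI[of _ "insert J G"] conjI ballI impI) (rule 2 insertI1 3 4 5 1; assumption)+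
  qed
qed

lemma full_chain_extend:
  assumes "C \<subseteq> \<L>" "\<And>I K. I \<in> C \<Longrightarrow> K \<in> C \<Longrightarrow> I \<subseteq> K \<or> K \<subseteq> I"
  obtains G where "full_chain G" "C \<subseteq> G"
proof -
  have "K \<subseteq> P" if "K \<in> C" for K using that assms(1) order_ideals_subset by blast
  then have "\<exists>G. G \<subseteq> \<L> \<and> P \<in> G \<and> C \<subseteq> G \<and> (\<forall>I\<in>G. \<forall>K\<in>G. I \<subseteq> K \<or> K \<subseteq> I) \<and>
    (\<forall>K\<in>G. K \<subseteq> P \<and> (K \<noteq> {} \<longrightarrow> (\<exists>p\<in>K. K - {p} \<in> G)))"
    by (intro chain_refine[OF top_ideal assms(1)]) (use assms(2) in blast)+
  then obtain G where "G \<subseteq> \<L> \<and> P \<in> G \<and> C \<subseteq> G \<and> (\<forall>I\<in>G. \<forall>K\<in>G. I \<subseteq> K \<or> K \<subseteq> I) \<and>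
    (\<forall>K\<in>G. K \<subseteq> P \<and> (K \<noteq> {} \<longrightarrow> (\<exists>p\<in>K. K - {p} \<in> G)))" ..
  then show ?thesis by (intro that[of G]) (simp_all add: full_chain_def)
qed

lemma full_chainD:
  assumes "full_chain G"
  shows "G \<subseteq> \<L>" "P \<in> G" "J \<in> G \<Longrightarrow> K \<in> G \<Longrightarrow> J \<subseteq> K \<or> K \<subseteq> J"
    "K \<in> G \<Longrightarrow> K \<noteq> {} \<Longrightarrow> \<exists>p\<in>K. K - {p} \<in> G"
  using assms by (auto simp: full_chain_def)

lemma full_chain_induct [consumes 2, case_names empty step]:
  assumes G: "full_chain G" and K: "K \<in> G" and 0: "Q {}"
    and step: "\<And>K p. K \<in> G \<Longrightarrow> p \<in> K \<Longrightarrow> K - {p} \<in> G \<Longrightarrow> Q (K - {p}) \<Longrightarrow> Q K"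
  shows "Q K"
  using K
proof (induction "card K" arbitrary: K rule: less_induct)
  case less
  show ?case
  proof (cases "K = {}")
    case False
    then obtain p where p: "p \<in> K" "K - {p} \<in> G" using full_chainD(4)[OF G] less.prems by blast
    then have "card (K - {p}) < card K" by (intro psubset_card_mono) auto
    then show ?thesis using step[OF less.prems p] less.hyps p by blast
  qed (use 0 in simp)
qed

lemma full_chain_empty:
  assumes "full_chain G" shows "{} \<in> G"
proof -
  have "K \<in> G \<longrightarrow> {} \<in> G" for K
  proof (induction "card K" arbitrary: K rule: less_induct)
    case less
    have "card (K - {p}) < card K" if "p \<in> K" for p
      using that by (intro psubset_card_mono) auto
    then show ?case using less full_chainD(4)[OF assms, of K] by blast
  qed
  then show ?thesis using full_chainD(2)[OF assms] by blast
qed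

lemma removed_in_mx:
  assumes "K - {p} \<in> \<L>" "p \<in> K" shows "p \<in> mx K"
  unfolding max_elems_def
proof (intro CollectI conjI notI)
  assume "\<exists>q\<in>K. (p, q) \<in> r' \<and> p \<noteq> q"
  then obtain q where q: "q \<in> K - {p}" "(p, q) \<in> r'" by blast
  show False using idealD[OF assms(1) q] by simp
qed fact

text \<open>A triangular system: each step of the chain adds a point \<open>p\<close> that is
  maximal in the new ideal and absent from all smaller ones. The coordinate \<open>p\<close> of
  \<open>u\<close> can be set to fit the new value without changing the earlier ones.\<close>

lemma affine_interpolation:
  assumes G: "full_chain G"
  shows "\<exists>c0 u. \<forall>J\<in>G. w J = c0 + u \<bullet> v J"
proof -
  have "\<exists>u. \<forall>J\<in>G. J \<subseteq> K \<longrightarrow> w J = w {} + u \<bullet> v J" if "K \<in> G" for K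
    using G that
  proof (induction rule: full_chain_induct)
    case empty
    then show ?case by auto
  next
    case (step K p)
    then obtain u where u: "\<forall>J\<in>G. J \<subseteq> K - {p} \<longrightarrow> w J = w {} + u \<bullet> v J" by blast
    have pK: "p \<in> mx K" using removed_in_mx step full_chainD(1)[OF G] by blast
    define u' where "u' = u + axis p (w K - w {} - u \<bullet> v K)"
    have "w J = w {} + u' \<bullet> v J" if J: "J \<in> G" "J \<subseteq> K" for J
    proof (cases "J = K")
      case True
      then show ?thesis using pK by (simp add: u'_def inner_add_left inner_axis' v_nth)
    next
      case False
      then have JK: "J \<subseteq> K - {p}" using full_chainD(3)[OF G J(1) step(3)] J(2) by blast
      then have "p \<notin> mx J" using mxD by blast
      then show ?thesis using u J JK by (simp add: u'_def inner_add_left inner_axis' v_nth)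
    qed
    then show ?case by blast
  qed
  from this[OF full_chainD(2)[OF G]] obtain u where "\<forall>J\<in>G. J \<subseteq> P \<longrightarrow> w J = w {} + u \<bullet> v J" ..
  moreover have "J \<subseteq> P" if "J \<in> G" for J
    using that full_chainD(1)[OF G] order_ideals_subset by blast
  ultimately show ?thesis by blast
qed

text \<open>The extra coordinate 1 records the coefficient sum of a linear combination, so that
  affine statements become linear ones.\<close>

definition chain_span :: "'p set set \<Rightarrow> ((real ^ 'p) \<times> real) set"
  where "chain_span G = span ((\<lambda>J. (v J, 1)) ` G)"

text \<open>The difference of the vectors of \<open>K\<close> and of the empty ideal is the sum of
  the axis vectors over \<open>mx K\<close>; all of them except the one of the newly added point are
  in the span by induction.\<close>

lemma axis_in_chain_span:
  assumes G: "full_chain G" and "K \<in> G"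
  shows "\<forall>p\<in>K. (axis p 1, 0) \<in> chain_span G"
  using assms
proof (induction rule: full_chain_induct)
  case empty
  then show ?case by simp
next
  case (step K p)
  have one: "(0, 1) \<in> chain_span G" 
    unfolding chain_span_def using full_chain_empty[OF G] by (intro span_base) force
  have K: "(v K, 1) \<in> chain_span G" unfolding chain_span_def using step by (intro span_base) auto
  have pK: "p \<in> mx K" using removed_in_mx step full_chainD(1)[OF G] by blast
  have "(\<Sum>q\<in>mx K - {p}. (axis q (1::real), 0::real)) \<in> chain_span G"
    unfolding chain_span_def
    by (intro span_sum) (use step.IH mxD in \<open>auto simp: chain_span_def\<close>)
  then have "(v K, 1) - (0, 1) - (\<Sum>q\<in>mx K - {p}. (axis q (1::real), 0::real)) \<in> chain_span G"
    using K one unfolding chain_span_def by (intro span_diff)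
  moreover have "v K = (\<Sum>q\<in>mx K. axis q (1::real))"
    by (auto simp: vec_eq_iff v_nth axis_def sum.delta if_distrib cong: if_cong)
  then have "v K = axis p 1 + (\<Sum>q\<in>mx K - {p}. axis q (1::real))"
    using pK by (simp add: sum.remove)
  then have "(v K, 1) - (0, 1) - (\<Sum>q\<in>mx K - {p}. (axis q (1::real), 0::real)) = (axis p 1, 0)"
    by (simp add: sum_prod)
  ultimately have "(axis p 1, 0) \<in> chain_span G" by simp
  then show ?case using step.IH by blast
qed

lemma supported_in_chain_span:
  assumes G: "full_chain G" and x: "\<And>p. p \<notin> P \<Longrightarrow> x $ p = 0"
  shows "(x, t) \<in> chain_span G"
proof -
  have one: "(0, 1) \<in> chain_span G" 
    unfolding chain_span_def using full_chain_empty[OF G] by (intro span_base) force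
  have "(x, t) = t *\<^sub>R (0, 1) + (\<Sum>p\<in>P. x $ p *\<^sub>R (axis p 1, 0))"
  proof -
    have "x = (\<Sum>p\<in>P. x $ p *\<^sub>R axis p 1)" by (rule axis_expansion[OF x])
    then show ?thesis by (simp add: sum_prod zero_prod_def)
  qed
  moreover have "\<dots> \<in> chain_span G"
    using axis_in_chain_span[OF G full_chainD(2)[OF G]] one unfolding chain_span_def
    by (intro span_add span_sum span_scale) auto
  ultimately show ?thesis by simp
qed

text \<open>The coefficients may be negative; \<open>support_inequality\<close> repairs this by
  adding a multiple of the whole chain.\<close>

lemma chain_affine_combination:
  assumes G: "full_chain G" and J: "J \<in> \<L>"
  shows "\<exists>a. (\<forall>K. K \<notin> G \<longrightarrow> a K = 0) \<and> total a = 1 \<and> bary a = v J"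
proof -
  have GL: "G \<subseteq> \<L>" using full_chainD[OF G] by blast
  have "(v J, 1) \<in> chain_span G"
    by (rule supported_in_chain_span[OF G]) (use J mxD order_ideals_subset in \<open>fastforce simp: v_nth\<close>)
  then obtain f where f: "(v J, 1) = (\<Sum>x\<in>(\<lambda>J. (v J, 1::real)) ` G. f x *\<^sub>R x)"
    unfolding chain_span_def by (subst (asm) span_finite) auto
  have inj: "inj_on (\<lambda>J. (v J, 1::real)) G"
    using v_inj GL by (auto simp: inj_on_def)
  define a where "a K = (if K \<in> G then f (v K, 1) else 0)" for K
  have "(v J, 1) = (\<Sum>K\<in>G. a K *\<^sub>R (v K, 1::real))"
    unfolding f sum.reindex[OF inj] by (simp add: a_def)
  also have "\<dots> = (\<Sum>K\<in>\<L>. a K *\<^sub>R (v K, 1::real))"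
    using GL by (intro sum.mono_neutral_left) (auto simp: a_def zero_prod_def)
  also have "\<dots> = (bary a, total a)"
    by (simp add: bary_def total_def sum_prod zero_prod_def)
  finally show ?thesis by (intro exI[of _ a]) (auto simp: a_def)
qed

lemma wtotal_affine:
  assumes "\<And>K. K \<in> \<L> \<Longrightarrow> a K \<noteq> 0 \<Longrightarrow> w K = c0 + u \<bullet> v K"
  shows "wtotal w a = c0 * total a + u \<bullet> bary a"
proof -
  have "wtotal w a = (\<Sum>K\<in>\<L>. a K * (c0 + u \<bullet> v K))"
    unfolding wtotal_def by (intro sum.cong refl) (use assms in auto)
  then show ?thesis
    by (simp add: total_def bary_def inner_sum_right sum_distrib_left sum.distrib algebra_simps)
qed

lemma sum_add_fun:
  "total (\<lambda>K. a K + b K) = total a + total b" "bary (\<lambda>K. a K + b K) = bary a + bary b"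
  "wtotal w (\<lambda>K. a K + b K) = wtotal w a + wtotal w b"
  by (simp_all add: total_def bary_def wtotal_def sum.distrib algebra_simps)

lemma sum_point:
  assumes "J \<in> \<L>"
  shows "total (\<lambda>K. if K = J then 1 else 0) = 1" "bary (\<lambda>K. if K = J then 1 else 0) = v J"
    "wtotal w (\<lambda>K. if K = J then 1 else 0) = w J"
  using assms by (simp_all add: total_def bary_def wtotal_def if_distrib[of "\<lambda>x. x *\<^sub>R _"] if_distrib[of "\<lambda>x. x * _"] cong: if_cong)

text \<open>A large multiple \<open>N\<close> of the sum over the chain, plus \<^term>\<open>v J\<close>, lies in the cone over the chain; straightening
  it compares \<^term>\<open>w J\<close> with the value at \<^term>\<open>v J\<close> of the affine function interpolating \<open>w\<close> on the chain.\<close>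

lemma support_inequality:
  assumes w: "superadd w" and G: "full_chain G" and l: "\<And>K. K \<in> G \<Longrightarrow> w K = c0 + u \<bullet> v K"
    and J: "J \<in> \<L>"
  shows "w J \<le> c0 + u \<bullet> v J"
proof -
  obtain a where a: "\<forall>K. K \<notin> G \<longrightarrow> a K = 0" "total a = 1" "bary a = v J"
    using chain_affine_combination[OF G J] by blast
  have GL: "G \<subseteq> \<L>" using full_chainD[OF G] by blast
  \<comment> \<open>A common bound for all \<open>\<bar>a K\<bar>\<close>, which makes every
    \<open>N + a K\<close> nonnegative.\<close>
  define N where "N = (\<Sum>K\<in>\<L>. \<bar>a K\<bar>)"
  have N: "0 \<le> N" "0 \<le> N + a K" for K
  proof -
    show "0 \<le> N" by (simp add: N_def sum_nonneg)
    have "\<bar>a K\<bar> \<le> N" if "K \<in> \<L>" unfolding N_def using that by (intro member_le_sum) auto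
    then show "0 \<le> N + a K" using a(1) GL \<open>0 \<le> N\<close> by (cases "K \<in> \<L>") auto
  qed
  define g where "g K = (if K \<in> G then N else 0)" for K
  define c where "c K = g K + (if K = J then 1 else 0)" for K
  define d where "d K = g K + a K" for K
  have cW: "c \<in> weights" using N J GL by (auto simp: weights_def c_def g_def)
  have dW: "d \<in> weights" using N a GL by (auto simp: weights_def d_def g_def)
  have dC: "chain_supp d"
    unfolding chain_supp_def using a(1) full_chainD(3)[OF G] by (auto simp: d_def g_def split: if_splits)
  have eq: "total d = total c" "bary d = bary c"
    unfolding c_def d_def sum_add_fun using a sum_point[OF J] by simp_all
  obtain c' where c': "c' \<in> weights" "chain_supp c'" "total c' = total c" "bary c' = bary c" "wtotal w c \<le> wtotal w c'"
    using straighten[OF w cW] by blast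
  \<comment> \<open>The weight \<open>d\<close> already sits on a chain and has the total and
    barycentre of \<open>c\<close>, so straightening \<open>c\<close> can only produce
    \<open>d\<close>.\<close>
  have "c' = d" using chain_unique[OF c'(1,2) dW dC] c' eq by simp
  then have "wtotal w c \<le> wtotal w d" using c'(5) by simp
  then have "wtotal w g + w J \<le> wtotal w g + wtotal w a"
    unfolding c_def d_def sum_add_fun sum_point[OF J] .
  also have "wtotal w a = c0 * total a + u \<bullet> bary a"
    by (rule wtotal_affine) (use a(1) l in auto)
  finally show ?thesis using a by simp
qed

section \<open>Domains of linearity and their orders\<close>

text \<open>The full chain inside \<open>M\<close> selects the domains of full dimension. By
  \<open>cell_le\<close> the affine function given by \<open>c0\<close> and \<open>u\<close> then
  dominates \<open>w\<close> on all ideals, as a concave extension requires.\<close>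

definition is_cell :: "('p set \<Rightarrow> real) \<Rightarrow> 'p set set \<Rightarrow> real \<Rightarrow> real ^ 'p \<Rightarrow> bool"
  where "is_cell w M c0 u \<longleftrightarrow> M = {J\<in>\<L>. w J = c0 + u \<bullet> v J} \<and> (\<exists>G. full_chain G \<and> G \<subseteq> M)"

definition cells :: "('p set \<Rightarrow> real) \<Rightarrow> 'p set set set"
  where "cells w = {M. \<exists>c0 u. is_cell w M c0 u}"

lemma cell_le:
  assumes w: "superadd w" and M: "is_cell w M c0 u" and J: "J \<in> \<L>"
  shows "w J \<le> c0 + u \<bullet> v J"
  using M support_inequality[OF w _ _ J] unfolding is_cell_def by blast

lemma cell_exists:
  assumes "full_chain G"
  obtains M c0 u where "is_cell w M c0 u" "G \<subseteq> M"
proof -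
  obtain c0 u where "\<forall>J\<in>G. w J = c0 + u \<bullet> v J" using affine_interpolation[OF assms] by blast
  then show ?thesis using assms full_chainD(1)[OF assms]
    by (intro that[of "{J\<in>\<L>. w J = c0 + u \<bullet> v J}" c0 u]) (auto simp: is_cell_def)
qed

text \<open>The affine function takes the same sum on a pair as on its union and star, and it
  dominates \<open>w\<close>; superadditivity of \<open>w\<close> gives the opposite inequality, so
  equality holds for both new ideals.\<close>

lemma cell_Un_star:
  assumes w: "superadd w" and M: "is_cell w M c0 u" and J: "J \<in> M" and K: "K \<in> M"
  shows "J \<union> K \<in> M" "star J K \<in> M"
proof -
  have L: "J \<in> \<L>" "K \<in> \<L>" using M J K by (auto simp: is_cell_def)
  then have L2: "J \<union> K \<in> \<L>" "star J K \<in> \<L>" using order_ideals_Un star_closed by auto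
  have "w J + w K \<le> w (J \<union> K) + w (star J K)" using w L by (simp add: superadd_def)
  moreover have "w J = c0 + u \<bullet> v J" "w K = c0 + u \<bullet> v K" using M J K by (auto simp: is_cell_def)
  moreover have "u \<bullet> v (J \<union> K) + u \<bullet> v (star J K) = u \<bullet> v J + u \<bullet> v K"
    using arg_cong[OF v_Un_star[OF L], of "\<lambda>x. u \<bullet> x"] by (simp add: inner_add_right)
  moreover note cell_le[OF w M L2(1)] cell_le[OF w M L2(2)]
  ultimately have "w (J \<union> K) = c0 + u \<bullet> v (J \<union> K)" "w (star J K) = c0 + u \<bullet> v (star J K)" by linarith+
  then show "J \<union> K \<in> M" "star J K \<in> M" using M L2 by (auto simp: is_cell_def)
qed

lemma cell_empty: "is_cell w M c0 u \<Longrightarrow> {} \<in> M"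
  unfolding is_cell_def using full_chain_empty by blast

lemma cell_Union:
  assumes "superadd w" "is_cell w M c0 u" "A \<subseteq> M"
  shows "\<Union>A \<in> M"
proof -
  have "finite A" by simp
  then show ?thesis using assms(3)
    by (induction A rule: finite_induct) (auto intro: cell_Un_star[OF assms(1,2)] cell_empty[OF assms(2)])
qed

lemma ex_min_card:
  fixes S :: "'p set set"
  assumes "K0 \<in> S"
  obtains K where "K \<in> S" "\<And>J. J \<in> S \<Longrightarrow> J \<subseteq> K \<Longrightarrow> J = K"
proof -
  obtain K where K: "K \<in> S" "\<And>J. J \<in> S \<Longrightarrow> card K \<le> card J"
    using arg_min_nat_lemma[of "\<lambda>K. K \<in> S" K0 card] assms by blast
  then show ?thesis using that[of K] card_subset_eq[of K] by (simp add: card_mono le_antisym)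
qed

text \<open>If \<open>K\<close> is the first member of the full chain containing \<open>J\<close> and \<open>p\<close> is the element added by \<open>K\<close>, then
  \<open>J - {p}\<close> is the union of the ideals \<open>J * K'\<close>, where \<open>K'\<close> runs over smaller members of the chain.\<close>

lemma cell_accessible:
  assumes w: "superadd w" and M: "is_cell w M c0 u" and J: "J \<in> M" "J \<noteq> {}"
  shows "\<exists>p\<in>J. J - {p} \<in> M"
proof -
  obtain G where G: "full_chain G" "G \<subseteq> M" using M by (auto simp: is_cell_def)
  have GL: "G \<subseteq> \<L>" and MS: "M \<subseteq> \<L>" using full_chainD[OF G(1)] M by (auto simp: is_cell_def)
  have JL: "J \<in> \<L>" using J MS by blast
  have "P \<in> {K\<in>G. J \<subseteq> K}" using full_chainD(2)[OF G(1)] JL order_ideals_subset by blast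
  then obtain K where "K \<in> {K\<in>G. J \<subseteq> K}" and Kmin: "\<And>I. I \<in> {K\<in>G. J \<subseteq> K} \<Longrightarrow> I \<subseteq> K \<Longrightarrow> I = K"
    by (rule ex_min_card) blast
  then have K: "K \<in> G" "J \<subseteq> K" by auto
  then obtain p where p: "p \<in> K" "K - {p} \<in> G" using full_chainD(4)[OF G(1), of K] J by blast
  have pJ: "p \<in> J" using Kmin[of "K - {p}"] p K by blast
  have "\<exists>I\<in>M. q \<in> I \<and> I \<subseteq> J - {p}" if q: "q \<in> J - {p}" for q
  proof -
    have "K - {p} \<in> {I\<in>G. q \<in> I \<and> I \<subseteq> K - {p}}" using q K p by blast
    then obtain I where I: "I \<in> {I\<in>G. q \<in> I \<and> I \<subseteq> K - {p}}"
      and Imin: "\<And>I'. I' \<in> {I\<in>G. q \<in> I \<and> I \<subseteq> K - {p}} \<Longrightarrow> I' \<subseteq> I \<Longrightarrow> I' = I"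
      by (rule ex_min_card) blast
    then obtain q' where q': "q' \<in> I" "I - {q'} \<in> G" using full_chainD(4)[OF G(1), of I] by blast
    \<comment> \<open>The point lost by the smallest chain member containing \<open>q\<close> must
      be \<open>q\<close>. Hence \<open>q\<close> is maximal in that member and belongs to its star
      with \<open>J\<close>.\<close>
    have "q' = q" using Imin[of "I - {q'}"] q' I by blast
    then have "q \<in> mx I" using removed_in_mx[of I q'] q' GL by auto
    then have "q \<in> star J I" using star_gen[OF JL, of I q] I GL q by auto
    moreover have "star J I \<subseteq> J - {p}" using star_subset[OF JL, of I] I GL by blast
    moreover have "star J I \<in> M" using cell_Un_star(2)[OF w M J(1)] I G by blast
    ultimately show ?thesis by blast
  qed
  then have "J - {p} = \<Union>{I\<in>M. I \<subseteq> J - {p}}" by blast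
  also have "\<dots> \<in> M" by (rule cell_Union[OF w M]) auto
  finally show ?thesis using pJ by blast
qed

text \<open>Closure under intersection is not yet known, so the star takes its place. Accessibility
  shows that a minimal member \<open>K\<close> containing \<open>p\<close> can lose only
  \<open>p\<close>; thus \<open>p\<close> is maximal in \<open>K\<close> and survives in the star of
  \<open>K\<close> with any member containing \<open>p\<close>. By minimality this star is
  \<open>K\<close>.\<close>

lemma cell_least:
  assumes w: "superadd w" and M: "is_cell w M c0 u" and p: "p \<in> P"
  obtains K where "K \<in> M" "p \<in> K" "K - {p} \<in> M" "\<And>J. J \<in> M \<Longrightarrow> p \<in> J \<Longrightarrow> K \<subseteq> J"
proof -
  have "P \<in> M" using M full_chainD(2) by (auto simp: is_cell_def)
  then have "P \<in> {J\<in>M. p \<in> J}" using p by blast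
  then obtain K where "K \<in> {J\<in>M. p \<in> J}" and Kmin: "\<And>J. J \<in> {J\<in>M. p \<in> J} \<Longrightarrow> J \<subseteq> K \<Longrightarrow> J = K"
    by (rule ex_min_card) blast
  then have K: "K \<in> M" "p \<in> K" by auto
  have MS: "M \<subseteq> \<L>" using M by (auto simp: is_cell_def)
  obtain q where q: "q \<in> K" "K - {q} \<in> M" using cell_accessible[OF w M K(1)] K(2) by blast
  then have "q = p" using Kmin[of "K - {q}"] K by blast
  then have Kp: "K - {p} \<in> M" using q by simp
  then have pm: "p \<in> mx K" using removed_in_mx K MS by blast
  have "K \<subseteq> J" if J: "J \<in> M" "p \<in> J" for J
  proof -
    have L: "J \<in> \<L>" "K \<in> \<L>" using J K MS by auto
    have "star K J \<in> {J\<in>M. p \<in> J}"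
      using star_gen[OF L(2,1) K(2) J(2)] pm cell_Un_star(2)[OF w M K(1) J(1)] by blast
    then have "star K J = K" using Kmin star_subset[OF L(2,1)] by blast
    then show ?thesis using star_subset[OF L(2,1)] by blast
  qed
  then show ?thesis using that[OF K Kp] by blast
qed

text \<open>Birkhoff's recovery of an order from its family of ideals.\<close>

definition cell_order :: "'p set set \<Rightarrow> 'p rel"
  where "cell_order M = {(q, p). p \<in> P \<and> q \<in> P \<and> (\<forall>J\<in>M. p \<in> J \<longrightarrow> q \<in> J)}"

text \<open>The least members given by \<open>cell_least\<close> act as principal ideals, and an
  ideal of the new order is the union of those of its points.\<close>

lemma cell_order_ideals:
  assumes w: "superadd w" and M: "is_cell w M c0 u"
  shows "order_ideals P (cell_order M) = M"
proof
  have MS: "M \<subseteq> \<L>" using M by (auto simp: is_cell_def)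
  show "M \<subseteq> order_ideals P (cell_order M)"
  proof
    fix J assume J: "J \<in> M"
    then have "J \<subseteq> P" using MS order_ideals_subset by blast
    then show "J \<in> order_ideals P (cell_order M)"
      using J by (auto simp: order_ideals_def cell_order_def)
  qed
  show "order_ideals P (cell_order M) \<subseteq> M"
  proof
    fix J assume J: "J \<in> order_ideals P (cell_order M)"
    have "\<exists>K\<in>M. p \<in> K \<and> K \<subseteq> J" if "p \<in> J" for p
    proof -
      have pP: "p \<in> P" using J that by (auto simp: order_ideals_def)
      then obtain K where K: "K \<in> M" "p \<in> K" "\<And>I. I \<in> M \<Longrightarrow> p \<in> I \<Longrightarrow> K \<subseteq> I"
        using cell_least[OF w M] by metis
      have "K \<subseteq> P" using K(1) MS order_ideals_subset by blast
      then have "(q, p) \<in> cell_order M" if "q \<in> K" for q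
        using that K pP by (auto simp: cell_order_def)
      then show ?thesis using K J that by (auto simp: order_ideals_def)
    qed
    then have "J = \<Union>{K\<in>M. K \<subseteq> J}" by blast
    also have "\<dots> \<in> M" by (rule cell_Union[OF w M]) auto
    finally show "J \<in> M" .
  qed
qed

lemma cell_relative_orders:
  assumes w: "superadd w" and M: "is_cell w M c0 u"
  shows "relative_orders P (cell_order M) r'"
  unfolding relative_orders_def
proof (intro conjI ballI po')
  have MS: "M \<subseteq> \<L>" using M by (auto simp: is_cell_def)
  have "antisym (cell_order M)"
  proof (rule antisymI)
    fix p q assume pq: "(p, q) \<in> cell_order M" "(q, p) \<in> cell_order M"
    then have "p \<in> P" by (simp add: cell_order_def)
    \<comment> \<open>The members \<open>K\<close> and \<open>K - {p}\<close> differ in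
      \<open>p\<close> alone and so separate it from every other point.\<close>
    then obtain K where K: "K \<in> M" "p \<in> K" "K - {p} \<in> M" by (rule cell_least[OF w M])
    have "p \<in> J \<longleftrightarrow> q \<in> J" if "J \<in> M" for J using pq that unfolding cell_order_def by blast
    from this[OF K(1)] this[OF K(3)] show "p = q" using K(2) by blast
  qed
  then show "partial_order_on P (cell_order M)"
    by (auto simp: partial_order_on_def preorder_on_def refl_on_def trans_def cell_order_def)
  show "r' \<subseteq> cell_order M"
    using MS idealD partial_order_onD(4)[OF po'] by (auto simp: cell_order_def)
  fix J K assume "J \<in> order_ideals P (cell_order M)" "K \<in> order_ideals P (cell_order M)"
  then show "star J K \<in> order_ideals P (cell_order M)"
    unfolding cell_order_ideals[OF w M] by (rule cell_Un_star(2)[OF w M])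
qed

text \<open>The vectors of a full chain affinely span all vectors of ideals, so two affine functions
  that agree on the chain agree on every \<open>v J\<close>.\<close>

lemma cell_maximal:
  assumes M: "is_cell w M c0 u" and M': "is_cell w M' c1 u'" and sub: "M \<subseteq> M'"
  shows "M = M'"
proof -
  obtain G where G: "full_chain G" "G \<subseteq> M" using M by (auto simp: is_cell_def)
  have "c0 + u \<bullet> v J = c1 + u' \<bullet> v J" if J: "J \<in> \<L>" for J
  proof -
    obtain a where a: "\<forall>K. K \<notin> G \<longrightarrow> a K = 0" "total a = 1" "bary a = v J"
      using chain_affine_combination[OF G(1) J] by blast
    have "wtotal w a = c0 * total a + u \<bullet> bary a"
      by (rule wtotal_affine) (use a G M in \<open>auto simp: is_cell_def\<close>)
    moreover have "wtotal w a = c1 * total a + u' \<bullet> bary a"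
      by (rule wtotal_affine) (use a G sub M' in \<open>auto simp: is_cell_def\<close>)
    ultimately show ?thesis using a by simp
  qed
  then show ?thesis using M M' by (auto simp: is_cell_def)
qed

section \<open>The polyhedral subdivision formed by the hulls of the cells\<close>

lemma hull_cell:
  assumes "M \<subseteq> \<L>"
  shows "convex hull (v ` M) = {bary c | c. c \<in> weights \<and> total c = 1 \<and> (\<forall>J. J \<notin> M \<longrightarrow> c J = 0)}"
proof -
  have inj: "inj_on v M" using v_inj assms inj_on_subset by blast
  show ?thesis
    unfolding convex_hull_image[OF finite inj]
  proof (intro equalityI subsetI)
    fix y assume "y \<in> {\<Sum>J\<in>M. c J *\<^sub>R v J | c. (\<forall>J\<in>M. 0 \<le> c J) \<and> sum c M = 1}"
    then obtain c where c: "\<forall>J\<in>M. 0 \<le> c J" "sum c M = 1" "y = (\<Sum>J\<in>M. c J *\<^sub>R v J)" by auto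
    define d where "d J = (if J \<in> M then c J else 0)" for J
    have "d \<in> weights" using c assms by (auto simp: d_def weights_def)
    moreover have "total d = sum d M" "bary d = (\<Sum>J\<in>M. d J *\<^sub>R v J)"
      unfolding total_def bary_def using assms by (intro sum.mono_neutral_right; auto simp: d_def)+
    then have "total d = 1" "y = bary d" using c by (simp_all add: d_def)
    ultimately show "y \<in> {bary c | c. c \<in> weights \<and> total c = 1 \<and> (\<forall>J. J \<notin> M \<longrightarrow> c J = 0)}"
      by (auto simp: d_def intro!: exI[of _ d])
  next
    fix y assume "y \<in> {bary c | c. c \<in> weights \<and> total c = 1 \<and> (\<forall>J. J \<notin> M \<longrightarrow> c J = 0)}"
    then obtain c where c: "c \<in> weights" "total c = 1" "\<forall>J. J \<notin> M \<longrightarrow> c J = 0" "y = bary c" by auto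
    have "total c = sum c M" "bary c = (\<Sum>J\<in>M. c J *\<^sub>R v J)"
      unfolding total_def bary_def using assms c(3) by (intro sum.mono_neutral_right; auto)+
    then show "y \<in> {\<Sum>J\<in>M. c J *\<^sub>R v J | c. (\<forall>J\<in>M. 0 \<le> c J) \<and> sum c M = 1}"
      using c by (auto simp: weights_def)
  qed
qed

text \<open>Straightening a combination over \<open>M\<close> with barycentre \<open>v J\<close>
  must end in the point mass at \<open>J\<close>, by uniqueness. Since it does not lower the weight,
  \<open>w J\<close> reaches the affine value of the cell.\<close>

lemma hull_cell_vertex:
  assumes M: "is_cell w M c0 u" "superadd w" and J: "J \<in> \<L>" "v J \<in> convex hull (v ` M)"
  shows "J \<in> M"
proof -
  have MS: "M \<subseteq> \<L>" using M by (auto simp: is_cell_def)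
  obtain c where c: "c \<in> weights" "total c = 1" "\<forall>J. J \<notin> M \<longrightarrow> c J = 0" "v J = bary c"
    using J(2) unfolding hull_cell[OF MS] by auto
  obtain c' where c': "c' \<in> weights" "chain_supp c'" "total c' = total c" "bary c' = bary c" "wtotal w c \<le> wtotal w c'"
    using straighten[OF M(2) c(1)] by blast
  have "c' = (\<lambda>K. if K = J then 1 else 0)"
    using c' c J sum_point[OF J(1)]
    by (intro chain_unique) (auto simp: weights_def chain_supp_def)
  then have "wtotal w c \<le> w J" using c' sum_point[OF J(1)] by simp
  moreover have "wtotal w c = c0 * total c + u \<bullet> bary c"
    by (rule wtotal_affine) (use c M in \<open>auto simp: is_cell_def\<close>)
  ultimately have "c0 + u \<bullet> v J \<le> w J" using c by simp
  then show ?thesis using cell_le[OF M(2,1) J(1)] M J by (auto simp: is_cell_def)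
qed

lemma hull_cell_inj:
  assumes "superadd w" "M \<in> cells w" "M' \<in> cells w" "convex hull (v ` M) = convex hull (v ` M')"
  shows "M = M'"
proof -
  have "A \<subseteq> B" if "A \<in> cells w" "B \<in> cells w" "convex hull (v ` A) = convex hull (v ` B)" for A B
  proof
    fix J assume "J \<in> A"
    then have "v J \<in> convex hull (v ` B)" using that(3) hull_inc[of "v J" "v ` A" convex] by auto
    moreover have "J \<in> \<L>" using \<open>J \<in> A\<close> that by (auto simp: cells_def is_cell_def)
    ultimately show "J \<in> B" using hull_cell_vertex assms(1) that by (auto simp: cells_def)
  qed
  from this[of M M'] this[of M' M] show ?thesis using assms by auto
qed

text \<open>For a combination over \<open>M\<close> the weight \<open>wtotal w\<close> equals the
  affine function of \<open>M\<close> at the barycentre and never exceeds that of \<open>M'\<close>.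
  Where the two functions agree, every term with positive coefficient is tight for
  \<open>M'\<close>, so the combination is also one over \<open>M'\<close>.\<close>

lemma hull_cells_Int:
  assumes w: "superadd w" and M: "is_cell w M c0 u" and M': "is_cell w M' c1 u'"
  shows "convex hull (v ` M) \<inter> convex hull (v ` M') =
    {x \<in> convex hull (v ` M). c0 + u \<bullet> x = c1 + u' \<bullet> x}"
proof -
  have MS: "M \<subseteq> \<L>" "M' \<subseteq> \<L>" using M M' by (auto simp: is_cell_def)
  have ws: "wtotal w c = a * total c + b \<bullet> bary c"
    if "is_cell w N a b" "\<forall>J. J \<notin> N \<longrightarrow> c J = 0" for c N a b
    by (rule wtotal_affine) (use that in \<open>auto simp: is_cell_def\<close>)
  have wle: "wtotal w c \<le> a * total c + b \<bullet> bary c" if "is_cell w N a b" "c \<in> weights" for c N a b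
  proof -
    have "wtotal w c \<le> wtotal (\<lambda>J. a + b \<bullet> v J) c"
      unfolding wtotal_def using that cell_le[OF w that(1)]
      by (intro sum_mono mult_left_mono) (auto simp: weights_def)
    also have "\<dots> = a * total c + b \<bullet> bary c" by (rule wtotal_affine) simp
    finally show ?thesis .
  qed
  show ?thesis
  proof (intro equalityI subsetI)
    fix x assume x: "x \<in> convex hull (v ` M) \<inter> convex hull (v ` M')"
    then obtain c d where c: "c \<in> weights" "total c = 1" "\<forall>J. J \<notin> M \<longrightarrow> c J = 0" "x = bary c"
      and d: "d \<in> weights" "total d = 1" "\<forall>J. J \<notin> M' \<longrightarrow> d J = 0" "x = bary d"
      unfolding hull_cell[OF MS(1)] hull_cell[OF MS(2)] by blast
    then show "x \<in> {x \<in> convex hull (v ` M). c0 + u \<bullet> x = c1 + u' \<bullet> x}"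
      using x ws[OF M, of c] wle[OF M', of c] ws[OF M', of d] wle[OF M, of d] by auto
  next
    fix x assume x: "x \<in> {x \<in> convex hull (v ` M). c0 + u \<bullet> x = c1 + u' \<bullet> x}"
    then obtain c where c: "c \<in> weights" "total c = 1" "\<forall>J. J \<notin> M \<longrightarrow> c J = 0" "x = bary c"
      unfolding hull_cell[OF MS(1)] by blast
    have "wtotal w c = c1 * total c + u' \<bullet> bary c" using ws[OF M c(3)] c x by simp
    also have "\<dots> = wtotal (\<lambda>J. c1 + u' \<bullet> v J) c" by (rule wtotal_affine[symmetric]) simp
    finally have "(\<Sum>J\<in>\<L>. c J * (c1 + u' \<bullet> v J) - c J * w J) = 0" by (simp add: wtotal_def sum_subtractf)
    then have "\<forall>J\<in>\<L>. c J * (c1 + u' \<bullet> v J) - c J * w J = 0"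
      using c(1) cell_le[OF w M']
      by (subst (asm) sum_nonneg_eq_0_iff) (auto simp: weights_def intro!: mult_left_mono)
    then have "c J = 0" if "J \<notin> M'" for J
      using that c(1) M' by (auto simp: weights_def is_cell_def simp flip: right_diff_distrib)
    then have "x \<in> convex hull (v ` M')" unfolding hull_cell[OF MS(2)] using c by blast
    then show "x \<in> convex hull (v ` M) \<inter> convex hull (v ` M')" using x by blast
  qed
qed

text \<open>On the hull of \<open>M\<close> the function of \<open>M\<close> lies below that of
  \<open>M'\<close>, so the hyperplane where both agree supports this hull.\<close>

lemma hull_cells_face:
  assumes w: "superadd w" and M: "is_cell w M c0 u" and M': "is_cell w M' c1 u'"
  shows "convex hull (v ` M) \<inter> convex hull (v ` M') face_of convex hull (v ` M)"
proof -
  have MS: "M \<subseteq> \<L>" using M by (auto simp: is_cell_def)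
  have "convex hull (v ` M) \<inter> convex hull (v ` M') = convex hull (v ` M) \<inter> {x. (u - u') \<bullet> x = c1 - c0}"
    unfolding hull_cells_Int[OF assms] by (auto simp: inner_diff_left)
  moreover have "convex hull (v ` M) \<inter> {x. (u - u') \<bullet> x = c1 - c0} face_of convex hull (v ` M)"
  proof (rule face_of_Int_supporting_hyperplane_le)
    fix x assume "x \<in> convex hull (v ` M)"
    moreover have "convex hull (v ` M) \<subseteq> {x. (u - u') \<bullet> x \<le> c1 - c0}"
    proof (rule hull_minimal)
      show "v ` M \<subseteq> {x. (u - u') \<bullet> x \<le> c1 - c0}"
      proof clarify
        fix J assume "J \<in> M"
        then have "w J = c0 + u \<bullet> v J" "J \<in> \<L>" using M by (auto simp: is_cell_def)
        moreover have "w J \<le> c1 + u' \<bullet> v J" using cell_le[OF w M' \<open>J \<in> \<L>\<close>] .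
        ultimately show "(u - u') \<bullet> v J \<le> c1 - c0" by (simp add: inner_diff_left)
      qed
    qed (rule convex_halfspace_le)
    ultimately show "(u - u') \<bullet> x \<le> c1 - c0" by blast
  qed simp
  ultimately show ?thesis by simp
qed

lemma hull_cells_Union:
  assumes w: "superadd w"
  shows "(\<Union>M\<in>cells w. convex hull (v ` M)) = rel_poset_polytope P r r'"
proof (intro equalityI subsetI)
  fix x assume "x \<in> (\<Union>M\<in>cells w. convex hull (v ` M))"
  then obtain M where M: "M \<in> cells w" "x \<in> convex hull (v ` M)" by auto
  then have "M \<subseteq> \<L>" by (auto simp: cells_def is_cell_def)
  then show "x \<in> rel_poset_polytope P r r'"
    using M hull_cell[of M] by (auto simp: polytope_eq)
next
  fix x assume "x \<in> rel_poset_polytope P r r'"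
  then obtain c where "c \<in> weights" "total c = 1" "x = bary c" by (auto simp: polytope_eq)
  \<comment> \<open>Straightening with weight zero puts \<open>x\<close> into the simplex of a
    chain; the chain extends to a full one, which lies in a cell of \<open>w\<close>.\<close>
  then obtain d where d: "d \<in> weights" "chain_supp d" "total d = 1" "x = bary d"
    using straighten[OF superadd_zero, of c] by auto
  have "{J. d J \<noteq> 0} \<subseteq> \<L>" using d(1) by (auto simp: weights_def)
  then obtain G where G: "full_chain G" "{J. d J \<noteq> 0} \<subseteq> G"
    using full_chain_extend[of "{J. d J \<noteq> 0}"] d(2) unfolding chain_supp_def by blast
  obtain M c0 u where M: "is_cell w M c0 u" "G \<subseteq> M" using cell_exists[OF G(1)] by blast
  then have MS: "M \<subseteq> \<L>" by (auto simp: is_cell_def)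
  have "x \<in> convex hull (v ` M)" unfolding hull_cell[OF MS] using d G M by blast
  then show "x \<in> (\<Union>M\<in>cells w. convex hull (v ` M))" using M by (auto simp: cells_def)
qed

text \<open>The empty ideal contributes the origin, so the affine dimension is a linear one, and the
  full chain alone spans all axis vectors of \<open>P\<close>.\<close>

lemma aff_dim_hull:
  assumes G: "full_chain G" "G \<subseteq> M" and MS: "M \<subseteq> \<L>"
  shows "aff_dim (convex hull (v ` M)) = int (card P)"
proof -
  have "0 \<in> v ` M" using full_chain_empty[OF G(1)] G(2) v_empty by force
  then have "aff_dim (convex hull (v ` M)) = int (dim (v ` M))"
    by (simp add: aff_dim_convex_hull aff_dim_zero hull_inc)
  also have "dim (v ` M) = dim ((\<lambda>p. axis p (1::real)) ` P)"
  proof (rule span_eq_dim, rule span_eq[THEN iffD2], intro conjI subsetI)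
    fix x assume "x \<in> v ` M"
    then obtain J where J: "J \<in> M" "x = v J" by auto
    have JP: "J \<subseteq> P" using J MS order_ideals_subset by blast
    have "x = (\<Sum>p\<in>P. x $ p *\<^sub>R axis p 1)"
    proof (rule axis_expansion)
      fix p assume "p \<notin> P"
      then show "x $ p = 0" using mxD[of p J] JP by (auto simp: J v_nth)
    qed
    moreover have "\<dots> \<in> span ((\<lambda>p. axis p (1::real)) ` P)"
      by (intro span_sum span_scale span_base) auto
    ultimately show "x \<in> span ((\<lambda>p. axis p (1::real)) ` P)" by simp
  next
    fix x :: "real ^ 'p" assume "x \<in> (\<lambda>p. axis p (1::real)) ` P"
    then obtain p where p: "p \<in> P" "x = axis p 1" by auto
    have "(x, 0) \<in> span ((\<lambda>J. (v J, 1::real)) ` G)"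
      using axis_in_chain_span[OF G(1) full_chainD(2)[OF G(1)]] p by (auto simp: chain_span_def)
    then have "x \<in> fst ` span ((\<lambda>J. (v J, 1::real)) ` G)" by force
    also have "\<dots> = span (fst ` (\<lambda>J. (v J, 1::real)) ` G)"
      by (rule linear_span_image[symmetric]) (rule linear_fst)
    also have "\<dots> \<subseteq> span (v ` M)" using G(2) by (intro span_mono) auto
    finally show "x \<in> span (v ` M)" .
  qed
  also have "dim ((\<lambda>p. axis p (1::real)) ` P) = card ((\<lambda>p. axis p (1::real)) ` P :: (real ^ 'p) set)"
  proof (rule dim_eq_card_independent)
    have "independent (Basis :: (real ^ 'p) set)" by (rule independent_Basis)
    then show "independent ((\<lambda>p. axis p (1::real)) ` P :: (real ^ 'p) set)"
      by (rule independent_mono) (auto simp: Basis_vec_def)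
  qed
  also have "\<dots> = card P" by (intro card_image) (auto simp: inj_on_def axis_eq_axis)
  finally show ?thesis .
qed

lemma cells_subdivision:
  assumes w: "superadd w"
  shows "polyhedral_subdivision (rel_poset_polytope P r r') ((\<lambda>M. convex hull (v ` M)) ` cells w)"
  unfolding polyhedral_subdivision_def
proof (intro conjI ballI)
  obtain G where G: "full_chain G" using full_chain_extend[of "{}"] by auto
  have dimR: "aff_dim (rel_poset_polytope P r r') = int (card P)"
    using aff_dim_hull[OF G full_chainD(1)[OF G]] by (simp add: rel_poset_polytope_def v_def)
  show "polytope A" if "A \<in> (\<lambda>M. convex hull (v ` M)) ` cells w" for A
    using that by (auto simp: polytope_convex_hull)
  show "aff_dim A = aff_dim (rel_poset_polytope P r r')" if "A \<in> (\<lambda>M. convex hull (v ` M)) ` cells w" for A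
    using that aff_dim_hull unfolding dimR by (auto simp: cells_def is_cell_def)
  show "\<Union>((\<lambda>M. convex hull (v ` M)) ` cells w) = rel_poset_polytope P r r'"
    using hull_cells_Union[OF w] by simp
  show "polyhedral_complex {F. \<exists>A\<in>(\<lambda>M. convex hull (v ` M)) ` cells w. F face_of A}"
    by (rule polyhedral_complex_faces)
      (use hull_cells_face[OF w] in \<open>auto simp: polytope_convex_hull cells_def\<close>)
qed

lemma hull_cell_eq:
  assumes "superadd w" "is_cell w M c0 u"
  shows "rel_poset_polytope P (cell_order M) r' = convex hull (v ` M)"
  by (simp add: rel_poset_polytope_def cell_order_ideals[OF assms] v_def)

end

section \<open>Polynomials in finitely many variables\<close>

definition monom_val :: "('i \<Rightarrow> complex) \<Rightarrow> ('i::finite \<Rightarrow> nat) \<Rightarrow> complex"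
  where "monom_val x k = (\<Prod>J\<in>UNIV. x J ^ k J)"

definition mdeg :: "('i::finite \<Rightarrow> nat) \<Rightarrow> nat"
  where "mdeg k = (\<Sum>J\<in>UNIV. k J)"

definition mvec :: "('i::finite \<Rightarrow> real ^ 'n) \<Rightarrow> ('i \<Rightarrow> nat) \<Rightarrow> real ^ 'n"
  where "mvec v k = (\<Sum>J\<in>UNIV. real (k J) *\<^sub>R v J)"

definition supp_in :: "('i \<Rightarrow> nat) \<Rightarrow> 'i set \<Rightarrow> bool"
  where "supp_in k M \<longleftrightarrow> (\<forall>J. J \<notin> M \<longrightarrow> k J = 0)"

text \<open>The affine cone over the projective toric variety of \<open>v ` M\<close>, cut out by its binomial equations.\<close>

definition toric_pt :: "'i set \<Rightarrow> ('i \<Rightarrow> real ^ 'n) \<Rightarrow> ('i::finite \<Rightarrow> complex) \<Rightarrow> bool"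
  where "toric_pt M v x \<longleftrightarrow> (\<forall>J. J \<notin> M \<longrightarrow> x J = 0) \<and>
    (\<forall>k k'. supp_in k M \<and> supp_in k' M \<and> mdeg k = mdeg k' \<and> mvec v k = mvec v k' \<longrightarrow> monom_val x k = monom_val x k')"

text \<open>Exponent vectors are plain functions on a finite index type; this converts them to the
  finitely supported maps of the polynomial ring.\<close>

abbreviation pm :: "('i::finite \<Rightarrow> nat) \<Rightarrow> ('i \<Rightarrow>\<^sub>0 nat)"
  where "pm k \<equiv> Abs_poly_mapping k"

lemma lookup_pm [simp]: "Poly_Mapping.lookup (pm k) = k"
  by simp

lemma pm_inj [simp]: "pm k = pm k' \<longleftrightarrow> k = k'"
  by (metis lookup_pm)

lemma monom_add: "monom_val x (\<lambda>J. k J + l J) = monom_val x k * monom_val x l"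
  by (simp add: monom_val_def power_add prod.distrib)

lemma mdeg_add: "mdeg (\<lambda>J. k J + l J) = mdeg k + mdeg l"
  by (simp add: mdeg_def sum.distrib)

lemma mvec_add: "mvec v (\<lambda>J. k J + l J) = mvec v k + mvec v l"
  by (simp add: mvec_def sum.distrib algebra_simps)

lemma monom_zero [simp]: "monom_val x (\<lambda>_. 0) = 1" and mdeg_zero [simp]: "mdeg (\<lambda>_. 0) = 0"
  and mvec_zero [simp]: "mvec v (\<lambda>_. 0) = 0"
  by (simp_all add: monom_val_def mdeg_def mvec_def)

lemma supp_in_add: "supp_in k M \<Longrightarrow> supp_in l M \<Longrightarrow> supp_in (\<lambda>J. k J + l J) M"
  by (simp add: supp_in_def)

definition unit_exp :: "'i \<Rightarrow> 'i \<Rightarrow> nat"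
  where "unit_exp J K = (if K = J then 1 else 0)"

lemma monom_unit [simp]: "monom_val x (unit_exp J) = x J"
  and mdeg_unit [simp]: "mdeg (unit_exp J) = 1" and mvec_unit [simp]: "mvec v (unit_exp J) = v J"
proof -
  have "monom_val x (unit_exp J) = (\<Prod>K\<in>UNIV. if K = J then x K else 1)"
    unfolding monom_val_def by (intro prod.cong) (auto simp: unit_exp_def)
  then show "monom_val x (unit_exp J) = x J" by simp
  show "mdeg (unit_exp J) = 1" by (simp add: mdeg_def unit_exp_def)
  have "mvec v (unit_exp J) = (\<Sum>K\<in>UNIV. if K = J then v K else 0)"
    unfolding mvec_def by (intro sum.cong) (auto simp: unit_exp_def)
  then show "mvec v (unit_exp J) = v J" by simp
qed

lemma supp_in_unit: "J \<in> M \<Longrightarrow> supp_in (unit_exp J) M"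
  by (auto simp: supp_in_def unit_exp_def)

lemma monom_scale: "monom_val (\<lambda>J. c * x J) k = c ^ mdeg k * monom_val x k"
  by (simp add: monom_val_def mdeg_def power_mult_distrib prod.distrib power_sum)

lemma monom_eq_0_iff: "monom_val x k = 0 \<longleftrightarrow> (\<exists>J. k J \<noteq> 0 \<and> x J = 0)"
  by (auto simp: monom_val_def)

lemma toric_pt_scale:
  assumes "toric_pt M v x" shows "toric_pt M v (\<lambda>J. c * x J)"
  using assms unfolding toric_pt_def monom_scale by auto

lemma supp_in_keys: "supp_in (Poly_Mapping.lookup m) M \<longleftrightarrow> Poly_Mapping.keys m \<subseteq> M"
  by (auto simp: supp_in_def in_keys_iff)

lemma eval_poly_monom: "eval_poly x f = (\<Sum>m\<in>Poly_Mapping.keys f. Poly_Mapping.lookup f m * monom_val x (Poly_Mapping.lookup m))"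
  unfolding subst_poly_def monom_val_def
  by (intro sum.cong arg_cong2[where f = "(*)"] refl prod.mono_neutral_left) (auto simp: in_keys_iff)

lemma eval_poly_superset:
  assumes "finite A" "Poly_Mapping.keys f \<subseteq> A"
  shows "eval_poly x f = (\<Sum>m\<in>A. Poly_Mapping.lookup f m * monom_val x (Poly_Mapping.lookup m))"
  unfolding eval_poly_monom using assms by (intro sum.mono_neutral_left) (auto simp: in_keys_iff)

lemma eval_poly_zero [simp]: "eval_poly x (0 :: 'v cpoly) = 0"
  by (simp add: subst_poly_def)

lemma eval_poly_add:
  fixes f g :: "'i::finite cpoly"
  shows "eval_poly x (f + g) = eval_poly x f + eval_poly x g"
proof -
  have "finite (Poly_Mapping.keys f \<union> Poly_Mapping.keys g)" by simp
  note A = eval_poly_superset[OF this]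
  show ?thesis
    by (subst (1 2 3) A) (auto simp: lookup_add sum.distrib algebra_simps dest: subsetD[OF Poly_Mapping.keys_add])
qed

lemma lookup_const_mult: "Poly_Mapping.lookup (const_poly c * f) m = c * Poly_Mapping.lookup f m"
  unfolding const_poly_def mult_map_scale_conv_mult[symmetric]
  by (simp add: Poly_Mapping.map.rep_eq when_def)

lemma eval_poly_const_mult:
  fixes f :: "'i::finite cpoly"
  shows "eval_poly x (const_poly c * f) = c * eval_poly x f"
proof -
  have "Poly_Mapping.keys (const_poly c * f) \<subseteq> Poly_Mapping.keys f" by (auto simp: in_keys_iff lookup_const_mult)
  from eval_poly_superset[OF finite_keys this] show ?thesis
    by (simp add: lookup_const_mult eval_poly_monom sum_distrib_left mult.assoc)
qed

lemma eval_poly_single [simp]: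
  fixes m :: "'i::finite \<Rightarrow>\<^sub>0 nat"
  shows "eval_poly x (Poly_Mapping.single m c) = c * monom_val x (Poly_Mapping.lookup m)"
  by (simp add: eval_poly_monom)

lemma eval_poly_sum:
  fixes f :: "'a \<Rightarrow> 'i::finite cpoly"
  assumes "finite A" shows "eval_poly x (sum f A) = (\<Sum>a\<in>A. eval_poly x (f a))"
  using assms by (induction A rule: finite_induct) (simp_all add: eval_poly_add)

lemma eval_poly_scale:
  assumes "homogeneous d f"
  shows "eval_poly (\<lambda>J. c * x J) f = c ^ d * eval_poly x (f :: 'i::finite cpoly)"
proof -
  have "mdeg (Poly_Mapping.lookup m) = d" if "m \<in> Poly_Mapping.keys f" for m
  proof -
    have "mdeg (Poly_Mapping.lookup m) = (\<Sum>v\<in>Poly_Mapping.keys m. Poly_Mapping.lookup m v)"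
      unfolding mdeg_def by (rule sum.mono_neutral_right) (auto simp: in_keys_iff)
    then show ?thesis using assms that by (simp add: homogeneous_def)
  qed
  then show ?thesis
    by (simp add: eval_poly_monom monom_scale sum_distrib_left mult_ac)
qed

lemma homogeneous_iff: "homogeneous d (f :: 'i::finite cpoly) \<longleftrightarrow> (\<forall>m\<in>Poly_Mapping.keys f. mdeg (Poly_Mapping.lookup m) = d)"
proof -
  have "mdeg (Poly_Mapping.lookup m) = (\<Sum>v\<in>Poly_Mapping.keys m. Poly_Mapping.lookup m v)" for m :: "'i \<Rightarrow>\<^sub>0 nat"
    unfolding mdeg_def by (rule sum.mono_neutral_right) (auto simp: in_keys_iff)
  then show ?thesis by (simp add: homogeneous_def)
qed

lemma poly_ring_iff: "f \<in> poly_ring V \<longleftrightarrow> (\<forall>m\<in>Poly_Mapping.keys f. supp_in (Poly_Mapping.lookup m) V)"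
  by (simp add: poly_ring_def supp_in_keys)

text \<open>The common pattern of \<open>initial_form_vanishes\<close> and
  \<open>torus_pt_dense\<close>: coefficients cancel on each class of monomials, and the value of a
  monomial depends on its class only.\<close>

lemma sum_graded_zero:
  fixes c val :: "'a \<Rightarrow> complex"
  assumes "finite S" and "\<And>s. s \<in> S \<Longrightarrow> (\<Sum>m | m \<in> S \<and> g m = g s. c m) = 0"
    and "\<And>m m'. m \<in> S \<Longrightarrow> m' \<in> S \<Longrightarrow> g m = g m' \<Longrightarrow> val m = val m'"
  shows "(\<Sum>m\<in>S. c m * val m) = 0"
proof -
  have "(\<Sum>m\<in>S. c m * val m) = (\<Sum>y\<in>g ` S. \<Sum>m | m \<in> S \<and> g m = y. c m * val m)"
    by (rule sum.image_gen[OF assms(1)])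
  also have "\<dots> = 0"
  proof (rule sum.neutral, clarify)
    fix s assume s: "s \<in> S"
    have "(\<Sum>m | m \<in> S \<and> g m = g s. c m * val m) = (\<Sum>m | m \<in> S \<and> g m = g s. c m * val s)"
    proof (rule sum.cong[OF refl])
      fix m assume "m \<in> {m. m \<in> S \<and> g m = g s}"
      then have "val m = val s" using s by (intro assms(3)) auto
      then show "c m * val m = c m * val s" by simp
    qed
    then show "(\<Sum>m | m \<in> S \<and> g m = g s. c m * val m) = 0"
      using assms(2)[OF s] by (simp flip: sum_distrib_right)
  qed
  finally show ?thesis .
qed

lemma sum_single_lookup: "(\<Sum>m\<in>Poly_Mapping.keys f. Poly_Mapping.single m (Poly_Mapping.lookup f m)) = f"
proof (rule poly_mapping_eqI)
  fix k
  have "(\<Sum>m\<in>Poly_Mapping.keys f. Poly_Mapping.lookup (Poly_Mapping.single m (Poly_Mapping.lookup f m)) k) =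
      (\<Sum>m\<in>Poly_Mapping.keys f. if m = k then Poly_Mapping.lookup f m else 0)"
    by (intro sum.cong) (auto simp: lookup_single when_def)
  then show "Poly_Mapping.lookup (\<Sum>m\<in>Poly_Mapping.keys f. Poly_Mapping.single m (Poly_Mapping.lookup f m)) k = Poly_Mapping.lookup f k"
    by (simp add: lookup_sum in_keys_iff)
qed

section \<open>Initial forms and initial ideals\<close>

lemma module_const_poly: "module (\<lambda>c f. const_poly c * (f :: 'v cpoly))"
  by unfold_locales
    (auto intro!: poly_mapping_eqI simp: lookup_const_mult lookup_add distrib_left distrib_right mult.assoc)

lemma monom_weight_eq: "monom_weight w m = (\<Sum>J\<in>UNIV. real (Poly_Mapping.lookup m J) * w (J :: 'i::finite))"
  unfolding monom_weight_def by (rule sum.mono_neutral_left) (auto simp: in_keys_iff)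

lemma eval_initial_form:
  fixes f :: "'i::finite cpoly"
  shows "eval_poly x (initial_form w f) =
    (\<Sum>m | m \<in> Poly_Mapping.keys f \<and> (\<forall>m'\<in>Poly_Mapping.keys f. monom_weight w m \<le> monom_weight w m').
       Poly_Mapping.lookup f m * monom_val x (Poly_Mapping.lookup m))"
  unfolding initial_form_def by (subst eval_poly_sum) auto

lemma initial_form_const_weight:
  assumes "\<And>m m'. m \<in> Poly_Mapping.keys f \<Longrightarrow> m' \<in> Poly_Mapping.keys f \<Longrightarrow> monom_weight w m = monom_weight w m'"
  shows "initial_form w f = f"
proof -
  have "{m. m \<in> Poly_Mapping.keys f \<and> (\<forall>m'\<in>Poly_Mapping.keys f. monom_weight w m \<le> monom_weight w m')} = Poly_Mapping.keys f"
    using eq_refl[OF assms] by blast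
  then show ?thesis unfolding initial_form_def using sum_single_lookup[of f] by simp
qed

lemma initial_form_binomial:
  assumes "a \<noteq> b" "monom_weight w a < monom_weight w b" "Poly_Mapping.keys f = {a, b}"
  shows "initial_form w f = Poly_Mapping.single a (Poly_Mapping.lookup f a)"
proof -
  have "{m. m \<in> Poly_Mapping.keys f \<and> (\<forall>m'\<in>Poly_Mapping.keys f. monom_weight w m \<le> monom_weight w m')} = {a}"
    using assms by auto
  then show ?thesis unfolding initial_form_def by simp
qed

text \<open>Vanishing at a point is a linear condition, so it can be tested on the spanning initial
  forms.\<close>

lemma zero_set_initial_ideal:
  fixes I :: "'i::finite cpoly set"
  shows "zero_set V (initial_ideal w I) =
    {l \<in> proj_space V. \<forall>f\<in>I. \<forall>x\<in>l. eval_poly x (initial_form w f) = 0}"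
proof -
  interpret module "\<lambda>c f. const_poly c * (f :: 'i cpoly)" by (rule module_const_poly)
  have "eval_poly x g = 0" if "g \<in> initial_ideal w I" "\<forall>f\<in>I. eval_poly x (initial_form w f) = 0" for g x
    using that(1) unfolding initial_ideal_def
  proof (induction rule: span_induct_alt)
    case (step c f g)
    then show ?case using that(2) by (auto simp: eval_poly_add eval_poly_const_mult)
  qed simp
  moreover have "initial_form w f \<in> initial_ideal w I" if "f \<in> I" for f
    unfolding initial_ideal_def using that by (intro span_base) auto
  ultimately show ?thesis unfolding zero_set_def by blast
qed

definition binomial :: "('i::finite \<Rightarrow> nat) \<Rightarrow> ('i \<Rightarrow> nat) \<Rightarrow> 'i cpoly"
  where "binomial k l = Poly_Mapping.single (pm k) 1 - Poly_Mapping.single (pm l) 1"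

lemma lookup_binomial:
  "k \<noteq> l \<Longrightarrow> Poly_Mapping.lookup (binomial k l) m = (if m = pm k then 1 else if m = pm l then -1 else 0)"
  by (auto simp: binomial_def lookup_minus lookup_single when_def)

lemma keys_binomial: "k \<noteq> l \<Longrightarrow> Poly_Mapping.keys (binomial k l) = {pm k, pm l}"
  by (auto simp: in_keys_iff lookup_binomial split: if_splits)

lemma keys_binomial_subset: "Poly_Mapping.keys (binomial k l) \<subseteq> {pm k, pm l}"
  by (cases "k = l") (simp_all add: keys_binomial, simp add: binomial_def)

lemma eval_binomial: "eval_poly x (binomial k l) = monom_val x k - monom_val x l"
proof (cases "k = l")
  case False
  then show ?thesis
    by (simp add: eval_poly_monom keys_binomial lookup_binomial)
qed (simp add: binomial_def)

section \<open>Toric ideals\<close>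

lemma single_power: "Poly_Mapping.single a (1 :: 'b::comm_semiring_1) ^ n = Poly_Mapping.single (\<Sum>i<n. a) 1"
  by (induction n) (simp_all add: mult_single add.commute)

lemma prod_single:
  "finite A \<Longrightarrow> (\<Prod>i\<in>A. Poly_Mapping.single (a i) (1 :: 'b::comm_semiring_1)) = Poly_Mapping.single (\<Sum>i\<in>A. a i) 1"
  by (induction A rule: finite_induct) (simp_all add: mult_single)

context relative_poset
begin

text \<open>The exponent of the monomial in \<open>t\<close> and the \<open>z\<close> variables to
  which \<open>m\<close> is sent. The sum over \<open>i\<close> is multiplication by the
  multiplicity, in the form produced by \<open>single_power\<close>.\<close>

definition toric_exp :: "('p set \<Rightarrow>\<^sub>0 nat) \<Rightarrow> ('p option \<Rightarrow>\<^sub>0 nat)"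
  where "toric_exp m = (\<Sum>J\<in>Poly_Mapping.keys m. \<Sum>i<Poly_Mapping.lookup m J. Poly_Mapping.single None 1 + (\<Sum>p\<in>mx J. Poly_Mapping.single (Some p) 1))"

text \<open>The exponent of \<open>t\<close> is the degree, and the exponents of the
  \<open>z\<close> variables are the coordinates of \<open>mvec\<close>.\<close>

lemma toric_exp_eq_iff: "toric_exp m = toric_exp m' \<longleftrightarrow> mdeg (Poly_Mapping.lookup m) = mdeg (Poly_Mapping.lookup m') \<and>
    mvec v (Poly_Mapping.lookup m) = mvec v (Poly_Mapping.lookup m')"
proof -
  have n: "Poly_Mapping.lookup (toric_exp m) None = mdeg (Poly_Mapping.lookup m)" for m
  proof -
    have "Poly_Mapping.lookup (toric_exp m) None = (\<Sum>J\<in>Poly_Mapping.keys m. Poly_Mapping.lookup m J)"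
      by (simp add: toric_exp_def lookup_sum lookup_add lookup_single)
    also have "\<dots> = mdeg (Poly_Mapping.lookup m)"
      unfolding mdeg_def by (rule sum.mono_neutral_left) (auto simp: in_keys_iff)
    finally show ?thesis .
  qed
  have s: "real (Poly_Mapping.lookup (toric_exp m) (Some p)) = mvec v (Poly_Mapping.lookup m) $ p" for m p
  proof -
    have "Poly_Mapping.lookup (toric_exp m) (Some p) = (\<Sum>J\<in>Poly_Mapping.keys m. Poly_Mapping.lookup m J * (if p \<in> mx J then 1 else 0))"
      by (auto simp: toric_exp_def lookup_sum lookup_add lookup_single when_def intro!: sum.cong)
    also have "\<dots> = (\<Sum>J\<in>UNIV. Poly_Mapping.lookup m J * (if p \<in> mx J then 1 else 0))"
      by (rule sum.mono_neutral_left) (auto simp: in_keys_iff)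
    finally show ?thesis by (simp add: mvec_def v_nth if_distrib cong: if_cong)
  qed
  show ?thesis
  proof
    assume "toric_exp m = toric_exp m'"
    then show "mdeg (Poly_Mapping.lookup m) = mdeg (Poly_Mapping.lookup m') \<and> mvec v (Poly_Mapping.lookup m) = mvec v (Poly_Mapping.lookup m')"
      using n[of m] n[of m'] s[of m] s[of m'] by (simp add: vec_eq_iff)
  next
    assume a: "mdeg (Poly_Mapping.lookup m) = mdeg (Poly_Mapping.lookup m') \<and> mvec v (Poly_Mapping.lookup m) = mvec v (Poly_Mapping.lookup m')"
    show "toric_exp m = toric_exp m'"
    proof (rule poly_mapping_eqI)
      fix i
      show "Poly_Mapping.lookup (toric_exp m) i = Poly_Mapping.lookup (toric_exp m') i"
      proof (cases i)
        case None
        then show ?thesis using a n by simp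
      next
        case (Some p)
        have "real (Poly_Mapping.lookup (toric_exp m) i) = real (Poly_Mapping.lookup (toric_exp m') i)"
          unfolding Some s using a by simp
        then show ?thesis by simp
      qed
    qed
  qed
qed

text \<open>The homomorphism sends monomials to monomials, so membership in its kernel is decided on
  each fibre of \<open>toric_exp\<close> separately.\<close>

lemma toric_ideal_iff:
  "f \<in> toric_ideal P r r' \<longleftrightarrow> f \<in> poly_ring \<L> \<and> (\<forall>a. (\<Sum>m | m \<in> Poly_Mapping.keys f \<and> toric_exp m = a. Poly_Mapping.lookup f m) = 0)"
proof -
  have X: "var_poly None * (\<Prod>p\<in>mx J. var_poly (Some p)) =
      (Poly_Mapping.single (Poly_Mapping.single None 1 + (\<Sum>p\<in>mx J. Poly_Mapping.single (Some p) 1)) 1 :: 'p option cpoly)" for J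
    unfolding var_poly_def by (subst prod_single) (simp_all add: mult_single)
  have "subst_poly const_poly (\<lambda>J. var_poly None * (\<Prod>p\<in>mx J. var_poly (Some p))) f =
      (\<Sum>m\<in>Poly_Mapping.keys f. Poly_Mapping.single (toric_exp m) (Poly_Mapping.lookup f m))"
    unfolding subst_poly_def X single_power
    by (subst prod_single) (simp_all add: const_poly_def mult_single toric_exp_def)
  then have eq: "Poly_Mapping.lookup (subst_poly const_poly (\<lambda>J. var_poly None * (\<Prod>p\<in>mx J. var_poly (Some p))) f) a =
      (\<Sum>m | m \<in> Poly_Mapping.keys f \<and> toric_exp m = a. Poly_Mapping.lookup f m)" for a
    by (simp add: lookup_sum lookup_single when_def sum.inter_filter)
  show ?thesis
    unfolding toric_ideal_def mem_Collect_eq poly_mapping_eq_iff fun_eq_iff eq by simp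
qed

lemma binomial_in_toric_ideal:
  assumes "supp_in k \<L>" "supp_in l \<L>" "mdeg k = mdeg l" "mvec v k = mvec v l"
  shows "binomial k l \<in> toric_ideal P r r'"
proof (cases "k = l")
  case True
  then show ?thesis by (simp add: toric_ideal_iff binomial_def poly_ring_def)
next
  case False
  have "toric_exp (pm k) = toric_exp (pm l)" using assms by (simp add: toric_exp_eq_iff)
  moreover have "{m. (m = pm k \<or> m = pm l) \<and> toric_exp m = a} =
      (if toric_exp (pm k) = a then {pm k, pm l} else {})" for a
    using calculation by auto
  ultimately show ?thesis
    using False assms by (auto simp: toric_ideal_iff keys_binomial lookup_binomial poly_ring_iff)
qed

section \<open>Weights of monomials and the zero set of the initial ideal\<close>

text \<open>A single term is its own initial form, so the comparable monomial also survives the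
  second degeneration and lands in the incomparable ideal. Every monomial occurring there involves
  an incomparable pair, whereas the star is contained in the union.\<close>

lemma superadd_if_initial:
  assumes inc: "incomparable_ideal P r = initial_ideal w' (initial_ideal w (toric_ideal P r r'))"
  shows "superadd w"
  unfolding superadd_def
proof (intro ballI)
  fix J K assume L: "J \<in> \<L>" "K \<in> \<L>"
  then have L2: "J \<union> K \<in> \<L>" "star J K \<in> \<L>" using order_ideals_Un star_closed by auto
  interpret module "\<lambda>c f. const_poly c * (f :: 'p set cpoly)" by (rule module_const_poly)
  show "w J + w K \<le> w (J \<union> K) + w (star J K)"
  proof (cases "J \<subseteq> K \<or> K \<subseteq> J")
    case True
    then show ?thesis
      using star_absorb[OF L] star_absorb[OF L(2,1)] by (auto simp: Un_absorb1 Un_absorb2)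
  next
    case False
    show ?thesis
    proof (rule ccontr)
      assume gt: "\<not> ?thesis"
      define k l where "k I = unit_exp J I + unit_exp K I" and "l I = unit_exp (J \<union> K) I + unit_exp (star J K) I" for I
      have l_supp: "A = J \<union> K \<or> A = star J K" if "l A \<noteq> 0" for A
        using that by (rule contrapos_np) (simp add: l_def unit_exp_def)
      have kl: "k \<noteq> l"
      proof
        assume "k = l"
        moreover have "k J \<noteq> 0" "k K \<noteq> 0" by (simp_all add: k_def unit_exp_def)
        ultimately have "J = J \<union> K \<or> J = star J K" "K = J \<union> K \<or> K = star J K"
          using l_supp[of J] l_supp[of K] by simp_all
        then show False using False star_subset[OF L] by blast
      qed
      have wt: "monom_weight w (pm k) = w J + w K" "monom_weight w (pm l) = w (J \<union> K) + w (star J K)"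
      proof -
        have u: "(\<Sum>I\<in>UNIV. real (unit_exp A I) * w I) = w A" for A
          by (simp add: unit_exp_def if_distrib[of "\<lambda>x. real x * _"] cong: if_cong)
        show "monom_weight w (pm k) = w J + w K" "monom_weight w (pm l) = w (J \<union> K) + w (star J K)"
          by (simp_all add: monom_weight_eq k_def l_def distrib_right sum.distrib u)
      qed
      have "binomial k l \<in> toric_ideal P r r'"
      proof (rule binomial_in_toric_ideal)
        show "supp_in k \<L>" "supp_in l \<L>"
          unfolding k_def[abs_def] l_def[abs_def] using L L2 by (intro supp_in_add supp_in_unit; simp)+
        show "mdeg k = mdeg l" unfolding k_def[abs_def] l_def[abs_def] mdeg_add by simp
        show "mvec v k = mvec v l"
          unfolding k_def[abs_def] l_def[abs_def] mvec_add by (simp add: v_Un_star[OF L])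
      qed
      moreover have "initial_form w (binomial k l) = Poly_Mapping.single (pm l) (- 1)"
      proof -
        have "monom_weight w (pm l) < monom_weight w (pm k)" using gt wt by simp
        from initial_form_binomial[OF _ this, of "binomial k l"] show ?thesis
          using kl by (auto simp: keys_binomial lookup_binomial)
      qed
      ultimately have "Poly_Mapping.single (pm l) (- 1) \<in> initial_ideal w (toric_ideal P r r')"
        unfolding initial_ideal_def by (metis imageI span_base)
      moreover have "initial_form w' (Poly_Mapping.single (pm l) (- 1)) = Poly_Mapping.single (pm l) (- 1)"
        by (rule initial_form_const_weight) simp
      ultimately have mem: "Poly_Mapping.single (pm l) (- 1) \<in> incomparable_ideal P r"
        unfolding inc initial_ideal_def[of w'] by (metis imageI span_base)
      \<comment> \<open>The polynomials whose terms all satisfy \<open>Q\<close> form an ideal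
        containing the generators, so minimality of the hull transfers \<open>Q\<close> to every
        term of a member.\<close>
      define Q where "Q m \<longleftrightarrow> Poly_Mapping.keys m \<subseteq> \<L> \<and> (\<exists>A B. Poly_Mapping.lookup m A \<noteq> 0 \<and> Poly_Mapping.lookup m B \<noteq> 0 \<and>
        \<not> A \<subseteq> B \<and> \<not> B \<subseteq> A)" for m :: "'p set \<Rightarrow>\<^sub>0 nat"
      define D where "D = {f :: 'p set cpoly. \<forall>m\<in>Poly_Mapping.keys f. Q m}"
      have "incomparable_ideal P r \<subseteq> D"
        unfolding incomparable_ideal_def
      proof (rule hull_minimal)
        show "{var_poly J1 * var_poly J2 |J1 J2. J1 \<in> \<L> \<and> J2 \<in> \<L> \<and> \<not> J1 \<subseteq> J2 \<and> \<not> J2 \<subseteq> J1} \<subseteq> D"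
        proof
          fix f :: "'p set cpoly"
          assume "f \<in> {var_poly J1 * var_poly J2 |J1 J2. J1 \<in> \<L> \<and> J2 \<in> \<L> \<and> \<not> J1 \<subseteq> J2 \<and> \<not> J2 \<subseteq> J1}"
          then obtain A B where f: "f = var_poly A * var_poly B"
            and AB: "A \<in> \<L>" "B \<in> \<L>" "\<not> A \<subseteq> B" "\<not> B \<subseteq> A" by blast
          let ?m = "Poly_Mapping.single A (1::nat) + Poly_Mapping.single B 1"
          have "f = (Poly_Mapping.single ?m 1 :: 'p set cpoly)"
            by (simp add: f var_poly_def mult_single)
          moreover have "Poly_Mapping.lookup ?m A \<noteq> 0" "Poly_Mapping.lookup ?m B \<noteq> 0" "Poly_Mapping.keys ?m \<subseteq> \<L>"
            using AB by (auto simp: lookup_add lookup_single when_def in_keys_iff split: if_splits)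
          then have "Q ?m" unfolding Q_def using AB(3,4) by blast
          ultimately show "f \<in> D" by (simp add: D_def)
        qed
        have Q_add: "Q (m1 + m2)" if "Poly_Mapping.keys m1 \<subseteq> \<L>" "Q m2" for m1 m2
        proof -
          obtain A B where "Poly_Mapping.lookup m2 A \<noteq> 0" "Poly_Mapping.lookup m2 B \<noteq> 0" "\<not> A \<subseteq> B" "\<not> B \<subseteq> A"
            using \<open>Q m2\<close> unfolding Q_def by blast
          moreover from this have "Poly_Mapping.lookup (m1 + m2) A \<noteq> 0" "Poly_Mapping.lookup (m1 + m2) B \<noteq> 0"
            by (simp_all add: lookup_add)
          moreover have "Poly_Mapping.keys (m1 + m2) \<subseteq> \<L>"
            using that Poly_Mapping.keys_add[of m1 m2] unfolding Q_def by blast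
          ultimately show ?thesis unfolding Q_def by blast
        qed
        show "ideal_in \<L> D"
          unfolding ideal_in_def
        proof (intro conjI ballI)
          show "D \<subseteq> poly_ring \<L>" "0 \<in> D" by (auto simp: D_def Q_def poly_ring_def)
          show "f + g \<in> D" if "f \<in> D" "g \<in> D" for f g
            using that Poly_Mapping.keys_add[of f g] unfolding D_def by blast
          show "a * f \<in> D" if a: "a \<in> poly_ring \<L>" and f: "f \<in> D" for a f
            unfolding D_def
          proof (intro CollectI ballI)
            fix m assume "m \<in> Poly_Mapping.keys (a * f)"
            then obtain m1 m2 where m: "m = m1 + m2" "m1 \<in> Poly_Mapping.keys a" "m2 \<in> Poly_Mapping.keys f"
              using keys_mult[of a f] by auto
            have "Poly_Mapping.keys m1 \<subseteq> \<L>" "Q m2" using m a f by (auto simp: poly_ring_def D_def)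
            then show "Q m" unfolding m(1) by (rule Q_add)
          qed
        qed
      qed
      then have "Poly_Mapping.single (pm l) (- 1) \<in> D" using mem by blast
      then have "Q (pm l)" by (simp add: D_def)
      then obtain A B where AB: "l A \<noteq> 0" "l B \<noteq> 0" "\<not> A \<subseteq> B" "\<not> B \<subseteq> A"
        unfolding Q_def lookup_pm by blast
      then have "A = J \<union> K \<or> A = star J K" "B = J \<union> K \<or> B = star J K"
        using l_supp by blast+
      then show False using AB(3,4) star_subset[OF L] by blast
    qed
  qed
qed

lemma nat_weight_sums:
  assumes "supp_in k \<L>"
  shows "total (\<lambda>J. real (k J)) = real (mdeg k)" "bary (\<lambda>J. real (k J)) = mvec v k"
    "wtotal w (\<lambda>J. real (k J)) = monom_weight w (pm k)" "(\<lambda>J. real (k J)) \<in> weights"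
proof -
  show "total (\<lambda>J. real (k J)) = real (mdeg k)" "bary (\<lambda>J. real (k J)) = mvec v k"
    "wtotal w (\<lambda>J. real (k J)) = monom_weight w (pm k)"
    unfolding total_def mdeg_def bary_def mvec_def wtotal_def monom_weight_eq of_nat_sum lookup_pm
    by (rule sum.mono_neutral_left; use assms in \<open>auto simp: supp_in_def\<close>)+
  show "(\<lambda>J. real (k J)) \<in> weights" using assms by (auto simp: weights_def supp_in_def)
qed

text \<open>The gap is a sum of nonnegative contributions, one for each factor of the monomial, and
  it vanishes exactly when every factor lies in \<open>M\<close>.\<close>

lemma cell_weight:
  assumes w: "superadd w" and M: "is_cell w M c0 u" and k: "supp_in k \<L>"
  shows "monom_weight w (pm k) \<le> c0 * real (mdeg k) + u \<bullet> mvec v k"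
    and "monom_weight w (pm k) = c0 * real (mdeg k) + u \<bullet> mvec v k \<longleftrightarrow> supp_in k M"
proof -
  have eq: "c0 * real (mdeg k) + u \<bullet> mvec v k - monom_weight w (pm k) =
      (\<Sum>J\<in>\<L>. real (k J) * (c0 + u \<bullet> v J - w J))"
  proof -
    have "c0 * real (mdeg k) + u \<bullet> mvec v k = wtotal (\<lambda>J. c0 + u \<bullet> v J) (\<lambda>J. real (k J))"
      using wtotal_affine[of "\<lambda>J. real (k J)" "\<lambda>J. c0 + u \<bullet> v J" c0 u] nat_weight_sums[OF k] by simp
    then show ?thesis
      unfolding nat_weight_sums(3)[OF k, of w, symmetric]
      by (simp add: wtotal_def sum_subtractf[symmetric] right_diff_distrib)
  qed
  have nn: "0 \<le> real (k J) * (c0 + u \<bullet> v J - w J)" if "J \<in> \<L>" for J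
    using cell_le[OF w M that] by (intro mult_nonneg_nonneg) auto
  then have "0 \<le> (\<Sum>J\<in>\<L>. real (k J) * (c0 + u \<bullet> v J - w J))" by (rule sum_nonneg)
  then show "monom_weight w (pm k) \<le> c0 * real (mdeg k) + u \<bullet> mvec v k" using eq by simp
  have "monom_weight w (pm k) = c0 * real (mdeg k) + u \<bullet> mvec v k \<longleftrightarrow>
      (\<Sum>J\<in>\<L>. real (k J) * (c0 + u \<bullet> v J - w J)) = 0" using eq by auto
  also have "\<dots> \<longleftrightarrow> (\<forall>J\<in>\<L>. real (k J) * (c0 + u \<bullet> v J - w J) = 0)"
    using nn by (intro sum_nonneg_eq_0_iff) auto
  also have "\<dots> \<longleftrightarrow> supp_in k M"
    using M k by (auto simp: supp_in_def is_cell_def)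
  finally show "monom_weight w (pm k) = c0 * real (mdeg k) + u \<bullet> mvec v k \<longleftrightarrow> supp_in k M" .
qed

text \<open>Terms with a variable outside \<open>M\<close> vanish at \<open>x\<close>. A term of
  minimal weight supported in \<open>M\<close> has the largest weight possible for its image, so all
  terms of \<open>f\<close> with that image have this weight and are supported in \<open>M\<close>.
  Thus whole fibres survive, and their coefficients cancel.\<close>

lemma initial_form_vanishes:
  assumes w: "superadd w" and M: "is_cell w M c0 u" and x: "toric_pt M v x"
    and f: "f \<in> toric_ideal P r r'"
  shows "eval_poly x (initial_form w f) = 0"
proof -
  define S where "S = {m \<in> Poly_Mapping.keys f. \<forall>m'\<in>Poly_Mapping.keys f. monom_weight w m \<le> monom_weight w m'}"
  define S' where "S' = {m \<in> S. supp_in (Poly_Mapping.lookup m) M}"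
  have fL: "supp_in (Poly_Mapping.lookup m) \<L>" if "m \<in> Poly_Mapping.keys f" for m
    using f that by (auto simp: toric_ideal_iff poly_ring_iff)
  have "eval_poly x (initial_form w f) = (\<Sum>m\<in>S. Poly_Mapping.lookup f m * monom_val x (Poly_Mapping.lookup m))"
    by (simp add: eval_initial_form S_def)
  also have "\<dots> = (\<Sum>m\<in>S'. Poly_Mapping.lookup f m * monom_val x (Poly_Mapping.lookup m))"
    using x unfolding S'_def
    by (intro sum.mono_neutral_right) (auto simp: monom_eq_0_iff toric_pt_def supp_in_def S_def)
  also have "\<dots> = 0"
  proof (rule sum_graded_zero[where g = toric_exp])
    show "finite S'" by (simp add: S'_def S_def)
    show "monom_val x (Poly_Mapping.lookup m) = monom_val x (Poly_Mapping.lookup m')"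
      if "m \<in> S'" "m' \<in> S'" "toric_exp m = toric_exp m'" for m m'
      using that x unfolding S'_def toric_exp_eq_iff toric_pt_def by blast
    fix s assume s: "s \<in> S'"
    have "{m. m \<in> S' \<and> toric_exp m = toric_exp s} = {m. m \<in> Poly_Mapping.keys f \<and> toric_exp m = toric_exp s}"
    proof (intro equalityI subsetI)
      fix m assume m: "m \<in> {m. m \<in> Poly_Mapping.keys f \<and> toric_exp m = toric_exp s}"
      have sk: "s \<in> Poly_Mapping.keys f" "supp_in (Poly_Mapping.lookup s) M" and smin: "\<And>m'. m' \<in> Poly_Mapping.keys f \<Longrightarrow> monom_weight w s \<le> monom_weight w m'"
        using s by (auto simp: S'_def S_def)
      have ws: "monom_weight w s = c0 * real (mdeg (Poly_Mapping.lookup s)) + u \<bullet> mvec v (Poly_Mapping.lookup s)"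
        using cell_weight(2)[OF w M fL[OF sk(1)]] sk by simp
      have mk: "m \<in> Poly_Mapping.keys f" and t: "mdeg (Poly_Mapping.lookup m) = mdeg (Poly_Mapping.lookup s)" "mvec v (Poly_Mapping.lookup m) = mvec v (Poly_Mapping.lookup s)"
        using m by (auto simp: toric_exp_eq_iff)
      have "monom_weight w m \<le> monom_weight w s" using cell_weight(1)[OF w M fL[OF mk]] ws t by simp
      then have "monom_weight w m = monom_weight w s" using smin[OF mk] by simp
      moreover from this have "supp_in (Poly_Mapping.lookup m) M"
        using cell_weight(2)[OF w M fL[OF mk]] ws t by simp
      ultimately show "m \<in> {m. m \<in> S' \<and> toric_exp m = toric_exp s}"
        using m smin by (auto simp: S'_def S_def)
    qed (auto simp: S'_def S_def)
    then show "(\<Sum>m | m \<in> S' \<and> toric_exp m = toric_exp s. Poly_Mapping.lookup f m) = 0"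
      using f by (simp add: toric_ideal_iff)
  qed
  finally show ?thesis .
qed

text \<open>Straighten the product \<open>k\<close> of all coordinates of \<open>x\<close> that are
  not zero. If this raised the weight, the initial form of the binomial would be the monomial
  \<open>k\<close>, which does not vanish at \<open>x\<close>. Hence the weight is unchanged, and
  any cell containing the resulting chain contains the support of \<open>x\<close>.\<close>

lemma initial_zero_in_cell:
  assumes w: "superadd w" and x: "\<And>J. J \<notin> \<L> \<Longrightarrow> x J = 0"
    and z: "\<And>f. f \<in> toric_ideal P r r' \<Longrightarrow> eval_poly x (initial_form w f) = 0"
  shows "\<exists>M\<in>cells w. toric_pt M v x"
proof -
  define k where "k J = (if x J \<noteq> 0 then 1 else 0 :: nat)" for J
  have kL: "supp_in k \<L>" using x by (auto simp: supp_in_def k_def)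
  have kx: "monom_val x k \<noteq> 0" by (auto simp: monom_eq_0_iff k_def)
  have "bary (\<lambda>J. real (k J)) \<in> integer_points"
    by (auto simp: integer_points_def bary_nth intro!: Ints_sum)
  then obtain m :: "'p set \<Rightarrow> nat" where m: "(\<lambda>J. real (m J)) \<in> weights" "chain_supp m" "sum m \<L> = mdeg k"
      "bary (\<lambda>J. real (m J)) = bary (\<lambda>J. real (k J))" "wtotal w (\<lambda>J. real (k J)) \<le> wtotal w (\<lambda>J. real (m J))"
    using straighten_nat[OF w nat_weight_sums(4)[OF kL] nat_weight_sums(1)[OF kL]] by blast
  have mL: "supp_in m \<L>" using m(1) by (auto simp: weights_def supp_in_def)
  have md: "mdeg m = mdeg k"
    using m(3) mL unfolding mdeg_def by (subst sum.mono_neutral_right[of UNIV \<L>]) (auto simp: supp_in_def)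
  have mv: "mvec v m = mvec v k" using m(4) by (simp add: nat_weight_sums[OF kL] nat_weight_sums[OF mL])
  have "monom_weight w (pm k) = monom_weight w (pm m)"
  proof (rule ccontr)
    assume "monom_weight w (pm k) \<noteq> monom_weight w (pm m)"
    then have lt: "monom_weight w (pm k) < monom_weight w (pm m)" and ne: "k \<noteq> m"
      using m(5) nat_weight_sums(3)[OF kL, of w] nat_weight_sums(3)[OF mL, of w] by auto
    have "initial_form w (binomial k m) = Poly_Mapping.single (pm k) 1"
      using initial_form_binomial[OF _ lt, of "binomial k m"] ne by (auto simp: keys_binomial lookup_binomial)
    moreover have "binomial k m \<in> toric_ideal P r r'"
      by (rule binomial_in_toric_ideal[OF kL mL]) (simp_all add: md mv)
    ultimately show False using z[of "binomial k m"] kx by simp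
  qed
  moreover have "{J. m J \<noteq> 0} \<subseteq> \<L>" using mL by (auto simp: supp_in_def)
  then obtain G where G: "full_chain G" "{J. m J \<noteq> 0} \<subseteq> G"
    using full_chain_extend[of "{J. m J \<noteq> 0}"] m(2) unfolding chain_supp_def by blast
  obtain M c0 u where M: "is_cell w M c0 u" "G \<subseteq> M" using cell_exists[OF G(1)] by blast
  moreover have "supp_in m M" using G M by (auto simp: supp_in_def)
  ultimately have kM: "supp_in k M"
    using cell_weight(2)[OF w M(1) mL] cell_weight(2)[OF w M(1) kL] md mv by simp
  have "M \<subseteq> \<L>" using M by (auto simp: is_cell_def)
  have "toric_pt M v x"
    unfolding toric_pt_def
  proof (intro conjI allI impI)
    show "x J = 0" if "J \<notin> M" for J using kM that by (auto simp: supp_in_def k_def split: if_splits)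
    fix a b assume ab: "supp_in a M \<and> supp_in b M \<and> mdeg a = mdeg b \<and> mvec v a = mvec v b"
    then have L: "supp_in a \<L>" "supp_in b \<L>" using \<open>M \<subseteq> \<L>\<close> by (auto simp: supp_in_def)
    show "monom_val x a = monom_val x b"
    proof (cases "a = b")
      case False
      \<comment> \<open>Inside a cell the weight depends only on degree and vector, so such a
        binomial is its own initial form and yields an equation for \<open>x\<close>.\<close>
      have "monom_weight w (pm a) = monom_weight w (pm b)"
        using cell_weight(2)[OF w M(1) L(1)] cell_weight(2)[OF w M(1) L(2)] ab by simp
      then have "initial_form w (binomial a b) = binomial a b"
        using False by (intro initial_form_const_weight) (auto simp: keys_binomial)
      moreover have "binomial a b \<in> toric_ideal P r r'"
        by (rule binomial_in_toric_ideal[OF L]) (use ab in auto)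
      ultimately show ?thesis using z[of "binomial a b"] by (simp add: eval_binomial)
    qed simp
  qed
  then show ?thesis using M by (auto simp: cells_def)
qed

end

definition toric_locus :: "'i set \<Rightarrow> ('i \<Rightarrow> real ^ 'n) \<Rightarrow> ('i::finite \<Rightarrow> complex) set set"
  where "toric_locus M v = proj_point ` {x. toric_pt M v x \<and> x \<noteq> (\<lambda>_. 0)}"

lemma (in relative_poset) zero_set_initial:
  assumes w: "superadd w"
  shows "zero_set \<L> (initial_ideal w (toric_ideal P r r')) = (\<Union>M\<in>cells w. toric_locus M v)"
  unfolding zero_set_initial_ideal
proof (intro equalityI subsetI)
  fix l assume l: "l \<in> {l \<in> proj_space \<L>. \<forall>f\<in>toric_ideal P r r'. \<forall>x\<in>l. eval_poly x (initial_form w f) = 0}"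
  then obtain x where x: "l = proj_point x" "\<And>J. J \<notin> \<L> \<Longrightarrow> x J = 0" "x \<noteq> (\<lambda>_. 0)"
    by (auto simp: proj_space_def)
  have "x \<in> l" unfolding x(1) proj_point_def by (auto intro!: exI[of _ 1])
  then have "\<exists>M\<in>cells w. toric_pt M v x" using l by (intro initial_zero_in_cell[OF w x(2)]) auto
  then show "l \<in> (\<Union>M\<in>cells w. toric_locus M v)" using x by (auto simp: toric_locus_def)
next
  fix l assume "l \<in> (\<Union>M\<in>cells w. toric_locus M v)"
  then obtain M c0 u x where M: "is_cell w M c0 u" and x: "toric_pt M v x" "x \<noteq> (\<lambda>_. 0)" "l = proj_point x"
    by (auto simp: toric_locus_def cells_def)
  have "x J = 0" if "J \<notin> \<L>" for J using that M x by (auto simp: toric_pt_def is_cell_def)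
  then have "l \<in> proj_space \<L>" using x by (auto simp: proj_space_def)
  moreover have "eval_poly y (initial_form w f) = 0" if "f \<in> toric_ideal P r r'" "y \<in> l" for f y
    using initial_form_vanishes[OF w M toric_pt_scale[OF x(1)] that(1)] that(2) x(3)
    by (auto simp: proj_point_def)
  ultimately show "l \<in> {l \<in> proj_space \<L>. \<forall>f\<in>toric_ideal P r r'. \<forall>x\<in>l. eval_poly x (initial_form w f) = 0}"
    by blast
qed

section \<open>Toric varieties of saturated configurations\<close>

text \<open>The ambient set \<open>V\<close> may exceed \<open>M\<close>, since the locus of a cell
  lives in the projective space of all ideals. By \<open>vertex\<close> each coordinate chart
  belongs to a cone of the normal fan; \<open>saturated\<close> is normality with the coefficient
  sum recorded as degree.\<close>

locale lattice_config =
  fixes V M :: "'i::finite set" and v :: "'i \<Rightarrow> real ^ 'n::finite"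
  assumes MV: "M \<subseteq> V" and M_ne: "M \<noteq> {}"
    and v_int: "J \<in> M \<Longrightarrow> v J \<in> integer_points"
    and vertex: "J \<in> M \<Longrightarrow> {v J} face_of convex hull (v ` M)"
    and saturated: "\<And>c k. (\<And>J. J \<in> M \<Longrightarrow> 0 \<le> c J) \<Longrightarrow> sum c M = real k \<Longrightarrow>
      (\<Sum>J\<in>M. c J *\<^sub>R v J) \<in> integer_points \<Longrightarrow>
      \<exists>m. supp_in m M \<and> mdeg m = k \<and> mvec v m = (\<Sum>J\<in>M. c J *\<^sub>R v J)"
begin

abbreviation "Q \<equiv> convex hull (v ` M)"

definition ncone :: "'i set \<Rightarrow> (real ^ 'n) set"
  where "ncone A = {u. \<forall>K\<in>A. \<forall>J\<in>M. u \<bullet> v K \<le> u \<bullet> v J}"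

abbreviation "dmon A \<equiv> dual_monoid (ncone A)"

definition face_set :: "'i set \<Rightarrow> bool" where "face_set A \<longleftrightarrow> A \<subseteq> M \<and> A \<noteq> {}"

definition vsum :: "'i set \<Rightarrow> real ^ 'n" where "vsum A = (\<Sum>K\<in>A. v K)"

definition xprod :: "('i \<Rightarrow> complex) \<Rightarrow> 'i set \<Rightarrow> complex" where "xprod x A = (\<Prod>K\<in>A. x K)"

definition nonzero_on :: "'i set \<Rightarrow> ('i \<Rightarrow> complex) \<Rightarrow> bool" where "nonzero_on A x \<longleftrightarrow> (\<forall>K\<in>A. x K \<noteq> 0)"

definition const_exp :: "nat \<Rightarrow> 'i set \<Rightarrow> 'i \<Rightarrow> nat" where "const_exp N A J = (if J \<in> A then N else 0)"

lemma const_exp_simps: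
  "monom_val x (const_exp N A) = xprod x A ^ N" "mdeg (const_exp N A) = N * card A"
  "mvec v (const_exp N A) = real N *\<^sub>R vsum A" "A \<subseteq> M \<Longrightarrow> supp_in (const_exp N A) M"
proof -
  have "monom_val x (const_exp N A) = (\<Prod>J\<in>UNIV. if J \<in> A then x J ^ N else 1)"
    unfolding monom_val_def by (intro prod.cong) (auto simp: const_exp_def)
  then show "monom_val x (const_exp N A) = xprod x A ^ N"
    by (simp add: prod.If_cases xprod_def prod_power_distrib)
  have "mdeg (const_exp N A) = (\<Sum>J\<in>UNIV. if J \<in> A then N else 0)"
    by (simp add: mdeg_def const_exp_def)
  then show "mdeg (const_exp N A) = N * card A" by (simp add: sum.If_cases)
  have "mvec v (const_exp N A) = (\<Sum>J\<in>UNIV. if J \<in> A then real N *\<^sub>R v J else 0)"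
    unfolding mvec_def by (intro sum.cong) (auto simp: const_exp_def)
  then show "mvec v (const_exp N A) = real N *\<^sub>R vsum A"
    by (simp add: sum.If_cases vsum_def scaleR_sum_right)
  show "A \<subseteq> M \<Longrightarrow> supp_in (const_exp N A) M" by (auto simp: supp_in_def const_exp_def)
qed

lemma xprod_nonzero: "xprod x A \<noteq> 0 \<longleftrightarrow> nonzero_on A x"
  by (auto simp: xprod_def nonzero_on_def)

text \<open>A face is the hull of the configuration points on it, so minimality over the face can be
  tested on these points.\<close>

lemma normal_cone_face:
  assumes F: "F face_of Q" "F \<noteq> {}"
  obtains A where "face_set A" "normal_cone Q F = ncone A"
proof
  define A where "A = {J\<in>M. v J \<in> F}"
  obtain S' where S': "S' \<subseteq> v ` M" "F = convex hull S'"
    by (rule face_of_convex_hull_subset[OF _ F(1)]) (simp_all add: finite_imp_compact)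
  have S'F: "S' \<subseteq> v ` A"
    using S' hull_subset[of S' convex] by (auto simp: A_def)
  have "S' \<noteq> {}" using F(2) S' by auto
  then show "face_set A" using S'F by (auto simp: face_set_def A_def)
  show "normal_cone Q F = ncone A"
  proof (intro equalityI subsetI)
    fix u assume "u \<in> normal_cone Q F"
    moreover have "v J \<in> Q" if "J \<in> M" for J using that by (intro hull_inc) auto
    ultimately show "u \<in> ncone A" by (auto simp: normal_cone_def ncone_def A_def)
  next
    fix u assume u: "u \<in> ncone A"
    have "F \<subseteq> {y. u \<bullet> y \<le> u \<bullet> v J}" if "J \<in> M" for J
      unfolding S'(2)
      by (rule hull_minimal) (use u that S'F in \<open>auto simp: ncone_def convex_halfspace_le\<close>)
    then have *: "v ` M \<subseteq> {x. u \<bullet> x \<ge> u \<bullet> y}" if "y \<in> F" for y using that by auto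
    have "Q \<subseteq> {x. u \<bullet> x \<ge> u \<bullet> y}" if "y \<in> F" for y
      by (rule hull_minimal[where S = convex]) (use *[OF that] convex_halfspace_ge in auto)
    then show "u \<in> normal_cone Q F" by (auto simp: normal_cone_def)
  qed
qed

lemma normal_cone_vertex: "normal_cone Q {v K} = ncone {K}"
proof (intro equalityI subsetI)
  fix u assume "u \<in> normal_cone Q {v K}"
  moreover have "v J \<in> Q" if "J \<in> M" for J using that by (intro hull_inc) auto
  ultimately show "u \<in> ncone {K}" by (auto simp: normal_cone_def ncone_def)
next
  fix u assume u: "u \<in> ncone {K}"
  have "Q \<subseteq> {x. u \<bullet> x \<ge> u \<bullet> v K}"
    by (rule hull_minimal[where S = convex]) (use u convex_halfspace_ge in \<open>auto simp: ncone_def\<close>)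
  then show "u \<in> normal_cone Q {v K}" by (auto simp: normal_cone_def)
qed

lemma ncone_Un: "ncone A \<inter> ncone B = ncone (A \<union> B)"
  by (auto simp: ncone_def)

lemma integer_points_add: "x \<in> integer_points \<Longrightarrow> y \<in> integer_points \<Longrightarrow> x + y \<in> integer_points"
  and integer_points_diff: "x \<in> integer_points \<Longrightarrow> y \<in> integer_points \<Longrightarrow> x - y \<in> integer_points"
  and integer_points_scale: "x \<in> integer_points \<Longrightarrow> real N *\<^sub>R x \<in> integer_points"
  and integer_points_sum: "(\<And>a. a \<in> B \<Longrightarrow> f a \<in> integer_points) \<Longrightarrow> sum f B \<in> integer_points"
  for x y :: "real ^ 'n" and f :: "'b \<Rightarrow> real ^ 'n"
  by (auto simp: integer_points_def sum_component intro!: Ints_sum)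

lemma dual_monoid_add: "a \<in> dual_monoid s \<Longrightarrow> b \<in> dual_monoid s \<Longrightarrow> a + b \<in> dual_monoid s"
  and dual_monoid_zero: "0 \<in> dual_monoid s" for s :: "(real ^ 'n) set"
  by (auto simp: dual_monoid_def integer_points_add inner_add_left) (simp add: integer_points_def)

lemma dual_monoid_diff: "K \<in> A \<Longrightarrow> face_set A \<Longrightarrow> J \<in> M \<Longrightarrow> v J - v K \<in> dmon A"
  by (auto simp: dual_monoid_def ncone_def integer_points_diff v_int face_set_def inner_diff_left inner_diff_right
      inner_commute subset_iff)

text \<open>A functional in \<open>ncone A\<close> is constant on \<open>A\<close> and takes its
  minimum over the configuration there; both vectors use the same number of points.\<close>

lemma dual_monoid_intro:
  assumes A: "face_set A" and k: "supp_in k M" "mdeg k = N * card A"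
  shows "mvec v k - real N *\<^sub>R vsum A \<in> dmon A"
  unfolding dual_monoid_def
proof (intro CollectI conjI ballI)
  have "mvec v k = (\<Sum>J\<in>M. real (k J) *\<^sub>R v J)"
    unfolding mvec_def using k(1) by (intro sum.mono_neutral_right) (auto simp: supp_in_def)
  then have "mvec v k \<in> integer_points" by (simp add: integer_points_sum integer_points_scale v_int)
  moreover have "vsum A \<in> integer_points"
    unfolding vsum_def using A by (intro integer_points_sum v_int) (auto simp: face_set_def)
  ultimately show "mvec v k - real N *\<^sub>R vsum A \<in> integer_points"
    by (simp add: integer_points_diff integer_points_scale)
  fix u assume u: "u \<in> ncone A"
  obtain K where K: "K \<in> A" "K \<in> M" using A by (auto simp: face_set_def)
  have eq: "u \<bullet> v I = u \<bullet> v K" if "I \<in> A" for I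
  proof -
    have "I \<in> M" using that A by (auto simp: face_set_def)
    then have "u \<bullet> v I \<le> u \<bullet> v K" "u \<bullet> v K \<le> u \<bullet> v I" using u K that by (auto simp: ncone_def)
    then show ?thesis by simp
  qed
  have "u \<bullet> vsum A = real (card A) * (u \<bullet> v K)"
    by (simp add: vsum_def inner_sum_right eq)
  moreover have "u \<bullet> mvec v k \<ge> real (mdeg k) * (u \<bullet> v K)"
  proof -
    have "real (mdeg k) * (u \<bullet> v K) = (\<Sum>J\<in>UNIV. real (k J) * (u \<bullet> v K))"
      by (simp add: mdeg_def sum_distrib_right)
    also have "\<dots> \<le> (\<Sum>J\<in>UNIV. real (k J) * (u \<bullet> v J))"
    proof (rule sum_mono)
      fix J show "real (k J) * (u \<bullet> v K) \<le> real (k J) * (u \<bullet> v J)"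
        using u K k(1) by (cases "J \<in> M") (auto simp: ncone_def supp_in_def intro!: mult_left_mono)
    qed
    also have "\<dots> = u \<bullet> mvec v k" by (simp add: mvec_def inner_sum_right)
    finally show ?thesis .
  qed
  ultimately show "0 \<le> (mvec v k - real N *\<^sub>R vsum A) \<bullet> u"
    using k(2) by (simp add: inner_diff_right inner_commute[of _ u])
qed

lemma sum_pairs:
  fixes c :: "'i \<times> 'i \<Rightarrow> real"
  shows "(\<Sum>p\<in>M\<times>A. c p *\<^sub>R (v (fst p) - v (snd p))) =
    (\<Sum>J\<in>M. (\<Sum>K\<in>A. c (J, K)) *\<^sub>R v J) - (\<Sum>K\<in>A. (\<Sum>J\<in>M. c (J, K)) *\<^sub>R v K)"
proof -
  have "(\<Sum>p\<in>M\<times>A. c p *\<^sub>R (v (fst p) - v (snd p))) =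
      (\<Sum>p\<in>M\<times>A. c p *\<^sub>R v (fst p)) - (\<Sum>p\<in>M\<times>A. c p *\<^sub>R v (snd p))"
    by (simp add: sum_subtractf algebra_simps)
  also have "(\<Sum>p\<in>M\<times>A. c p *\<^sub>R v (fst p)) = (\<Sum>J\<in>M. (\<Sum>K\<in>A. c (J, K)) *\<^sub>R v J)"
    by (simp add: sum.cartesian_product' scaleR_left.sum)
  also have "(\<Sum>p\<in>M\<times>A. c p *\<^sub>R v (snd p)) = (\<Sum>J\<in>M. \<Sum>K\<in>A. c (J, K) *\<^sub>R v K)"
    by (simp add: sum.cartesian_product')
  also have "\<dots> = (\<Sum>K\<in>A. (\<Sum>J\<in>M. c (J, K)) *\<^sub>R v K)"
    by (subst sum.swap) (simp add: scaleR_left.sum)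
  finally show ?thesis .
qed

text \<open>Farkas: the finitely generated cone of differences is closed. A functional separating
  \<open>m\<close> from it is nonnegative on all differences, so it lies in \<open>ncone A\<close>
  and contradicts membership of \<open>m\<close> in the dual.\<close>

lemma dual_monoid_cone:
  assumes A: "face_set A" and m: "m \<in> dmon A"
  obtains c where "\<And>p. 0 \<le> c p" "m = (\<Sum>p\<in>M\<times>A. c p *\<^sub>R (v (fst p) - v (snd p)))"
proof -
  define D where "D = (\<lambda>p. v (fst p) - v (snd p)) ` (M \<times> A)"
  define C where "C = {\<Sum>p\<in>M\<times>A. c p *\<^sub>R (v (fst p) - v (snd p)) | c. \<forall>p. 0 \<le> c p}"
  have "convex_cone C"
    unfolding convex_cone_iff
  proof (intro conjI ballI allI impI)
    show "0 \<in> C" unfolding C_def by (intro CollectI exI[of _ "\<lambda>_. 0"]) auto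
    show "x + y \<in> C" if "x \<in> C" "y \<in> C" for x y
    proof -
      obtain c d where "\<forall>p. 0 \<le> c p" "\<forall>p. 0 \<le> d p" "x = (\<Sum>p\<in>M\<times>A. c p *\<^sub>R (v (fst p) - v (snd p)))"
        "y = (\<Sum>p\<in>M\<times>A. d p *\<^sub>R (v (fst p) - v (snd p)))" using \<open>x \<in> C\<close> \<open>y \<in> C\<close> unfolding C_def by blast
      then show ?thesis unfolding C_def
        by (intro CollectI exI[of _ "\<lambda>p. c p + d p"]) (simp add: scaleR_left_distrib sum.distrib)
    qed
    show "a *\<^sub>R x \<in> C" if "x \<in> C" "0 \<le> a" for a x
    proof -
      obtain c where "\<forall>p. 0 \<le> c p" "x = (\<Sum>p\<in>M\<times>A. c p *\<^sub>R (v (fst p) - v (snd p)))"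
        using \<open>x \<in> C\<close> unfolding C_def by blast
      then show ?thesis using that(2) unfolding C_def
        by (intro CollectI exI[of _ "\<lambda>p. a * c p"]) (simp add: scaleR_sum_right)
    qed
  qed
  moreover have "D \<subseteq> C"
  proof
    fix d assume "d \<in> D"
    then obtain q where q: "q \<in> M \<times> A" "d = v (fst q) - v (snd q)" unfolding D_def by blast
    have "(\<Sum>p\<in>M\<times>A. (if p = q then 1 else 0 :: real) *\<^sub>R (v (fst p) - v (snd p))) =
        (\<Sum>p\<in>M\<times>A. if p = q then v (fst p) - v (snd p) else 0)" by (intro sum.cong) auto
    also have "\<dots> = d" using q by simp
    finally show "d \<in> C" unfolding C_def
      by (intro CollectI exI[of _ "\<lambda>p. if p = q then 1 else 0"]) simp
  qed
  ultimately have CH: "convex_cone hull D \<subseteq> C" by (rule_tac hull_minimal)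
  have "m \<in> convex_cone hull D"
  proof (rule ccontr)
    assume "m \<notin> convex_cone hull D"
    moreover have "closed (convex_cone hull D)"
      unfolding D_def by (rule closed_convex_cone_hull) simp
    ultimately obtain a b where ab: "a \<bullet> m < b" "\<And>x. x \<in> convex_cone hull D \<Longrightarrow> a \<bullet> x > b"
      using separating_hyperplane_closed_point[OF convex_convex_cone_hull] by blast
    have b: "b < 0" using ab(2)[OF convex_cone_hull_contains_0] by simp
    have nn: "0 \<le> a \<bullet> x" if x: "x \<in> convex_cone hull D" for x
    proof (rule ccontr)
      assume "\<not> 0 \<le> a \<bullet> x"
      then have neg: "a \<bullet> x < 0" by simp
      \<comment> \<open>Both numbers are negative; this multiple of \<open>x\<close> attains the
        value \<open>b\<close>, against the strict separation.\<close>
      have "(b / (a \<bullet> x)) *\<^sub>R x \<in> convex_cone hull D"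
        by (rule convex_cone_hull_mul[OF x]) (use b neg in \<open>simp add: divide_nonpos_neg\<close>)
      from ab(2)[OF this] show False using neg by simp
    qed
    have "a \<in> ncone A"
      unfolding ncone_def
    proof (intro CollectI ballI)
      fix K J assume "K \<in> A" "J \<in> M"
      then have "v J - v K \<in> D" by (force simp: D_def)
      then have "0 \<le> a \<bullet> (v J - v K)" by (intro nn hull_inc)
      then show "a \<bullet> v K \<le> a \<bullet> v J" by (simp add: inner_diff_right)
    qed
    then have "0 \<le> m \<bullet> a" using m by (simp add: dual_monoid_def)
    then show False using ab(1) b by (simp add: inner_commute)
  qed
  then have "m \<in> C" using CH by blast
  then show ?thesis using that unfolding C_def by blast
qed

text \<open>A lattice point of the dual cone becomes, after adding a large multiple of \<^term>\<open>vsum A\<close>, a lattice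
  point of a dilate of the polytope, to which saturation applies.\<close>

lemma dual_monoid_elim:
  assumes A: "face_set A" and m: "m \<in> dmon A"
  shows "\<exists>N0. \<forall>N\<ge>N0. \<exists>k. supp_in k M \<and> mdeg k = N * card A \<and> mvec v k = m + real N *\<^sub>R vsum A"
proof -
  obtain c where c: "\<And>p. 0 \<le> c p" "m = (\<Sum>p\<in>M\<times>A. c p *\<^sub>R (v (fst p) - v (snd p)))"
    by (rule dual_monoid_cone[OF A m]) blast
  have AM: "A \<subseteq> M" using A by (simp add: face_set_def)
  \<comment> \<open>For each \<open>K\<close> in \<open>A\<close> this bounds the total amount of
    \<open>v K\<close> that is subtracted, so any \<open>N\<close> above it makes the coefficients
    \<open>e\<close> nonnegative.\<close>
  define t where "t = (\<Sum>K\<in>A. \<Sum>J\<in>M. c (J, K))"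
  have t: "(\<Sum>J\<in>M. c (J, K)) \<le> t" if "K \<in> A" for K
    unfolding t_def using that c(1) by (intro member_le_sum) (auto intro!: sum_nonneg)
  show ?thesis
  proof (intro exI[of _ "nat \<lceil>t\<rceil>"] allI impI)
    fix N assume "nat \<lceil>t\<rceil> \<le> N"
    then have tN: "t \<le> real N" by linarith
    define e where "e J = (\<Sum>K\<in>A. c (J, K)) + (if J \<in> A then real N - (\<Sum>I\<in>M. c (I, J)) else 0)" for J
    have restr: "(\<Sum>J\<in>M. (if J \<in> A then f J else 0)) = sum f A" for f :: "'i \<Rightarrow> 'b::comm_monoid_add"
      using AM by (simp add: sum.inter_restrict[symmetric] Int_absorb1)
    have "(\<Sum>J\<in>M. e J *\<^sub>R v J) = (\<Sum>J\<in>M. (\<Sum>K\<in>A. c (J, K)) *\<^sub>R v J + (if J \<in> A then (real N - (\<Sum>I\<in>M. c (I, J))) *\<^sub>R v J else 0))"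
      by (intro sum.cong refl) (simp add: e_def scaleR_left_distrib)
    also have "\<dots> = (\<Sum>J\<in>M. (\<Sum>K\<in>A. c (J, K)) *\<^sub>R v J) + (\<Sum>K\<in>A. (real N - (\<Sum>I\<in>M. c (I, K))) *\<^sub>R v K)"
      unfolding sum.distrib restr ..
    also have "\<dots> = m + real N *\<^sub>R vsum A"
      unfolding c(2) sum_pairs
      by (simp add: vsum_def scaleR_left_diff_distrib sum_subtractf scaleR_sum_right)
    finally have eq: "(\<Sum>J\<in>M. e J *\<^sub>R v J) = m + real N *\<^sub>R vsum A" .
    have "\<exists>k. supp_in k M \<and> mdeg k = N * card A \<and> mvec v k = (\<Sum>J\<in>M. e J *\<^sub>R v J)"
    proof (rule saturated)
      show "0 \<le> e J" if "J \<in> M" for J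
        using c(1) t[of J] tN by (auto simp: e_def intro!: add_nonneg_nonneg sum_nonneg)
      have "sum e M = (\<Sum>J\<in>M. \<Sum>K\<in>A. c (J, K)) + (\<Sum>K\<in>A. real N - (\<Sum>I\<in>M. c (I, K)))"
        unfolding e_def sum.distrib restr ..
      then show "sum e M = real (N * card A)"
        using sum.swap[of "\<lambda>J K. c (J, K)" A M] by (simp add: sum_subtractf)
      have "vsum A \<in> integer_points"
        unfolding vsum_def using AM by (intro integer_points_sum v_int) auto
      moreover have "m \<in> integer_points" using m by (simp add: dual_monoid_def)
      ultimately show "(\<Sum>J\<in>M. e J *\<^sub>R v J) \<in> integer_points"
        unfolding eq by (intro integer_points_add integer_points_scale)
    qed
    then show "\<exists>k. supp_in k M \<and> mdeg k = N * card A \<and> mvec v k = m + real N *\<^sub>R vsum A" unfolding eq .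
  qed
qed

text \<open>The character \<open>m\<close> is the monomial \<open>k\<close> divided by the \<open>N\<close>-th power of the product of the coordinates in \<open>A\<close>.\<close>

definition rep :: "'i set \<Rightarrow> real ^ 'n \<Rightarrow> nat \<Rightarrow> ('i \<Rightarrow> nat) \<Rightarrow> bool"
  where "rep A m N k \<longleftrightarrow> supp_in k M \<and> mdeg k = N * card A \<and> mvec v k = m + real N *\<^sub>R vsum A"

lemma rep_exists: "face_set A \<Longrightarrow> m \<in> dmon A \<Longrightarrow> \<exists>N0. \<forall>N\<ge>N0. \<exists>k. rep A m N k"
  unfolding rep_def by (rule dual_monoid_elim)

section \<open>Characters attached to projective points\<close>

text \<open>\<open>SOME\<close> picks one of the possible quotients; \<open>chart_of_eq\<close>
  shows that all agree on toric points without zeros on \<open>A\<close>. The value 0 elsewhere is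
  the convention of \<open>chart\<close>.\<close>

definition chart_of :: "'i set \<Rightarrow> ('i \<Rightarrow> complex) \<Rightarrow> real ^ 'n \<Rightarrow> complex"
  where "chart_of A x m = (if m \<in> dmon A then
     (SOME z. \<exists>N k. rep A m N k \<and> z = monom_val x k / xprod x A ^ N) else 0)"

text \<open>After cross multiplication two representations of \<open>m\<close> give monomials of
  equal degree and equal vector, which coincide on toric points.\<close>

lemma chart_of_eq:
  assumes A: "face_set A" and x: "toric_pt M v x" "nonzero_on A x" and r: "rep A m N k"
  shows "chart_of A x m = monom_val x k / xprod x A ^ N"
proof -
  have xA: "xprod x A \<noteq> 0" using x(2) by (simp add: xprod_nonzero)
  have AM: "A \<subseteq> M" using A by (simp add: face_set_def)
  have m: "m \<in> dmon A"
    using dual_monoid_intro[OF A, of k N] r by (simp add: rep_def)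
  have "\<exists>N' k'. rep A m N' k' \<and> (SOME z. \<exists>N k. rep A m N k \<and> z = monom_val x k / xprod x A ^ N) = monom_val x k' / xprod x A ^ N'"
    by (rule someI[where P = "\<lambda>z. \<exists>N k. rep A m N k \<and> z = monom_val x k / xprod x A ^ N"]) (use r in blast)
  then obtain N' k' where r': "rep A m N' k'" and g: "chart_of A x m = monom_val x k' / xprod x A ^ N'"
    using m unfolding chart_of_def by auto
  have "monom_val x (\<lambda>J. k J + const_exp N' A J) = monom_val x (\<lambda>J. k' J + const_exp N A J)"
  proof -
    have "supp_in (\<lambda>J. k J + const_exp N' A J) M" "supp_in (\<lambda>J. k' J + const_exp N A J) M"
      using r r' AM by (auto simp: rep_def intro!: supp_in_add const_exp_simps)
    moreover have "mdeg (\<lambda>J. k J + const_exp N' A J) = mdeg (\<lambda>J. k' J + const_exp N A J)"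
      using r r' by (simp add: rep_def mdeg_add const_exp_simps)
    moreover have "mvec v (\<lambda>J. k J + const_exp N' A J) = mvec v (\<lambda>J. k' J + const_exp N A J)"
      using r r' by (simp add: rep_def mvec_add const_exp_simps algebra_simps)
    ultimately show ?thesis using x(1) unfolding toric_pt_def by blast
  qed
  then have "monom_val x k * xprod x A ^ N' = monom_val x k' * xprod x A ^ N"
    by (simp add: monom_add const_exp_simps)
  then show ?thesis unfolding g using xA by (simp add: frac_eq_eq)
qed

lemma rep_add: "rep A m N k \<Longrightarrow> rep A m' N' k' \<Longrightarrow> rep A (m + m') (N + N') (\<lambda>J. k J + k' J)"
  by (simp add: rep_def supp_in_add mdeg_add mvec_add algebra_simps)

lemma rep_zero: "rep A 0 0 (\<lambda>_. 0)"
  by (simp add: rep_def supp_in_def)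

lemma chart_of_in_chart:
  assumes A: "face_set A" and x: "toric_pt M v x" "nonzero_on A x"
  shows "chart_of A x \<in> chart (ncone A)"
  unfolding chart_def
proof (intro CollectI conjI ballI allI impI)
  show "chart_of A x 0 = 1" using chart_of_eq[OF A x rep_zero] by simp
  show "chart_of A x m = 0" if "m \<notin> dmon A" for m using that by (simp add: chart_of_def)
  fix a b assume "a \<in> dmon A" "b \<in> dmon A"
  then obtain N k N' k' where r: "rep A a N k" "rep A b N' k'" using rep_exists[OF A] by (meson order_refl)
  show "chart_of A x (a + b) = chart_of A x a * chart_of A x b"
    by (simp add: chart_of_eq[OF A x rep_add[OF r]] chart_of_eq[OF A x r(1)] chart_of_eq[OF A x r(2)] monom_add power_add)
qed

lemma chart_of_diff:
  assumes A: "face_set A" and x: "toric_pt M v x" "nonzero_on A x" and K: "K \<in> A" and J: "J \<in> M"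
  shows "chart_of A x (v J - v K) = x J / x K"
proof -
  have AM: "A \<subseteq> M" using A by (simp add: face_set_def)
  \<comment> \<open>A representation with \<open>N = 1\<close>: in the product over \<open>A\<close>
    the factor \<open>K\<close> is replaced by \<open>J\<close>.\<close>
  define k where "k = (\<lambda>I. unit_exp J I + const_exp 1 (A - {K}) I)"
  have vs: "vsum A = v K + vsum (A - {K})" using K by (simp add: vsum_def sum.remove)
  have cA: "card A = Suc (card (A - {K}))" using card_Suc_Diff1[OF finite K] by simp
  have xp: "xprod x A = x K * xprod x (A - {K})" using K by (simp add: xprod_def prod.remove)
  have "A - {K} \<subseteq> M" using AM by blast
  then have "supp_in k M" unfolding k_def using J by (intro supp_in_add supp_in_unit const_exp_simps)
  then have "rep A (v J - v K) 1 k"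
    by (simp add: rep_def k_def mdeg_add mvec_add const_exp_simps cA vs)
  from chart_of_eq[OF A x this] have "chart_of A x (v J - v K) = x J * xprod x (A - {K}) / xprod x A"
    by (simp add: k_def monom_add const_exp_simps)
  moreover have "xprod x (A - {K}) \<noteq> 0" "x K \<noteq> 0" using x(2) K by (auto simp: xprod_nonzero nonzero_on_def)
  ultimately show ?thesis by (simp add: xp)
qed

text \<open>Numerator and denominator are both multiplied by the \<open>N\<close>-th power of the
  product over \<open>B - A\<close>, which is not zero at \<open>x\<close>.\<close>

lemma chart_of_mono:
  assumes A: "face_set A" and B: "face_set B" and AB: "A \<subseteq> B" and x: "toric_pt M v x" "nonzero_on B x" and m: "m \<in> dmon A"
  shows "chart_of B x m = chart_of A x m"
proof -
  have nA: "nonzero_on A x" "nonzero_on (B - A) x" using x(2) AB by (auto simp: nonzero_on_def)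
  have BM: "B - A \<subseteq> M" using B by (auto simp: face_set_def)
  obtain N k where r: "rep A m N k" using rep_exists[OF A m] by blast
  have vs: "vsum B = vsum A + vsum (B - A)"
    using AB by (simp add: vsum_def sum.subset_diff[of A B] add.commute)
  have xp: "xprod x B = xprod x A * xprod x (B - A)"
    using AB by (simp add: xprod_def prod.subset_diff[of A B] mult.commute)
  have cB: "card B = card A + card (B - A)" using AB by (simp add: card_Diff_subset card_mono)
  have "rep B m N (\<lambda>J. k J + const_exp N (B - A) J)"
    using r supp_in_add[OF _ const_exp_simps(4)[OF BM]]
    by (simp add: rep_def mdeg_add mvec_add const_exp_simps vs cB algebra_simps del: card_Diff_subset)
  from chart_of_eq[OF B x this] have "chart_of B x m = monom_val x k * xprod x (B - A) ^ N / xprod x B ^ N"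
    by (simp add: monom_add const_exp_simps)
  then show ?thesis
    using nA(2) unfolding xprod_nonzero[symmetric] chart_of_eq[OF A x(1) nA(1) r] by (simp add: xp power_mult_distrib)
qed

lemma chart_of_scale:
  assumes A: "face_set A" and x: "toric_pt M v x" "nonzero_on A x" and c: "c \<noteq> 0"
  shows "chart_of A (\<lambda>J. c * x J) = chart_of A x"
proof
  fix m
  show "chart_of A (\<lambda>J. c * x J) m = chart_of A x m"
  proof (cases "m \<in> dmon A")
    case True
    obtain N k where r: "rep A m N k" using rep_exists[OF A True] by blast
    have x': "toric_pt M v (\<lambda>J. c * x J)" "nonzero_on A (\<lambda>J. c * x J)" using toric_pt_scale[OF x(1)] x(2) c by (auto simp: nonzero_on_def)
    have "xprod (\<lambda>J. c * x J) A = c ^ card A * xprod x A" by (simp add: xprod_def prod.distrib)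
    moreover have "monom_val (\<lambda>J. c * x J) k = c ^ (N * card A) * monom_val x k" using r by (simp add: monom_scale rep_def)
    ultimately show ?thesis
      using c by (simp add: chart_of_eq[OF A x r] chart_of_eq[OF A x' r] power_mult_distrib mult.commute flip: power_mult)
  qed (simp add: chart_of_def)
qed

text \<open>The homogeneous coordinates of the point with character \<open>\<gamma>\<close>,
  normalised to 1 at \<open>K\<close>.\<close>

definition chart_pt :: "(real ^ 'n \<Rightarrow> complex) \<Rightarrow> 'i \<Rightarrow> 'i \<Rightarrow> complex"
  where "chart_pt \<gamma> K J = (if J \<in> M then \<gamma> (v J - v K) else 0)"

lemma chart_mult: "\<gamma> \<in> chart s \<Longrightarrow> a \<in> dual_monoid s \<Longrightarrow> b \<in> dual_monoid s \<Longrightarrow> \<gamma> (a + b) = \<gamma> a * \<gamma> b"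
  and chart_zero: "\<gamma> \<in> chart s \<Longrightarrow> \<gamma> 0 = 1"
  and chart_outside: "\<gamma> \<in> chart s \<Longrightarrow> a \<notin> dual_monoid s \<Longrightarrow> \<gamma> a = 0"
  for s :: "(real ^ 'n) set"
  by (auto simp: chart_def)

lemma chart_power:
  fixes s :: "(real ^ 'n) set"
  assumes "\<gamma> \<in> chart s" "a \<in> dual_monoid s"
  shows "real N *\<^sub>R a \<in> dual_monoid s \<and> \<gamma> (real N *\<^sub>R a) = \<gamma> a ^ N"
proof (induction N)
  case (Suc N)
  have "real (Suc N) *\<^sub>R a = a + real N *\<^sub>R a" by (simp add: scaleR_left_distrib)
  then show ?case using Suc assms by (simp add: dual_monoid_add chart_mult)
qed (use assms in \<open>simp add: dual_monoid_zero chart_zero\<close>)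

lemma chart_prod:
  fixes s :: "(real ^ 'n) set" and k :: "'i \<Rightarrow> nat"
  assumes \<gamma>: "\<gamma> \<in> chart s" and "finite B" and d: "\<And>J. J \<in> B \<Longrightarrow> d J \<in> dual_monoid s"
  shows "(\<Sum>J\<in>B. real (k J) *\<^sub>R d J) \<in> dual_monoid s \<and> \<gamma> (\<Sum>J\<in>B. real (k J) *\<^sub>R d J) = (\<Prod>J\<in>B. \<gamma> (d J) ^ k J)"
  using assms(2) d
proof (induction B rule: finite_induct)
  case (insert a B)
  then show ?case using chart_power[OF \<gamma>, of "d a" "k a"] by (simp add: dual_monoid_add chart_mult[OF \<gamma>])
qed (simp add: dual_monoid_zero chart_zero[OF \<gamma>])

lemma chart_pt_monom:
  assumes A: "face_set A" and \<gamma>: "\<gamma> \<in> chart (ncone A)" and K: "K \<in> A" and k: "supp_in k M"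
  shows "mvec v k - real (mdeg k) *\<^sub>R v K \<in> dmon A" "monom_val (chart_pt \<gamma> K) k = \<gamma> (mvec v k - real (mdeg k) *\<^sub>R v K)"
proof -
  have "mvec v k = (\<Sum>J\<in>M. real (k J) *\<^sub>R v J)" "mdeg k = sum k M"
    unfolding mvec_def mdeg_def using k by (intro sum.mono_neutral_right; auto simp: supp_in_def)+
  then have eq: "mvec v k - real (mdeg k) *\<^sub>R v K = (\<Sum>J\<in>M. real (k J) *\<^sub>R (v J - v K))"
    by (simp add: scaleR_right_diff_distrib sum_subtractf scaleR_left.sum)
  have *: "(\<Sum>J\<in>M. real (k J) *\<^sub>R (v J - v K)) \<in> dmon A \<and>
      \<gamma> (\<Sum>J\<in>M. real (k J) *\<^sub>R (v J - v K)) = (\<Prod>J\<in>M. \<gamma> (v J - v K) ^ k J)"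
    by (rule chart_prod[OF \<gamma>]) (use dual_monoid_diff[OF K A] in auto)
  then show "mvec v k - real (mdeg k) *\<^sub>R v K \<in> dmon A" unfolding eq by blast
  have "monom_val (chart_pt \<gamma> K) k = (\<Prod>J\<in>M. chart_pt \<gamma> K J ^ k J)"
    unfolding monom_val_def using k by (intro prod.mono_neutral_right) (auto simp: supp_in_def)
  also have "\<dots> = (\<Prod>J\<in>M. \<gamma> (v J - v K) ^ k J)" by (intro prod.cong) (auto simp: chart_pt_def)
  finally show "monom_val (chart_pt \<gamma> K) k = \<gamma> (mvec v k - real (mdeg k) *\<^sub>R v K)" using * eq by simp
qed

lemma chart_pt_toric:
  assumes A: "face_set A" and \<gamma>: "\<gamma> \<in> chart (ncone A)" and K: "K \<in> A"
  shows "toric_pt M v (chart_pt \<gamma> K)"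
  unfolding toric_pt_def using chart_pt_monom(2)[OF A \<gamma> K] by (auto simp: chart_pt_def)

text \<open>For two indices in \<open>A\<close> both differences of their vectors lie in the dual
  monoid, so the character takes invertible values on them.\<close>

lemma chart_pt_nonzero:
  assumes A: "face_set A" and \<gamma>: "\<gamma> \<in> chart (ncone A)" and K: "K \<in> A"
  shows "nonzero_on A (chart_pt \<gamma> K)"
  unfolding nonzero_on_def
proof
  fix I assume I: "I \<in> A"
  have M: "I \<in> M" "K \<in> M" using A I K by (auto simp: face_set_def)
  have "\<gamma> (v I - v K) * \<gamma> (v K - v I) = \<gamma> ((v I - v K) + (v K - v I))"
    by (rule chart_mult[OF \<gamma>, symmetric]) (use dual_monoid_diff A I K M in auto)
  also have "\<dots> = 1" using chart_zero[OF \<gamma>] by simp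
  finally show "chart_pt \<gamma> K I \<noteq> 0" using M by (auto simp: chart_pt_def)
qed

lemma chart_of_chart_pt:
  assumes A: "face_set A" and \<gamma>: "\<gamma> \<in> chart (ncone A)" and K: "K \<in> A"
  shows "chart_of A (chart_pt \<gamma> K) = \<gamma>"
proof
  fix m
  note x = chart_pt_toric[OF assms] chart_pt_nonzero[OF assms]
  show "chart_of A (chart_pt \<gamma> K) m = \<gamma> m"
  proof (cases "m \<in> dmon A")
    case True
    obtain N k where r: "rep A m N k" using rep_exists[OF A True] by blast
    have k: "supp_in k M" "mdeg k = N * card A" "mvec v k = m + real N *\<^sub>R vsum A" using r by (auto simp: rep_def)
    have AM: "A \<subseteq> M" using A by (simp add: face_set_def)
    note ind = chart_pt_monom[OF A \<gamma> K const_exp_simps(4)[OF AM, of N]]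
    have "mvec v k - real (mdeg k) *\<^sub>R v K = m + (mvec v (const_exp N A) - real (mdeg (const_exp N A)) *\<^sub>R v K)"
      using k by (simp add: const_exp_simps)
    then have "monom_val (chart_pt \<gamma> K) k = \<gamma> m * xprod (chart_pt \<gamma> K) A ^ N"
      using chart_pt_monom(2)[OF A \<gamma> K k(1)] chart_mult[OF \<gamma> True ind(1)] ind(2) by (simp add: const_exp_simps(1))
    then show ?thesis using chart_of_eq[OF A x r] x(2) by (simp add: xprod_nonzero[symmetric])
  next
    case False
    then show ?thesis using chart_outside[OF \<gamma>] by (simp add: chart_of_def)
  qed
qed

lemma chart_pt_chart_of:
  assumes "face_set A" "toric_pt M v x" "nonzero_on A x" "K \<in> A"
  shows "chart_pt (chart_of A x) K = (\<lambda>J. (1 / x K) * x J)"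
  using chart_of_diff[OF assms] assms(2) by (auto simp: chart_pt_def toric_pt_def)

section \<open>Points\<close>

lemma proj_point_scale: "c \<noteq> 0 \<Longrightarrow> proj_point (\<lambda>J. c * x J) = proj_point x"
proof -
  assume c: "c \<noteq> 0"
  have "\<exists>d. (\<lambda>J. e * x J) = (\<lambda>J. d * (c * x J)) \<and> d \<noteq> 0" if "e \<noteq> 0" for e
    using c that by (intro exI[of _ "e / c"]) auto
  moreover have "\<exists>d. (\<lambda>J. e * (c * x J)) = (\<lambda>J. d * x J) \<and> d \<noteq> 0" if "e \<noteq> 0" for e
    using c that by (intro exI[of _ "e * c"]) auto
  ultimately show ?thesis unfolding proj_point_def by blast
qed

lemma proj_point_self: "x \<in> proj_point x"
  unfolding proj_point_def by (auto intro!: exI[of _ 1])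

text \<open>For a cone of the fan this is the largest index set with that cone. It depends on the
  cone alone, which is what a point of the toric variety records.\<close>

definition base_set :: "(real ^ 'n) set \<Rightarrow> 'i set"
  where "base_set s = {K\<in>M. \<forall>J\<in>M. v J - v K \<in> dual_monoid s}"

abbreviation "\<Sigma> \<equiv> normal_fan Q"

lemma base_set_ncone: assumes A: "face_set A" shows "A \<subseteq> base_set (ncone A)" "ncone (base_set (ncone A)) = ncone A" "face_set (base_set (ncone A))"
proof -
  show sub: "A \<subseteq> base_set (ncone A)" using A dual_monoid_diff[OF _ A] by (auto simp: base_set_def face_set_def)
  then show "face_set (base_set (ncone A))" using A by (auto simp: face_set_def base_set_def)
  have "u \<bullet> v K \<le> u \<bullet> v J" if "u \<in> ncone A" "K \<in> base_set (ncone A)" "J \<in> M" for u K J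
  proof -
    have "0 \<le> (v J - v K) \<bullet> u" using that by (simp add: base_set_def dual_monoid_def)
    then show ?thesis by (simp add: inner_diff_right inner_commute[of _ u])
  qed
  then have "ncone A \<subseteq> ncone (base_set (ncone A))" by (auto simp: ncone_def)
  moreover have "ncone (base_set (ncone A)) \<subseteq> ncone A" using sub by (auto simp: ncone_def)
  ultimately show "ncone (base_set (ncone A)) = ncone A" by blast
qed

lemma fan_cone:
  assumes "s \<in> \<Sigma>" shows "face_set (base_set s)" "ncone (base_set s) = s"
proof -
  obtain F where F: "F face_of Q" "F \<noteq> {}" "s = normal_cone Q F" using assms by (auto simp: normal_fan_def)
  obtain A where "face_set A" "s = ncone A" by (rule normal_cone_face[OF F(1,2)]) (use F in blast)
  then show "face_set (base_set s)" "ncone (base_set s) = s" using base_set_ncone by simp_all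
qed

lemma vertex_cone: "K \<in> M \<Longrightarrow> ncone {K} \<in> \<Sigma>" "K \<in> M \<Longrightarrow> face_set {K}"
  using vertex normal_cone_vertex by (auto simp: normal_fan_def face_set_def)

text \<open>For \<open>I\<close> in the base set the difference of \<open>v I\<close> and a vector
  from \<open>A\<close> is invertible in the dual monoid, so the character cannot vanish on
  it.\<close>

lemma nonzero_on_base_set:
  assumes A: "face_set A" and x: "toric_pt M v x" "nonzero_on A x"
  shows "nonzero_on (base_set (ncone A)) x"
  unfolding nonzero_on_def
proof
  fix I assume I: "I \<in> base_set (ncone A)"
  obtain K where K: "K \<in> A" "K \<in> M" using A by (auto simp: face_set_def)
  have IM: "I \<in> M" "v K - v I \<in> dmon A" using I K by (auto simp: base_set_def)
  note \<gamma> = chart_of_in_chart[OF A x]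
  have "chart_of A x (v I - v K) * chart_of A x (v K - v I) = chart_of A x ((v I - v K) + (v K - v I))"
    by (rule chart_mult[OF \<gamma>, symmetric]) (use dual_monoid_diff[OF K(1) A IM(1)] IM(2) in auto)
  also have "\<dots> = 1" using chart_zero[OF \<gamma>] by simp
  finally have "chart_of A x (v I - v K) \<noteq> 0" by auto
  then show "x I \<noteq> 0" using chart_of_diff[OF A x K(1) IM(1)] by auto
qed

abbreviation "Y \<equiv> toric_locus M v"

lemma Y_cases:
  assumes "l \<in> Y" obtains x where "toric_pt M v x" "x \<noteq> (\<lambda>_. 0)" "l = proj_point x"
  using assms by (auto simp: toric_locus_def)

lemma mem_Y:
  assumes "l \<in> Y" "x \<in> l" shows "toric_pt M v x" "x \<noteq> (\<lambda>_. 0)" "l = proj_point x"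
proof -
  obtain y where y: "toric_pt M v y" "y \<noteq> (\<lambda>_. 0)" "l = proj_point y" using assms(1) by (rule Y_cases)
  then obtain c where c: "c \<noteq> 0" "x = (\<lambda>J. c * y J)" using assms(2) by (auto simp: proj_point_def)
  show "toric_pt M v x" using c toric_pt_scale[OF y(1)] by simp
  show "x \<noteq> (\<lambda>_. 0)" using y(2) c by (auto simp: fun_eq_iff)
  show "l = proj_point x" unfolding c(2) y(3) by (rule proj_point_scale[OF c(1), symmetric])
qed

lemma Y_coordinate:
  assumes "toric_pt M v x" "x \<noteq> (\<lambda>_. 0)" obtains K where "K \<in> M" "x K \<noteq> 0"
  using assms unfolding toric_pt_def fun_eq_iff by blast

text \<open>Collecting the characters in all charts that contain the point gives its whole gluing
  class at once, without choosing a chart.\<close>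

definition toric_map :: "('i \<Rightarrow> complex) set \<Rightarrow> 'n toric_point"
  where "toric_map l = {(s, \<gamma>). s \<in> \<Sigma> \<and> (\<exists>x\<in>l. nonzero_on (base_set s) x \<and> \<gamma> = chart_of (base_set s) x)}"

lemma mem_toric_map:
  assumes l: "l \<in> Y" "x \<in> l"
  shows "(s, \<gamma>) \<in> toric_map l \<longleftrightarrow> s \<in> \<Sigma> \<and> nonzero_on (base_set s) x \<and> \<gamma> = chart_of (base_set s) x"
proof
  assume "(s, \<gamma>) \<in> toric_map l"
  then obtain y where y: "s \<in> \<Sigma>" "y \<in> l" "nonzero_on (base_set s) y" "\<gamma> = chart_of (base_set s) y" by (auto simp: toric_map_def)
  have "y \<in> proj_point x" using mem_Y(3)[OF l] y(2) by simp
  then obtain c where c: "c \<noteq> 0" "y = (\<lambda>J. c * x J)" by (auto simp: proj_point_def)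
  then have "nonzero_on (base_set s) x" using y(3) by (auto simp: nonzero_on_def)
  then show "s \<in> \<Sigma> \<and> nonzero_on (base_set s) x \<and> \<gamma> = chart_of (base_set s) x"
    using y c chart_of_scale[OF fan_cone(1)[OF y(1)] mem_Y(1)[OF l], of c] by simp
next
  assume "s \<in> \<Sigma> \<and> nonzero_on (base_set s) x \<and> \<gamma> = chart_of (base_set s) x"
  then show "(s, \<gamma>) \<in> toric_map l" using l by (auto simp: toric_map_def)
qed

lemma chart_pt_in_Y:
  assumes s: "s \<in> \<Sigma>" and \<gamma>: "\<gamma> \<in> chart s" and K: "K \<in> base_set s"
  shows "proj_point (chart_pt \<gamma> K) \<in> Y" "(s, \<gamma>) \<in> toric_map (proj_point (chart_pt \<gamma> K))"
proof -
  note A = fan_cone[OF s]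
  have \<gamma>': "\<gamma> \<in> chart (ncone (base_set s))" using \<gamma> A by simp
  note x = chart_pt_toric[OF A(1) \<gamma>' K] chart_pt_nonzero[OF A(1) \<gamma>' K]
  have "chart_pt \<gamma> K \<noteq> (\<lambda>_. 0)" using x(2) K by (auto simp: nonzero_on_def fun_eq_iff)
  then show Y: "proj_point (chart_pt \<gamma> K) \<in> Y" using x by (auto simp: toric_locus_def)
  show "(s, \<gamma>) \<in> toric_map (proj_point (chart_pt \<gamma> K))"
    unfolding mem_toric_map[OF Y proj_point_self] using s x chart_of_chart_pt[OF A(1) \<gamma>' K] by simp
qed

text \<open>The cone \<open>s \<inter> t\<close> belongs to the union of the two base sets. A common
  extension of both characters to it exists exactly when no coordinate of the point vanishes on that
  union, and it is then the character of the point there.\<close>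

lemma glue_eq:
  assumes s: "s \<in> \<Sigma>" and \<gamma>: "\<gamma> \<in> chart s" and K: "K \<in> base_set s"
  shows "glue \<Sigma> `` {(s, \<gamma>)} = toric_map (proj_point (chart_pt \<gamma> K))"
proof (rule set_eqI)
  fix z :: "(real ^ 'n) set \<times> (real ^ 'n \<Rightarrow> complex)"
  obtain t \<beta> where z: "z = (t, \<beta>)" by (cases z)
  note A = fan_cone[OF s]
  have \<gamma>': "\<gamma> \<in> chart (ncone (base_set s))" using \<gamma> A by simp
  note x = chart_pt_toric[OF A(1) \<gamma>' K] chart_pt_nonzero[OF A(1) \<gamma>' K]
  note Y = chart_pt_in_Y(1)[OF assms]
  have U: "face_set (base_set s \<union> base_set t)" "s \<inter> t = ncone (base_set s \<union> base_set t)" "ncone (base_set t) = t" "face_set (base_set t)" if "t \<in> \<Sigma>"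
    using A fan_cone[OF that] ncone_Un[of "base_set s" "base_set t"] by (auto simp: face_set_def)
  have "(\<exists>\<delta>\<in>chart (s \<inter> t). (\<forall>m\<in>dual_monoid s. \<delta> m = \<gamma> m) \<and> (\<forall>m\<in>dual_monoid t. \<delta> m = \<beta> m)) \<longleftrightarrow>
      nonzero_on (base_set t) (chart_pt \<gamma> K) \<and> \<beta> = chart_of (base_set t) (chart_pt \<gamma> K)" if t: "t \<in> \<Sigma>" and \<beta>: "\<beta> \<in> chart t"
  proof
    note U = U[OF t]
    assume "\<exists>\<delta>\<in>chart (s \<inter> t). (\<forall>m\<in>dual_monoid s. \<delta> m = \<gamma> m) \<and> (\<forall>m\<in>dual_monoid t. \<delta> m = \<beta> m)"
    then obtain \<delta> where \<delta>: "\<delta> \<in> chart (ncone (base_set s \<union> base_set t))" "\<forall>m\<in>dmon (base_set s). \<delta> m = \<gamma> m" "\<forall>m\<in>dmon (base_set t). \<delta> m = \<beta> m"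
      unfolding U(2,3) A(2) by blast
    have K': "K \<in> base_set s \<union> base_set t" using K by blast
    have pteq: "chart_pt \<delta> K = chart_pt \<gamma> K"
      using \<delta>(2) dual_monoid_diff[OF K A(1)] by (auto simp: chart_pt_def)
    have n: "nonzero_on (base_set s \<union> base_set t) (chart_pt \<gamma> K)" using chart_pt_nonzero[OF U(1) \<delta>(1) K'] pteq by simp
    then have nt: "nonzero_on (base_set t) (chart_pt \<gamma> K)" by (auto simp: nonzero_on_def)
    have "\<beta> m = chart_of (base_set t) (chart_pt \<gamma> K) m" for m
    proof (cases "m \<in> dmon (base_set t)")
      case True
      have "chart_of (base_set t) (chart_pt \<gamma> K) m = chart_of (base_set s \<union> base_set t) (chart_pt \<gamma> K) m"
        using chart_of_mono[OF U(4) U(1) _ x(1) n True] by simp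
      also have "\<dots> = \<delta> m" using chart_of_chart_pt[OF U(1) \<delta>(1) K'] pteq by simp
      finally show ?thesis using \<delta>(3) True by simp
    next
      case False
      then show ?thesis using chart_outside[OF \<beta>] U(3) by (simp add: chart_of_def)
    qed
    then show "nonzero_on (base_set t) (chart_pt \<gamma> K) \<and> \<beta> = chart_of (base_set t) (chart_pt \<gamma> K)" using nt by auto
  next
    note U = U[OF t]
    assume b: "nonzero_on (base_set t) (chart_pt \<gamma> K) \<and> \<beta> = chart_of (base_set t) (chart_pt \<gamma> K)"
    have n: "nonzero_on (base_set s \<union> base_set t) (chart_pt \<gamma> K)" using b x(2) by (auto simp: nonzero_on_def)
    have "chart_of (base_set s \<union> base_set t) (chart_pt \<gamma> K) \<in> chart (s \<inter> t)"
      unfolding U(2) by (rule chart_of_in_chart[OF U(1) x(1) n])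
    moreover have "chart_of (base_set s \<union> base_set t) (chart_pt \<gamma> K) m = \<gamma> m" if "m \<in> dual_monoid s" for m
      using chart_of_mono[OF A(1) U(1) _ x(1) n, of m] that A(2) chart_of_chart_pt[OF A(1) \<gamma>' K] by simp
    moreover have "chart_of (base_set s \<union> base_set t) (chart_pt \<gamma> K) m = \<beta> m" if "m \<in> dual_monoid t" for m
      using chart_of_mono[OF U(4) U(1) _ x(1) n, of m] that U(3) b by simp
    ultimately show "\<exists>\<delta>\<in>chart (s \<inter> t). (\<forall>m\<in>dual_monoid s. \<delta> m = \<gamma> m) \<and> (\<forall>m\<in>dual_monoid t. \<delta> m = \<beta> m)" by blast
  qed
  moreover have "\<beta> \<in> chart t" if "t \<in> \<Sigma>" "nonzero_on (base_set t) (chart_pt \<gamma> K)" "\<beta> = chart_of (base_set t) (chart_pt \<gamma> K)"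
    using chart_of_in_chart[OF U(4)[OF that(1)] x(1) that(2)] that(3) U(3)[OF that(1)] by simp
  ultimately show "z \<in> glue \<Sigma> `` {(s, \<gamma>)} \<longleftrightarrow> z \<in> toric_map (proj_point (chart_pt \<gamma> K))"
    unfolding z mem_toric_map[OF Y proj_point_self] Image_singleton_iff glue_def
    using s \<gamma> by auto
qed

lemma toric_map_chart_of:
  assumes l: "l \<in> Y" "x \<in> l" and K: "K \<in> M" "x K \<noteq> 0"
  shows "(ncone {K}, chart_of (base_set (ncone {K})) x) \<in> toric_map l" "nonzero_on (base_set (ncone {K})) x" "K \<in> base_set (ncone {K})"
proof -
  note x = mem_Y(1)[OF l]
  show n: "nonzero_on (base_set (ncone {K})) x" by (rule nonzero_on_base_set[OF vertex_cone(2)[OF K(1)] x]) (use K in \<open>simp add: nonzero_on_def\<close>)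
  show "(ncone {K}, chart_of (base_set (ncone {K})) x) \<in> toric_map l" using mem_toric_map[OF l] vertex_cone(1)[OF K(1)] n by blast
  show "K \<in> base_set (ncone {K})" using base_set_ncone(1)[OF vertex_cone(2)[OF K(1)]] by simp
qed

text \<open>The character in the chart of a coordinate \<open>K\<close> that is not zero determines
  all quotients \<open>x J / x K\<close>.\<close>

lemma toric_map_inj: "inj_on toric_map Y"
proof (rule inj_onI)
  fix l l' assume l: "l \<in> Y" "l' \<in> Y" "toric_map l = toric_map l'"
  obtain x where x: "toric_pt M v x" "x \<noteq> (\<lambda>_. 0)" "l = proj_point x" using l(1) by (rule Y_cases)
  obtain y where y: "toric_pt M v y" "y \<noteq> (\<lambda>_. 0)" "l' = proj_point y" using l(2) by (rule Y_cases)
  have xl: "x \<in> l" "y \<in> l'" using x y proj_point_self by auto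
  obtain K where K: "K \<in> M" "x K \<noteq> 0" using Y_coordinate[OF x(1,2)] by blast
  note g = toric_map_chart_of[OF l(1) xl(1) K]
  let ?A = "base_set (ncone {K})"
  have A: "face_set ?A" using base_set_ncone(3)[OF vertex_cone(2)[OF K(1)]] .
  have h: "nonzero_on ?A y" "chart_of ?A x = chart_of ?A y"
    using g(1) unfolding l(3) mem_toric_map[OF l(2) xl(2)] by auto
  have yK: "y K \<noteq> 0" using h(1) g(3) by (auto simp: nonzero_on_def)
  have "(\<lambda>J. (1 / x K) * x J) = (\<lambda>J. (1 / y K) * y J)"
    using chart_pt_chart_of[OF A x(1) g(2,3)] chart_pt_chart_of[OF A y(1) h(1) g(3)] h(2) by metis
  then have "proj_point (\<lambda>J. (1 / x K) * x J) = proj_point (\<lambda>J. (1 / y K) * y J)" by (rule arg_cong)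
  moreover have "proj_point (\<lambda>J. (1 / x K) * x J) = proj_point x" by (rule proj_point_scale) (use K in simp)
  moreover have "proj_point (\<lambda>J. (1 / y K) * y J) = proj_point y" by (rule proj_point_scale) (use yK in simp)
  ultimately show "l = l'" using x y by simp
qed

lemma toric_points_eq: "toric_points \<Sigma> = toric_map ` Y"
proof (intro equalityI subsetI)
  fix \<xi> assume "\<xi> \<in> toric_points \<Sigma>"
  then obtain s \<gamma> where s: "s \<in> \<Sigma>" "\<gamma> \<in> chart s" "\<xi> = glue \<Sigma> `` {(s, \<gamma>)}"
    unfolding toric_points_def quotient_def by auto
  obtain K where "K \<in> base_set s" using fan_cone(1)[OF s(1)] by (auto simp: face_set_def)
  then show "\<xi> \<in> toric_map ` Y" using glue_eq[OF s(1,2)] chart_pt_in_Y(1)[OF s(1,2)] s(3) by blast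
next
  fix \<xi> assume "\<xi> \<in> toric_map ` Y"
  then obtain l where l: "l \<in> Y" "\<xi> = toric_map l" by blast
  obtain x where x: "toric_pt M v x" "x \<noteq> (\<lambda>_. 0)" "l = proj_point x" using l(1) by (rule Y_cases)
  have xl: "x \<in> l" using x proj_point_self by auto
  obtain K where K: "K \<in> M" "x K \<noteq> 0" using Y_coordinate[OF x(1,2)] by blast
  note g = toric_map_chart_of[OF l(1) xl K]
  let ?s = "ncone {K}"
  note s = vertex_cone(1)[OF K(1)]
  note A = fan_cone[OF s]
  have \<gamma>: "chart_of (base_set ?s) x \<in> chart ?s" using chart_of_in_chart[OF A(1) x(1) g(2)] A(2) by simp
  have "proj_point (chart_pt (chart_of (base_set ?s) x) K) = l"
    unfolding chart_pt_chart_of[OF A(1) x(1) g(2,3)] x(3) by (rule proj_point_scale) (use K in simp)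
  then have "\<xi> = glue \<Sigma> `` {(?s, chart_of (base_set ?s) x)}" using glue_eq[OF s \<gamma> g(3)] l(2) by simp
  then show "\<xi> \<in> toric_points \<Sigma>" unfolding toric_points_def using s \<gamma> by (auto intro!: quotientI)
qed

section \<open>Topology and regular functions\<close>

lemma eval_char_superset:
  assumes "finite B" "Poly_Mapping.keys f \<subseteq> B"
  shows "eval_char \<gamma> f = (\<Sum>m\<in>B. Poly_Mapping.lookup f m * \<gamma> m)"
  unfolding eval_char_def using assms by (intro sum.mono_neutral_left) (auto simp: in_keys_iff)

lemma eval_char_sum_single:
  assumes "finite B"
  shows "eval_char \<gamma> (\<Sum>b\<in>B. Poly_Mapping.single (e b) (c b)) = (\<Sum>b\<in>B. c b * \<gamma> (e b))"
proof -
  have add: "eval_char \<gamma> (f + g) = eval_char \<gamma> f + eval_char \<gamma> g" for f g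
  proof -
    have fin: "finite (Poly_Mapping.keys f \<union> Poly_Mapping.keys g)" by simp
    have "Poly_Mapping.keys (f + g) \<subseteq> Poly_Mapping.keys f \<union> Poly_Mapping.keys g" by (rule Poly_Mapping.keys_add)
    then show ?thesis
      by (simp add: eval_char_superset[OF fin] lookup_add sum.distrib algebra_simps)
  qed
  have single: "eval_char \<gamma> (Poly_Mapping.single m a) = a * \<gamma> m" for m a
    by (simp add: eval_char_def)
  have zero: "eval_char \<gamma> 0 = 0" by (simp add: eval_char_def)
  show ?thesis using assms by (induction B rule: finite_induct) (simp_all add: add single zero)
qed

lemma keys_sum_single: "Poly_Mapping.keys (\<Sum>b\<in>B. Poly_Mapping.single (e b) (c b)) \<subseteq> e ` B"
proof
  fix m assume "m \<in> Poly_Mapping.keys (\<Sum>b\<in>B. Poly_Mapping.single (e b) (c b))"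
  then have "(\<Sum>b\<in>B. Poly_Mapping.lookup (Poly_Mapping.single (e b) (c b)) m) \<noteq> 0" by (simp add: in_keys_iff lookup_sum)
  then obtain b where "b \<in> B" "Poly_Mapping.lookup (Poly_Mapping.single (e b) (c b)) m \<noteq> 0" by (meson sum.neutral)
  then show "m \<in> e ` B" by (auto simp: lookup_single when_def split: if_splits)
qed

text \<open>All large \<open>N\<close> are provided, so that numerator and denominator of a regular
  function can later receive the same degree.\<close>

lemma homogenize:
  assumes A: "face_set A" and f: "f \<in> monoid_algebra (dmon A)"
  shows "\<exists>N0. \<forall>N\<ge>N0. \<exists>F. F \<in> poly_ring V \<and> homogeneous (N * card A) F \<and>
    (\<forall>x. toric_pt M v x \<longrightarrow> nonzero_on A x \<longrightarrow> eval_poly x F = xprod x A ^ N * eval_char (chart_of A x) f)"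
proof -
  have fm: "m \<in> dmon A" if "m \<in> Poly_Mapping.keys f" for m using f that by (auto simp: monoid_algebra_def)
  then have "\<forall>m\<in>Poly_Mapping.keys f. \<exists>N0. \<forall>N\<ge>N0. \<exists>k. rep A m N k" using rep_exists[OF A] by blast
  then obtain n where n: "\<And>m N. m \<in> Poly_Mapping.keys f \<Longrightarrow> n m \<le> N \<Longrightarrow> \<exists>k. rep A m N k" by metis
  show ?thesis
  \<comment> \<open>The inserted 0 covers the case that \<open>f\<close> has no terms.\<close>
  proof (intro exI[of _ "Max (insert 0 (n ` Poly_Mapping.keys f))"] allI impI)
    fix N assume "Max (insert 0 (n ` Poly_Mapping.keys f)) \<le> N"
    then have "\<forall>m\<in>Poly_Mapping.keys f. \<exists>k. rep A m N k" using n by simp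
    then obtain k where k: "\<And>m. m \<in> Poly_Mapping.keys f \<Longrightarrow> rep A m N (k m)" by metis
    define F where "F = (\<Sum>m\<in>Poly_Mapping.keys f. Poly_Mapping.single (pm (k m)) (Poly_Mapping.lookup f m))"
    have keysF: "\<exists>m\<in>Poly_Mapping.keys f. p = pm (k m)" if "p \<in> Poly_Mapping.keys F" for p
      using that keys_sum_single unfolding F_def by fast
    have "F \<in> poly_ring V"
      unfolding poly_ring_iff
    proof
      fix p assume "p \<in> Poly_Mapping.keys F"
      then obtain m where "m \<in> Poly_Mapping.keys f" "p = pm (k m)" using keysF by blast
      then show "supp_in (Poly_Mapping.lookup p) V" using k MV by (auto simp: rep_def supp_in_def)
    qed
    moreover have "homogeneous (N * card A) F"
      unfolding homogeneous_iff
    proof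
      fix p assume "p \<in> Poly_Mapping.keys F"
      then obtain m where "m \<in> Poly_Mapping.keys f" "p = pm (k m)" using keysF by blast
      then show "mdeg (Poly_Mapping.lookup p) = N * card A" using k by (simp add: rep_def)
    qed
    moreover have "eval_poly x F = xprod x A ^ N * eval_char (chart_of A x) f" if x: "toric_pt M v x" "nonzero_on A x" for x
    proof -
      have "eval_poly x F = (\<Sum>m\<in>Poly_Mapping.keys f. Poly_Mapping.lookup f m * monom_val x (k m))"
        unfolding F_def by (subst eval_poly_sum) simp_all
      also have "\<dots> = (\<Sum>m\<in>Poly_Mapping.keys f. xprod x A ^ N * (Poly_Mapping.lookup f m * chart_of A x m))"
      proof (rule sum.cong[OF refl])
        fix m assume "m \<in> Poly_Mapping.keys f"
        from chart_of_eq[OF A x k[OF this]] show "Poly_Mapping.lookup f m * monom_val x (k m) = xprod x A ^ N * (Poly_Mapping.lookup f m * chart_of A x m)"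
          using x(2) by (simp add: xprod_nonzero[symmetric])
      qed
      finally show ?thesis by (simp add: eval_char_def sum_distrib_left)
    qed
    ultimately show "\<exists>F. F \<in> poly_ring V \<and> homogeneous (N * card A) F \<and>
      (\<forall>x. toric_pt M v x \<longrightarrow> nonzero_on A x \<longrightarrow> eval_poly x F = xprod x A ^ N * eval_char (chart_of A x) f)" by blast
  qed
qed

text \<open>Division by \<open>x K ^ d\<close> turns each term into a character. Terms with a
  variable outside \<open>M\<close> vanish on the locus and are dropped.\<close>

lemma dehomogenize:
  assumes g: "g \<in> poly_ring V" "homogeneous d g" and K: "K \<in> M"
  shows "\<exists>f\<in>monoid_algebra (dual_monoid (ncone {K})). \<forall>x. toric_pt M v x \<longrightarrow> x K \<noteq> 0 \<longrightarrow>
    eval_char (chart_of (base_set (ncone {K})) x) f = eval_poly x g / x K ^ d"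
proof -
  note A = vertex_cone(2)[OF K]
  define B where "B = {m \<in> Poly_Mapping.keys g. supp_in (Poly_Mapping.lookup m) M}"
  define e where "e m = mvec v (Poly_Mapping.lookup m) - real d *\<^sub>R v K" for m
  define f where "f = (\<Sum>m\<in>B. Poly_Mapping.single (e m) (Poly_Mapping.lookup g m))"
  have finB: "finite B" by (simp add: B_def)
  have md: "mdeg (Poly_Mapping.lookup m) = d" if "m \<in> B" for m using that g(2) by (auto simp: B_def homogeneous_iff)
  have r: "rep {K} (e m) d (Poly_Mapping.lookup m)" if "m \<in> B" for m
    using that md[OF that] by (simp add: rep_def B_def e_def vsum_def)
  have em: "e m \<in> dmon {K}" if "m \<in> B" for m
    using dual_monoid_intro[OF A, of "Poly_Mapping.lookup m" d] r[OF that] by (simp add: rep_def)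
  have "Poly_Mapping.keys f \<subseteq> e ` B" unfolding f_def by (rule keys_sum_single)
  then have "f \<in> monoid_algebra (dmon {K})"
    using em by (auto simp: monoid_algebra_def)
  moreover have "eval_char (chart_of (base_set (ncone {K})) x) f = eval_poly x g / x K ^ d"
    if x: "toric_pt M v x" "x K \<noteq> 0" for x
  proof -
    have nK: "nonzero_on {K} x" using x(2) by (simp add: nonzero_on_def)
    have AK: "nonzero_on (base_set (ncone {K})) x" by (rule nonzero_on_base_set[OF A x(1) nK])
    have ge: "chart_of (base_set (ncone {K})) x (e m) = monom_val x (Poly_Mapping.lookup m) / x K ^ d" if "m \<in> B" for m
    proof -
      have "chart_of (base_set (ncone {K})) x (e m) = chart_of {K} x (e m)"
        by (rule chart_of_mono[OF A base_set_ncone(3)[OF A] base_set_ncone(1)[OF A] x(1) AK em[OF that]])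
      also have "\<dots> = monom_val x (Poly_Mapping.lookup m) / x K ^ d"
        unfolding chart_of_eq[OF A x(1) nK r[OF that]] by (simp add: xprod_def)
      finally show ?thesis .
    qed
    have "eval_char (chart_of (base_set (ncone {K})) x) f = (\<Sum>m\<in>B. Poly_Mapping.lookup g m * chart_of (base_set (ncone {K})) x (e m))"
      unfolding f_def by (rule eval_char_sum_single[OF finB])
    also have "\<dots> = (\<Sum>m\<in>B. Poly_Mapping.lookup g m * monom_val x (Poly_Mapping.lookup m)) / x K ^ d"
      unfolding sum_divide_distrib by (intro sum.cong refl) (simp add: ge)
    also have "(\<Sum>m\<in>B. Poly_Mapping.lookup g m * monom_val x (Poly_Mapping.lookup m)) = eval_poly x g"
      unfolding eval_poly_monom
    proof (rule sum.mono_neutral_left)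
      show "\<forall>m\<in>Poly_Mapping.keys g - B. Poly_Mapping.lookup g m * monom_val x (Poly_Mapping.lookup m) = 0"
      proof
        fix m assume "m \<in> Poly_Mapping.keys g - B"
        then obtain J where "J \<notin> M" "Poly_Mapping.lookup m J \<noteq> 0" by (auto simp: B_def supp_in_def)
        then show "Poly_Mapping.lookup g m * monom_val x (Poly_Mapping.lookup m) = 0"
          using x(1) by (auto simp: monom_eq_0_iff toric_pt_def)
      qed
    qed (auto simp: B_def)
    finally show ?thesis .
  qed
  ultimately show ?thesis by blast
qed

lemma Y_subset: "Y \<subseteq> proj_space V"
proof
  fix l assume "l \<in> Y"
  then obtain x where x: "toric_pt M v x" "x \<noteq> (\<lambda>_. 0)" "l = proj_point x" by (rule Y_cases)
  then have "\<forall>J. J \<notin> V \<longrightarrow> x J = 0" using MV by (auto simp: toric_pt_def)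
  then show "l \<in> proj_space V" using x unfolding proj_space_def by blast
qed

text \<open>The constant 1 is a form of degree 0 without zeros: projective points are nonempty sets,
  so it does not vanish vacuously.\<close>

lemma topspace_proj_zariski: "topspace (proj_zariski V) = proj_space V"
proof -
  have "Poly_Mapping.single 0 1 \<in> poly_ring V \<and> homogeneous 0 (Poly_Mapping.single 0 1 :: 'i cpoly)"
    by (simp add: poly_ring_def homogeneous_def)
  moreover have "zero_set V {Poly_Mapping.single 0 1 :: 'i cpoly} = {}"
  proof -
    have "eval_poly x (Poly_Mapping.single 0 1 :: 'i cpoly) = 1" for x by (simp add: subst_poly_def)
    moreover have "l \<noteq> {}" if "l \<in> proj_space V" for l
      using that proj_point_self by (auto simp: proj_space_def)
    ultimately show ?thesis by (auto simp: zero_set_def)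
  qed
  ultimately have "proj_space V \<in> {proj_space V - zero_set V {f} |f. f \<in> poly_ring V \<and> (\<exists>d. homogeneous d f)}"
    by (intro CollectI exI[of _ "Poly_Mapping.single 0 1"]) auto
  then have "\<Union>{proj_space V - zero_set V {f} |f. f \<in> poly_ring V \<and> (\<exists>d. homogeneous d f)} = proj_space V"
    by blast
  then show ?thesis unfolding proj_zariski_def topology_generated_by_topspace .
qed

definition Y_nonzero :: "'i cpoly \<Rightarrow> ('i \<Rightarrow> complex) set set"
  where "Y_nonzero F = Y \<inter> (proj_space V - zero_set V {F})"

abbreviation "Y_top \<equiv> subtopology (proj_zariski V) Y"

lemma Y_nonzero_open: "F \<in> poly_ring V \<Longrightarrow> homogeneous d F \<Longrightarrow> openin Y_top (Y_nonzero F)"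
  unfolding Y_nonzero_def proj_zariski_def
  by (intro openin_subtopology_Int2 topology_generated_by_Basis) auto

lemma mem_Y_nonzero:
  assumes l: "l \<in> Y" "x \<in> l" and F: "homogeneous d F"
  shows "l \<in> Y_nonzero F \<longleftrightarrow> eval_poly x F \<noteq> 0"
proof -
  have "eval_poly y F = 0 \<longleftrightarrow> eval_poly x F = 0" if "y \<in> l" for y
  proof -
    have "y \<in> proj_point x" using that unfolding mem_Y(3)[OF l] .
    then obtain c where "c \<noteq> 0" "y = (\<lambda>J. c * x J)" by (auto simp: proj_point_def)
    then show ?thesis using eval_poly_scale[OF F, of c x] by simp
  qed
  then have "(\<forall>y\<in>l. eval_poly y F = 0) \<longleftrightarrow> eval_poly x F = 0" using l(2) by blast
  moreover have "l \<in> proj_space V" using l(1) Y_subset by blast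
  ultimately show ?thesis using l(1) by (simp add: Y_nonzero_def zero_set_def)
qed

lemma var_poly_props:
  "J \<in> V \<Longrightarrow> var_poly J \<in> poly_ring V" "homogeneous 1 (var_poly J)" "eval_poly x (var_poly J) = x J"
proof -
  have "Poly_Mapping.single J 1 = pm (unit_exp J)"
    by (rule poly_mapping_eqI) (simp add: lookup_single when_def unit_exp_def eq_commute)
  then have eq: "var_poly J = Poly_Mapping.single (pm (unit_exp J)) 1" by (simp add: var_poly_def)
  show "eval_poly x (var_poly J) = x J" "homogeneous 1 (var_poly J)"
    by (simp_all add: eq homogeneous_iff)
  show "J \<in> V \<Longrightarrow> var_poly J \<in> poly_ring V" by (simp add: eq poly_ring_iff supp_in_unit)
qed

section \<open>Comparison of the Zariski topologies\<close>

definition basic :: "(real ^ 'n) set \<Rightarrow> ((real ^ 'n) \<Rightarrow>\<^sub>0 complex) \<Rightarrow> 'n toric_point set"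
  where "basic s f = {\<xi> \<in> toric_points \<Sigma>. \<exists>\<gamma>. (s, \<gamma>) \<in> \<xi> \<and> eval_char \<gamma> f \<noteq> 0}"

abbreviation "fan_top \<equiv> toric_zariski \<Sigma>"

lemma toric_zariski_basic:
  "fan_top = topology_generated_by {basic s f | s f. s \<in> \<Sigma> \<and> f \<in> monoid_algebra (dual_monoid s)}"
  by (simp add: toric_zariski_def basic_def)

lemma mem_basic:
  assumes l: "l \<in> Y" "x \<in> l" and s: "s \<in> \<Sigma>"
  shows "toric_map l \<in> basic s f \<longleftrightarrow> nonzero_on (base_set s) x \<and> eval_char (chart_of (base_set s) x) f \<noteq> 0"
  using l s mem_toric_map[OF l] by (auto simp: basic_def toric_points_eq)

lemma topspace_fan_top: "topspace fan_top = toric_points \<Sigma>"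
proof -
  have sub: "basic s f \<subseteq> toric_points \<Sigma>" for s f unfolding basic_def by (rule Collect_restrict)
  have ex: "\<exists>s f. s \<in> \<Sigma> \<and> f \<in> monoid_algebra (dual_monoid s) \<and> \<xi> \<in> basic s f" if \<xi>: "\<xi> \<in> toric_points \<Sigma>" for \<xi>
  proof -
    obtain l where l: "l \<in> Y" "\<xi> = toric_map l" using \<xi> unfolding toric_points_eq by blast
    obtain x where x: "toric_pt M v x" "x \<noteq> (\<lambda>_. 0)" "l = proj_point x" using l(1) by (rule Y_cases)
    have xl: "x \<in> l" using x proj_point_self by auto
    obtain K where K: "K \<in> M" "x K \<noteq> 0" using Y_coordinate[OF x(1,2)] by blast
    have s: "ncone {K} \<in> \<Sigma>" using vertex_cone K by blast
    \<comment> \<open>Dehomogenising the coordinate \<open>K\<close> itself gives the value 1 on its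
      chart, so the point lies in a basic open set.\<close>
    obtain f where "f \<in> monoid_algebra (dual_monoid (ncone {K}))"
      "eval_char (chart_of (base_set (ncone {K})) x) f = eval_poly x (var_poly K) / x K ^ 1"
      using dehomogenize[OF var_poly_props(1,2) K(1)] x(1) K MV by blast
    moreover from this have "\<xi> \<in> basic (ncone {K}) f"
      unfolding l(2) mem_basic[OF l(1) xl s] using toric_map_chart_of(2)[OF l(1) xl K] K(2) by (simp add: var_poly_props)
    ultimately show ?thesis using s by blast
  qed
  have "toric_points \<Sigma> \<subseteq> \<Union>{basic s f | s f. s \<in> \<Sigma> \<and> f \<in> monoid_algebra (dual_monoid s)}"
  proof (intro subsetI)
    fix \<xi> assume "\<xi> \<in> toric_points \<Sigma>"
    then obtain s f where "s \<in> \<Sigma>" "f \<in> monoid_algebra (dual_monoid s)" "\<xi> \<in> basic s f" using ex by meson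
    then show "\<xi> \<in> \<Union>{basic s f | s f. s \<in> \<Sigma> \<and> f \<in> monoid_algebra (dual_monoid s)}"
      by (intro UnionI[of "basic s f"]) auto
  qed
  moreover have "\<Union>{basic s f | s f. s \<in> \<Sigma> \<and> f \<in> monoid_algebra (dual_monoid s)} \<subseteq> toric_points \<Sigma>"
    using sub by (intro Union_least) auto
  ultimately show ?thesis
    unfolding toric_zariski_basic topology_generated_by_topspace by (rule equalityI[rotated])
qed

lemma topspace_Y_top: "topspace Y_top = Y"
  using Y_subset by (auto simp: topspace_subtopology topspace_proj_zariski)

text \<open>The chart of \<open>s\<close> is where the coordinates in its base set do not vanish,
  and there a homogenisation of \<open>f\<close> has the same zeros as \<open>f\<close>.\<close>

lemma preimage_basic:
  assumes s: "s \<in> \<Sigma>" and f: "f \<in> monoid_algebra (dual_monoid s)"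
  shows "openin Y_top {l \<in> Y. toric_map l \<in> basic s f}"
proof -
  note A = fan_cone[OF s]
  obtain N F where F: "F \<in> poly_ring V" "homogeneous (N * card (base_set s)) F"
    "\<And>x. toric_pt M v x \<Longrightarrow> nonzero_on (base_set s) x \<Longrightarrow> eval_poly x F = xprod x (base_set s) ^ N * eval_char (chart_of (base_set s) x) f"
    using homogenize[OF A(1), of f] f A(2) by auto
  have "{l \<in> Y. toric_map l \<in> basic s f} = Y_nonzero F \<inter> (\<Inter>K\<in>base_set s. Y_nonzero (var_poly K))"
  proof (rule set_eqI)
    fix l
    have AY: "\<Inter>((\<lambda>K. Y_nonzero (var_poly K)) ` base_set s) \<subseteq> Y" using A(1) by (auto simp: Y_nonzero_def face_set_def)
    show "l \<in> {l \<in> Y. toric_map l \<in> basic s f} \<longleftrightarrow> l \<in> Y_nonzero F \<inter> (\<Inter>K\<in>base_set s. Y_nonzero (var_poly K))"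
    proof (cases "l \<in> Y")
      case True
      then obtain x where x: "toric_pt M v x" "x \<noteq> (\<lambda>_. 0)" "l = proj_point x" by (rule Y_cases)
      have xl: "x \<in> l" using x proj_point_self by auto
      have "(\<forall>K\<in>base_set s. l \<in> Y_nonzero (var_poly K)) \<longleftrightarrow> nonzero_on (base_set s) x"
        using mem_Y_nonzero[OF True xl var_poly_props(2)] by (simp add: nonzero_on_def var_poly_props(3))
      moreover have "l \<in> Y_nonzero F \<longleftrightarrow> eval_char (chart_of (base_set s) x) f \<noteq> 0" if "nonzero_on (base_set s) x"
        using mem_Y_nonzero[OF True xl F(2)] F(3)[OF x(1) that] that by (simp add: xprod_nonzero[symmetric])
      ultimately show ?thesis using mem_basic[OF True xl s] True by auto
    next
      case False
      then show ?thesis using AY by blast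
    qed
  qed
  moreover have "openin Y_top (\<Inter>K\<in>base_set s. Y_nonzero (var_poly K))"
  proof (rule openin_Inter)
    show "(\<lambda>K. Y_nonzero (var_poly K)) ` base_set s \<noteq> {}" using A(1) by (simp add: face_set_def)
    show "openin Y_top X" if "X \<in> (\<lambda>K. Y_nonzero (var_poly K)) ` base_set s" for X
      using that A(1) MV var_poly_props(1,2) by (auto simp: face_set_def intro!: Y_nonzero_open)
  qed simp
  ultimately show ?thesis using Y_nonzero_open[OF F(1,2)] by (simp add: openin_Int)
qed

lemma toric_map_continuous: "continuous_map Y_top fan_top toric_map"
  unfolding toric_zariski_basic
proof (rule continuous_on_generated_topo)
  fix U assume "U \<in> {basic s f | s f. s \<in> \<Sigma> \<and> f \<in> monoid_algebra (dual_monoid s)}"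
  then obtain s f where sf: "U = basic s f" "s \<in> \<Sigma>" "f \<in> monoid_algebra (dual_monoid s)" by blast
  have "toric_map -` U \<inter> topspace Y_top = {l \<in> Y. toric_map l \<in> basic s f}" unfolding topspace_Y_top sf(1) by blast
  then show "openin Y_top (toric_map -` U \<inter> topspace Y_top)" using preimage_basic[OF sf(2,3)] by simp
next
  have "\<Union>{basic s f | s f. s \<in> \<Sigma> \<and> f \<in> monoid_algebra (dual_monoid s)} = toric_points \<Sigma>"
    using topspace_fan_top unfolding toric_zariski_basic topology_generated_by_topspace .
  then show "toric_map ` topspace Y_top \<subseteq> \<Union>{basic s f | s f. s \<in> \<Sigma> \<and> f \<in> monoid_algebra (dual_monoid s)}"
    unfolding topspace_Y_top toric_points_eq by simp
qed

text \<open>The vertex charts cover the locus, and on each of them \<open>g\<close> and its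
  dehomogenisation differ by a power of an invertible coordinate.\<close>

lemma toric_map_image_Y_nonzero:
  assumes g: "g \<in> poly_ring V" "homogeneous d g"
  shows "openin fan_top (toric_map ` Y_nonzero g)"
proof -
  have "\<forall>K\<in>M. \<exists>f\<in>monoid_algebra (dual_monoid (ncone {K})). \<forall>x. toric_pt M v x \<longrightarrow> x K \<noteq> 0 \<longrightarrow>
    eval_char (chart_of (base_set (ncone {K})) x) f = eval_poly x g / x K ^ d"
    using dehomogenize[OF g] by blast
  then obtain f where f: "\<And>K. K \<in> M \<Longrightarrow> f K \<in> monoid_algebra (dual_monoid (ncone {K}))"
    "\<And>K x. K \<in> M \<Longrightarrow> toric_pt M v x \<Longrightarrow> x K \<noteq> 0 \<Longrightarrow>
      eval_char (chart_of (base_set (ncone {K})) x) (f K) = eval_poly x g / x K ^ d" by metis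
  have s: "ncone {K} \<in> \<Sigma>" if "K \<in> M" for K using vertex_cone that by blast
  have mem: "toric_map l \<in> basic (ncone {K}) (f K) \<longleftrightarrow> x K \<noteq> 0 \<and> eval_poly x g \<noteq> 0"
    if K: "K \<in> M" and l: "l \<in> Y" "x \<in> l" for K l x
  proof -
    note x = mem_Y(1)[OF l]
    have "nonzero_on (base_set (ncone {K})) x \<longleftrightarrow> x K \<noteq> 0"
    proof
      show "x K \<noteq> 0" if "nonzero_on (base_set (ncone {K})) x"
        using that base_set_ncone(1)[OF vertex_cone(2)[OF K]] unfolding nonzero_on_def by blast
    qed (rule toric_map_chart_of(2)[OF l K])
    then show ?thesis unfolding mem_basic[OF l s[OF K]] using f(2)[OF K x] by (cases "x K = 0") simp_all
  qed
  have "toric_map ` Y_nonzero g = (\<Union>K\<in>M. basic (ncone {K}) (f K))"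
  proof (intro equalityI subsetI)
    fix \<xi> assume "\<xi> \<in> toric_map ` Y_nonzero g"
    then obtain l where l: "l \<in> Y_nonzero g" "\<xi> = toric_map l" by blast
    then have lY: "l \<in> Y" by (simp add: Y_nonzero_def)
    then obtain x where x: "toric_pt M v x" "x \<noteq> (\<lambda>_. 0)" "l = proj_point x" by (rule Y_cases)
    have xl: "x \<in> l" using x proj_point_self by auto
    obtain K where K: "K \<in> M" "x K \<noteq> 0" using Y_coordinate[OF x(1,2)] by blast
    have "eval_poly x g \<noteq> 0" using mem_Y_nonzero[OF lY xl g(2)] l(1) by simp
    then show "\<xi> \<in> (\<Union>K\<in>M. basic (ncone {K}) (f K))" using mem[OF K(1) lY xl] K l(2) by blast
  next
    fix \<xi> assume "\<xi> \<in> (\<Union>K\<in>M. basic (ncone {K}) (f K))"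
    then obtain K where K: "K \<in> M" "\<xi> \<in> basic (ncone {K}) (f K)" by blast
    then have "\<xi> \<in> toric_points \<Sigma>" by (simp add: basic_def)
    then obtain l where l: "l \<in> Y" "\<xi> = toric_map l" unfolding toric_points_eq by blast
    obtain x where x: "toric_pt M v x" "x \<noteq> (\<lambda>_. 0)" "l = proj_point x" using l(1) by (rule Y_cases)
    have xl: "x \<in> l" using x proj_point_self by auto
    have "eval_poly x g \<noteq> 0" using mem[OF K(1) l(1) xl] K(2) l(2) by simp
    then show "\<xi> \<in> toric_map ` Y_nonzero g" using mem_Y_nonzero[OF l(1) xl g(2)] l(2) by blast
  qed
  moreover have "openin fan_top (\<Union>K\<in>M. basic (ncone {K}) (f K))"
    unfolding toric_zariski_basic
    by (intro openin_Union) (use s f(1) in \<open>auto intro!: topology_generated_by_Basis\<close>)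
  ultimately show ?thesis by simp
qed

lemma toric_map_open: "open_map Y_top fan_top toric_map"
  unfolding open_map_def
proof (intro allI impI)
  fix U assume "openin Y_top U"
  then obtain W where W: "openin (proj_zariski V) W" "U = W \<inter> Y" by (auto simp: openin_subtopology)
  have "generate_topology_on {proj_space V - zero_set V {f} | f. f \<in> poly_ring V \<and> (\<exists>d. homogeneous d f)} W"
    using W(1) unfolding proj_zariski_def openin_topology_generated_by_iff .
  then have "openin fan_top (toric_map ` (W \<inter> Y))"
  proof (induction rule: generate_topology_on.induct)
    case (Int a b)
    \<comment> \<open>The topology is generated by a subbasis, so images have to respect
      intersections; injectivity ensures this.\<close>
    have "toric_map ` (a \<inter> b \<inter> Y) = toric_map ` (a \<inter> Y) \<inter> toric_map ` (b \<inter> Y)"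
      using inj_on_image_Int[OF toric_map_inj, of "a \<inter> Y" "b \<inter> Y"] by (simp add: Int_ac)
    then show ?case using Int by (simp add: openin_Int)
  next
    case (UN K)
    have "toric_map ` (\<Union>K \<inter> Y) = (\<Union>k\<in>K. toric_map ` (k \<inter> Y))" by blast
    then show ?case using UN by (auto intro!: openin_Union)
  next
    case (Basis D)
    then obtain f d where f: "f \<in> poly_ring V" "homogeneous d f" "D = proj_space V - zero_set V {f}" by blast
    have "D \<inter> Y = Y_nonzero f" by (auto simp: Y_nonzero_def f(3))
    then show ?case using toric_map_image_Y_nonzero[OF f(1,2)] by simp
  qed simp
  then show "openin fan_top (toric_map ` U)" using W(2) by simp
qed

lemma toric_map_homeomorphic: "homeomorphic_map Y_top fan_top toric_map"
proof (rule bijective_open_imp_homeomorphic_map[OF toric_map_continuous toric_map_open])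
  show "toric_map ` topspace Y_top = topspace fan_top" by (simp only: topspace_Y_top topspace_fan_top toric_points_eq)
  show "inj_on toric_map (topspace Y_top)" unfolding topspace_Y_top by (rule toric_map_inj)
qed

section \<open>Regular functions in both directions\<close>

lemma regular_pullback:
  assumes U: "openin fan_top U" and \<phi>: "\<phi> \<in> snd (fan_variety \<Sigma>) U"
  shows "\<phi> \<circ> toric_map \<in> snd (proj_variety V Y) {l \<in> topspace Y_top. toric_map l \<in> U}"
  unfolding proj_variety_def snd_conv mem_Collect_eq topspace_Y_top
proof (intro ballI)
  fix l assume "l \<in> {l \<in> Y. toric_map l \<in> U}"
  then have l: "l \<in> Y" "toric_map l \<in> U" by auto
  from \<phi> l(2) obtain W s f g where sfg: "s \<in> \<Sigma>" "f \<in> monoid_algebra (dual_monoid s)" "g \<in> monoid_algebra (dual_monoid s)"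
    and W: "openin fan_top W" "toric_map l \<in> W" "W \<subseteq> U"
    and loc: "\<And>\<eta>. \<eta> \<in> W \<Longrightarrow> \<exists>\<gamma>. (s, \<gamma>) \<in> \<eta> \<and> eval_char \<gamma> g \<noteq> 0 \<and> \<phi> \<eta> = eval_char \<gamma> f / eval_char \<gamma> g"
    unfolding fan_variety_def by auto
  note A = fan_cone[OF sfg(1)]
  define W' where "W' = {k \<in> Y. toric_map k \<in> W}"
  have W': "openin Y_top W'" "l \<in> W'" "W' \<subseteq> {l \<in> Y. toric_map l \<in> U}"
    using openin_continuous_map_preimage[OF toric_map_continuous W(1)] l(1) W(2,3) unfolding topspace_Y_top W'_def by auto
  obtain N1 where N1: "\<And>N. N1 \<le> N \<Longrightarrow> \<exists>F. F \<in> poly_ring V \<and> homogeneous (N * card (base_set s)) F \<and>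
    (\<forall>x. toric_pt M v x \<longrightarrow> nonzero_on (base_set s) x \<longrightarrow> eval_poly x F = xprod x (base_set s) ^ N * eval_char (chart_of (base_set s) x) f)"
    using homogenize[OF A(1), of f] sfg(2) A(2) by auto
  obtain N2 where N2: "\<And>N. N2 \<le> N \<Longrightarrow> \<exists>F. F \<in> poly_ring V \<and> homogeneous (N * card (base_set s)) F \<and>
    (\<forall>x. toric_pt M v x \<longrightarrow> nonzero_on (base_set s) x \<longrightarrow> eval_poly x F = xprod x (base_set s) ^ N * eval_char (chart_of (base_set s) x) g)"
    using homogenize[OF A(1), of g] sfg(3) A(2) by auto
  \<comment> \<open>One exponent for both, so that the two forms have equal degree and the powers of
    the product cancel in the quotient.\<close>
  define N where "N = max N1 N2"
  obtain F where F: "F \<in> poly_ring V" "homogeneous (N * card (base_set s)) F"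
    "\<And>x. toric_pt M v x \<Longrightarrow> nonzero_on (base_set s) x \<Longrightarrow> eval_poly x F = xprod x (base_set s) ^ N * eval_char (chart_of (base_set s) x) f"
    using N1[of N] by (auto simp: N_def)
  obtain G where G: "G \<in> poly_ring V" "homogeneous (N * card (base_set s)) G"
    "\<And>x. toric_pt M v x \<Longrightarrow> nonzero_on (base_set s) x \<Longrightarrow> eval_poly x G = xprod x (base_set s) ^ N * eval_char (chart_of (base_set s) x) g"
    using N2[of N] by (auto simp: N_def)
  have "eval_poly x G \<noteq> 0 \<and> (\<phi> \<circ> toric_map) k = eval_poly x F / eval_poly x G" if k: "k \<in> W'" "x \<in> k" for k x
  proof -
    have kY: "k \<in> Y" "toric_map k \<in> W" using k by (auto simp: W'_def)
    note x = mem_Y(1)[OF kY(1) k(2)]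
    obtain \<gamma> where \<gamma>: "(s, \<gamma>) \<in> toric_map k" "eval_char \<gamma> g \<noteq> 0" "\<phi> (toric_map k) = eval_char \<gamma> f / eval_char \<gamma> g"
      using loc[OF kY(2)] by blast
    have n: "nonzero_on (base_set s) x" "\<gamma> = chart_of (base_set s) x" using \<gamma>(1) unfolding mem_toric_map[OF kY(1) k(2)] by auto
    have "xprod x (base_set s) \<noteq> 0" using n(1) by (simp add: xprod_nonzero)
    then show ?thesis using \<gamma> n F(3)[OF x n(1)] G(3)[OF x n(1)] by simp
  qed
  then show "\<exists>W d f g. openin Y_top W \<and> l \<in> W \<and> W \<subseteq> {l \<in> Y. toric_map l \<in> U} \<and> f \<in> poly_ring V \<and> g \<in> poly_ring V \<and>
    homogeneous d f \<and> homogeneous d g \<and>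
    (\<forall>k\<in>W. \<forall>x\<in>k. eval_poly x g \<noteq> 0 \<and> (\<phi> \<circ> toric_map) k = eval_poly x f / eval_poly x g)"
    using W' F(1,2) G(1,2) by blast
qed

lemma regular_pushforward:
  assumes U: "openin fan_top U" and \<phi>: "\<phi> \<circ> toric_map \<in> snd (proj_variety V Y) {l \<in> topspace Y_top. toric_map l \<in> U}"
  shows "\<phi> \<in> snd (fan_variety \<Sigma>) U"
  unfolding fan_variety_def snd_conv mem_Collect_eq
proof (intro ballI)
  fix \<xi> assume \<xi>: "\<xi> \<in> U"
  then have "\<xi> \<in> toric_points \<Sigma>" using openin_subset[OF U] topspace_fan_top by blast
  then obtain l where l: "l \<in> Y" "\<xi> = toric_map l" unfolding toric_points_eq by blast
  then have "l \<in> {l \<in> topspace Y_top. toric_map l \<in> U}" using \<xi> topspace_Y_top by simp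
  with \<phi> obtain W d f g where W: "openin Y_top W" "l \<in> W" "W \<subseteq> {l \<in> topspace Y_top. toric_map l \<in> U}"
    and fg: "f \<in> poly_ring V" "g \<in> poly_ring V" "homogeneous d f" "homogeneous d g"
    and loc: "\<And>k x. k \<in> W \<Longrightarrow> x \<in> k \<Longrightarrow> eval_poly x g \<noteq> 0 \<and> (\<phi> \<circ> toric_map) k = eval_poly x f / eval_poly x g"
    unfolding proj_variety_def by auto
  obtain x where x: "toric_pt M v x" "x \<noteq> (\<lambda>_. 0)" "l = proj_point x" using l(1) by (rule Y_cases)
  have xl: "x \<in> l" using x proj_point_self by auto
  obtain K where K: "K \<in> M" "x K \<noteq> 0" using Y_coordinate[OF x(1,2)] by blast
  let ?s = "ncone {K}"
  note s = vertex_cone(1)[OF K(1)]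
  obtain f' where f': "f' \<in> monoid_algebra (dual_monoid ?s)"
    "\<And>x. toric_pt M v x \<Longrightarrow> x K \<noteq> 0 \<Longrightarrow> eval_char (chart_of (base_set ?s) x) f' = eval_poly x f / x K ^ d"
    using dehomogenize[OF fg(1,3) K(1)] by blast
  obtain g' where g': "g' \<in> monoid_algebra (dual_monoid ?s)"
    "\<And>x. toric_pt M v x \<Longrightarrow> x K \<noteq> 0 \<Longrightarrow> eval_char (chart_of (base_set ?s) x) g' = eval_poly x g / x K ^ d"
    using dehomogenize[OF fg(2,4) K(1)] by blast
  \<comment> \<open>The neighbourhood is shrunk to the chart of \<open>K\<close>, where both forms
    can be dehomogenised.\<close>
  define W' where "W' = toric_map ` (W \<inter> Y_nonzero (var_poly K))"
  have KV: "K \<in> V" using K(1) MV by blast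
  have "openin Y_top (W \<inter> Y_nonzero (var_poly K))"
    using W(1) Y_nonzero_open[OF var_poly_props(1)[OF KV] var_poly_props(2)] by (rule openin_Int)
  then have "openin fan_top W'" unfolding W'_def using toric_map_open by (simp add: open_map_def)
  moreover have "\<xi> \<in> W'"
    using l W(2) mem_Y_nonzero[OF l(1) xl var_poly_props(2)] K(2) by (auto simp: W'_def var_poly_props(3))
  moreover have "W' \<subseteq> U" using W(3) by (auto simp: W'_def)
  moreover have "\<exists>\<gamma>. (?s, \<gamma>) \<in> \<eta> \<and> eval_char \<gamma> g' \<noteq> 0 \<and> \<phi> \<eta> = eval_char \<gamma> f' / eval_char \<gamma> g'" if \<eta>: "\<eta> \<in> W'" for \<eta>
  proof -
    obtain k where k: "k \<in> W" "k \<in> Y_nonzero (var_poly K)" "\<eta> = toric_map k" using \<eta> unfolding W'_def by blast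
    have kY: "k \<in> Y" using k(2) by (simp add: Y_nonzero_def)
    then obtain y where y: "toric_pt M v y" "y \<noteq> (\<lambda>_. 0)" "k = proj_point y" by (rule Y_cases)
    have yk: "y \<in> k" using y proj_point_self by auto
    have yK: "y K \<noteq> 0" using mem_Y_nonzero[OF kY yk var_poly_props(2)] k(2) by (simp add: var_poly_props(3))
    have "(?s, chart_of (base_set ?s) y) \<in> toric_map k" by (rule toric_map_chart_of(1)[OF kY yk K(1) yK])
    moreover have "eval_char (chart_of (base_set ?s) y) g' \<noteq> 0"
      using g'(2)[OF y(1) yK] loc[OF k(1) yk] yK by simp
    moreover have "\<phi> \<eta> = eval_char (chart_of (base_set ?s) y) f' / eval_char (chart_of (base_set ?s) y) g'"
      using g'(2)[OF y(1) yK] f'(2)[OF y(1) yK] loc[OF k(1) yk] yK k(3) by simp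
    ultimately show ?thesis unfolding k(3) by blast
  qed
  ultimately show "\<exists>W. \<exists>s\<in>\<Sigma>. \<exists>f\<in>monoid_algebra (dual_monoid s). \<exists>g\<in>monoid_algebra (dual_monoid s).
    openin fan_top W \<and> \<xi> \<in> W \<and> W \<subseteq> U \<and>
    (\<forall>\<eta>\<in>W. \<exists>\<gamma>. (s, \<gamma>) \<in> \<eta> \<and> eval_char \<gamma> g \<noteq> 0 \<and> \<phi> \<eta> = eval_char \<gamma> f / eval_char \<gamma> g)"
    using s f'(1) g'(1) by blast
qed

theorem isomorphic_toric_variety: "isomorphic_varieties (proj_variety V Y) (toric_variety Q)"
  unfolding isomorphic_varieties_def toric_variety_def
proof (intro exI[of _ toric_map] conjI allI impI)
  have fst: "fst (proj_variety V Y) = Y_top" "fst (fan_variety \<Sigma>) = fan_top"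
    by (simp_all add: proj_variety_def fan_variety_def)
  show "homeomorphic_map (fst (proj_variety V Y)) (fst (fan_variety \<Sigma>)) toric_map"
    unfolding fst by (rule toric_map_homeomorphic)
  fix U \<phi> assume "openin (fst (fan_variety \<Sigma>)) U"
  then show "\<phi> \<in> snd (fan_variety \<Sigma>) U \<longleftrightarrow>
      \<phi> \<circ> toric_map \<in> snd (proj_variety V Y) {x \<in> topspace (fst (proj_variety V Y)). toric_map x \<in> U}"
    unfolding fst using regular_pullback regular_pushforward by blast
qed

end

section \<open>Irreducible components\<close>

lemma irreducible_in_finite_Union:
  assumes D: "irreducible_subset X D" and "finite \<A>" "\<And>A. A \<in> \<A> \<Longrightarrow> closedin X A" "D \<subseteq> \<Union>\<A>"
  shows "\<exists>A\<in>\<A>. D \<subseteq> A"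
  using assms(2-)
proof (induction \<A> rule: finite_induct)
  case empty
  then show ?case using D by (auto simp: irreducible_subset_def)
next
  case (insert A \<A>)
  have "closedin X (\<Union>\<A>)" using insert by (intro closedin_Union) auto
  moreover have "closedin X A" "D \<subseteq> A \<union> \<Union>\<A>" using insert by auto
  ultimately have "D \<subseteq> A \<or> D \<subseteq> \<Union>\<A>" using D unfolding irreducible_subset_def by blast
  then show ?case using insert by blast
qed

text \<open>An irreducible set lies in a single member of the finite closed cover, and members are
  not properly nested.\<close>

lemma irreducible_components_eq:
  assumes fin: "finite \<A>" and top: "topspace X = \<Union>\<A>"
    and irr: "\<And>A. A \<in> \<A> \<Longrightarrow> irreducible_subset X A" and cl: "\<And>A. A \<in> \<A> \<Longrightarrow> closedin X A"
    and max: "\<And>A B. A \<in> \<A> \<Longrightarrow> B \<in> \<A> \<Longrightarrow> A \<subseteq> B \<Longrightarrow> A = B"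
  shows "irreducible_components X = \<A>"
proof -
  have sub: "\<exists>A\<in>\<A>. D \<subseteq> A" if "irreducible_subset X D" for D
    using irreducible_in_finite_Union[OF that fin cl] that top by (auto simp: irreducible_subset_def)
  show ?thesis
  proof (intro equalityI subsetI)
    fix C assume "C \<in> irreducible_components X"
    then have C: "irreducible_subset X C" "\<And>D. irreducible_subset X D \<Longrightarrow> C \<subseteq> D \<Longrightarrow> D = C"
      by (auto simp: irreducible_components_def)
    obtain A where "A \<in> \<A>" "C \<subseteq> A" using sub[OF C(1)] by blast
    then show "C \<in> \<A>" using C(2)[OF irr] by blast
  next
    fix C assume C: "C \<in> \<A>"
    have "D = C" if D: "irreducible_subset X D" "C \<subseteq> D" for D
    proof -
      obtain A where A: "A \<in> \<A>" "D \<subseteq> A" using sub[OF D(1)] by blast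
      then have "C = A" using max[OF C A(1)] D(2) by blast
      then show ?thesis using A D by blast
    qed
    then show "C \<in> irreducible_components X" using irr[OF C] by (auto simp: irreducible_components_def)
  qed
qed

definition power_val :: "('p::finite \<Rightarrow> complex) \<Rightarrow> ('p \<Rightarrow> nat) \<Rightarrow> complex"
  where "power_val z e = (\<Prod>p\<in>UNIV. z p ^ e p)"

text \<open>Dedekind's argument: substituting \<open>y * z\<close> for \<open>z\<close> and subtracting eliminates one character.\<close>

lemma power_val_independent:
  assumes "finite E" "\<And>z. (\<Sum>e\<in>E. a e * power_val z e) = 0"
  shows "\<forall>e\<in>E. a e = 0"
  using assms
proof (induction E arbitrary: a rule: finite_induct)
  case (insert e0 E)
  have mult: "power_val (\<lambda>p. y p * z p) e = power_val y e * power_val z e" for y z and e :: "'a \<Rightarrow> nat"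
    by (simp add: power_val_def power_mult_distrib prod.distrib)
  have "\<forall>e\<in>E. a e * (power_val y e - power_val y e0) = 0" for y
  proof (rule insert.IH)
    fix z
    have "(\<Sum>e\<in>E. a e * (power_val y e - power_val y e0) * power_val z e) =
        (\<Sum>e\<in>insert e0 E. a e * power_val (\<lambda>p. y p * z p) e) - power_val y e0 * (\<Sum>e\<in>insert e0 E. a e * power_val z e)"
      using insert.hyps by (simp add: mult sum_distrib_left sum_subtractf algebra_simps)
    then show "(\<Sum>e\<in>E. a e * (power_val y e - power_val y e0) * power_val z e) = 0"
      by (simp only: insert.prems) simp
  qed
  moreover have "\<exists>y. power_val y e \<noteq> power_val y e0" if "e \<in> E" for e
  proof -
    have "e \<noteq> e0" using that insert.hyps by blast
    then obtain p where p: "e p \<noteq> e0 p" by blast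
    \<comment> \<open>The value 2 is placed where the exponents differ, since distinct powers of 2
      are distinct.\<close>
    define y :: "'a \<Rightarrow> complex" where "y q = (if q = p then 2 else 1)" for q
    have "power_val y f = 2 ^ f p" for f
    proof -
      have "power_val y f = (\<Prod>q\<in>UNIV. if q = p then 2 ^ f q else 1)"
        unfolding power_val_def y_def by (intro prod.cong) auto
      then show ?thesis by simp
    qed
    moreover have "(2::complex) ^ e p \<noteq> 2 ^ e0 p"
    proof
      assume "(2::complex) ^ e p = 2 ^ e0 p"
      then have "cmod (2 ^ e p) = cmod (2 ^ e0 p)" by simp
      then show False using p by (simp add: norm_power)
    qed
    ultimately have "power_val y e \<noteq> power_val y e0" by simp
    then show ?thesis by blast
  qed
  ultimately have E: "\<forall>e\<in>E. a e = 0" by fastforce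
  have "a e0 * power_val (\<lambda>_. 1) e0 = 0"
    using insert.prems[of "\<lambda>_. 1"] insert.hyps E by simp
  then show ?case using E by (simp add: power_val_def)
qed simp

section \<open>A dense parametrised subset of the toric locus\<close>

context relative_poset
begin

text \<open>The coordinates of \<open>mvec\<close> as natural numbers, so that they can serve as
  exponents.\<close>

definition coord_exp :: "('p set \<Rightarrow> nat) \<Rightarrow> 'p \<Rightarrow> nat"
  where "coord_exp k p = (\<Sum>J\<in>UNIV. if p \<in> mx J then k J else 0)"

lemma coord_exp_mvec: "real (coord_exp k p) = mvec v k $ p"
  by (auto simp: coord_exp_def mvec_def v_nth intro!: sum.cong)

text \<open>Zero coordinates of \<open>z\<close> are allowed: the coordinate of the empty ideal is \<open>1\<close>, so no \<open>z\<close> is mapped to \<open>0\<close>.\<close>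

definition torus_pt :: "('p \<Rightarrow> complex) \<Rightarrow> 'p set \<Rightarrow> complex"
  where "torus_pt z J = (if J \<in> \<L> then \<Prod>p\<in>mx J. z p else 0)"

lemma monom_torus_pt:
  assumes "supp_in k \<L>" shows "monom_val (torus_pt z) k = power_val z (coord_exp k)"
proof -
  have "monom_val (torus_pt z) k = (\<Prod>J\<in>UNIV. \<Prod>p\<in>UNIV. z p ^ (if p \<in> mx J then k J else 0))"
    unfolding monom_val_def
  proof (rule prod.cong[OF refl])
    fix J
    show "torus_pt z J ^ k J = (\<Prod>p\<in>UNIV. z p ^ (if p \<in> mx J then k J else 0))"
    proof (cases "J \<in> \<L>")
      case True
      have "(\<Prod>p\<in>UNIV. z p ^ (if p \<in> mx J then k J else 0)) = (\<Prod>p\<in>UNIV. if p \<in> mx J then z p ^ k J else 1)"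
        by (intro prod.cong) auto
      then show ?thesis using True by (simp add: torus_pt_def prod.If_cases prod_power_distrib)
    next
      case False
      then have "k J = 0" using assms by (simp add: supp_in_def)
      moreover from this have "(\<Prod>p\<in>UNIV. z p ^ (if p \<in> mx J then k J else 0)) = 1"
        by (intro prod.neutral) simp
      ultimately show ?thesis by simp
    qed
  qed
  also have "\<dots> = (\<Prod>p\<in>UNIV. \<Prod>J\<in>UNIV. z p ^ (if p \<in> mx J then k J else 0))" by (rule prod.swap)
  also have "\<dots> = power_val z (coord_exp k)" by (simp add: power_val_def coord_exp_def power_sum)
  finally show ?thesis .
qed

lemma torus_pt_toric: "toric_pt \<L> v (torus_pt z)" "torus_pt z \<noteq> (\<lambda>_. 0)"
proof -
  have coord_exp: "coord_exp k = coord_exp k'" if "mvec v k = mvec v k'" for k k'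
  proof
    fix p
    have "real (coord_exp k p) = real (coord_exp k' p)" unfolding coord_exp_mvec that ..
    then show "coord_exp k p = coord_exp k' p" by simp
  qed
  have "monom_val (torus_pt z) k = monom_val (torus_pt z) k'" if "supp_in k \<L>" "supp_in k' \<L>" "mvec v k = mvec v k'" for k k'
    unfolding monom_torus_pt[OF that(1)] monom_torus_pt[OF that(2)] coord_exp[OF that(3)] ..
  then show "toric_pt \<L> v (torus_pt z)" unfolding toric_pt_def by (auto simp: torus_pt_def)
  have "torus_pt z {} = 1" by (simp add: torus_pt_def order_ideals_empty)
  then show "torus_pt z \<noteq> (\<lambda>_. 0)" by (metis zero_neq_one)
qed

text \<open>On parametrised points \<open>f\<close> is a combination of power functions of
  \<open>z\<close> whose coefficients are sums over fibres; by independence these sums vanish.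
  Homogeneity provides the equal degrees that the parametrisation, which has no \<open>t\<close>,
  does not see.\<close>

lemma torus_pt_dense:
  assumes f: "homogeneous d f" and z: "\<And>z. eval_poly (torus_pt z) f = 0" and x: "toric_pt \<L> v x"
  shows "eval_poly x f = 0"
proof -
  define B where "B = {m \<in> Poly_Mapping.keys f. supp_in (Poly_Mapping.lookup m) \<L>}"
  define e where "e m = coord_exp (Poly_Mapping.lookup m)" for m
  have restrict: "eval_poly y f = (\<Sum>m\<in>B. Poly_Mapping.lookup f m * monom_val y (Poly_Mapping.lookup m))" if "toric_pt \<L> v y" for y
    unfolding eval_poly_monom
  proof (rule sum.mono_neutral_right)
    show "\<forall>m\<in>Poly_Mapping.keys f - B. Poly_Mapping.lookup f m * monom_val y (Poly_Mapping.lookup m) = 0"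
    proof
      fix m assume "m \<in> Poly_Mapping.keys f - B"
      then obtain J where "J \<notin> \<L>" "Poly_Mapping.lookup m J \<noteq> 0" by (auto simp: B_def supp_in_def)
      then show "Poly_Mapping.lookup f m * monom_val y (Poly_Mapping.lookup m) = 0"
        using that by (auto simp: monom_eq_0_iff toric_pt_def)
    qed
  qed (auto simp: B_def)
  have "finite B" by (simp add: B_def)
  have "(\<Sum>a\<in>e ` B. (\<Sum>m | m \<in> B \<and> e m = a. Poly_Mapping.lookup f m) * power_val z a) = 0" for z
  proof -
    have "(\<Sum>a\<in>e ` B. (\<Sum>m | m \<in> B \<and> e m = a. Poly_Mapping.lookup f m) * power_val z a) =
        (\<Sum>a\<in>e ` B. \<Sum>m | m \<in> B \<and> e m = a. Poly_Mapping.lookup f m * power_val z (e m))"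
      by (simp add: sum_distrib_right)
    also have "\<dots> = (\<Sum>m\<in>B. Poly_Mapping.lookup f m * power_val z (e m))"
      by (rule sum.image_gen[OF \<open>finite B\<close>, symmetric])
    also have "\<dots> = (\<Sum>m\<in>B. Poly_Mapping.lookup f m * monom_val (torus_pt z) (Poly_Mapping.lookup m))"
      by (intro sum.cong refl) (simp add: B_def monom_torus_pt e_def)
    also have "\<dots> = eval_poly (torus_pt z) f" by (rule restrict[OF torus_pt_toric(1), symmetric])
    finally show ?thesis using z by simp
  qed
  then have zero: "\<forall>a\<in>e ` B. (\<Sum>m | m \<in> B \<and> e m = a. Poly_Mapping.lookup f m) = 0"
    by (intro power_val_independent) (simp_all add: \<open>finite B\<close>)
  show ?thesis
    unfolding restrict[OF x]
  proof (rule sum_graded_zero[where g = e])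
    show "(\<Sum>m | m \<in> B \<and> e m = e s. Poly_Mapping.lookup f m) = 0" if "s \<in> B" for s using zero that by blast
    fix m m' assume m: "m \<in> B" "m' \<in> B" "e m = e m'"
    have "mvec v (Poly_Mapping.lookup m) = mvec v (Poly_Mapping.lookup m')"
      using m(3) unfolding e_def by (simp add: vec_eq_iff flip: coord_exp_mvec)
    moreover have "mdeg (Poly_Mapping.lookup m) = mdeg (Poly_Mapping.lookup m')"
      using f m(1,2) by (simp add: homogeneous_iff B_def)
    ultimately show "monom_val x (Poly_Mapping.lookup m) = monom_val x (Poly_Mapping.lookup m')"
      using m(1,2) x unfolding toric_pt_def B_def by blast
  qed fact
qed

text \<open>Restriction to a line of parameters makes the finiteness of roots in one variable
  available.\<close>

lemma torus_pt_line:
  "\<exists>q :: complex poly. \<forall>s. poly q s = eval_poly (torus_pt (\<lambda>p. (1 - s) * a p + s * b p)) f"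
proof -
  define l where "l p = [:a p, b p - a p:]" for p
  define X where "X J = (if J \<in> \<L> then \<Prod>p\<in>mx J. l p else 0)" for J
  have l: "poly (l p) s = (1 - s) * a p + s * b p" for p s
    by (simp add: l_def algebra_simps)
  have X: "poly (X J) s = torus_pt (\<lambda>p. (1 - s) * a p + s * b p) J" for J s
    by (simp add: X_def torus_pt_def poly_prod l)
  show ?thesis
    by (intro exI[of _ "\<Sum>m\<in>Poly_Mapping.keys f. smult (Poly_Mapping.lookup f m) (\<Prod>J\<in>UNIV. X J ^ Poly_Mapping.lookup m J)"])
      (simp add: poly_sum poly_prod X eval_poly_monom monom_val_def)
qed

text \<open>On the line through \<open>a\<close> and \<open>b\<close> each form is nonzero at one of
  the two ends, so it has finitely many roots there; the infinite field contains a parameter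
  avoiding all of them.\<close>

lemma torus_pt_common_nonzero:
  assumes "finite F" "\<And>f. f \<in> F \<Longrightarrow> \<exists>z. eval_poly (torus_pt z) f \<noteq> 0"
  shows "\<exists>z. \<forall>f\<in>F. eval_poly (torus_pt z) f \<noteq> 0"
  using assms
proof (induction F rule: finite_induct)
  case (insert f F)
  obtain a where a: "\<forall>g\<in>F. eval_poly (torus_pt a) g \<noteq> 0" using insert by blast
  obtain b where b: "eval_poly (torus_pt b) f \<noteq> 0" using insert.prems by blast
  obtain q where q: "\<And>g s. poly (q g) s = eval_poly (torus_pt (\<lambda>p. (1 - s) * a p + s * b p)) g"
    using torus_pt_line[of a b] by metis
  have "q g \<noteq> 0" if "g \<in> insert f F" for g
  proof -
    have "poly (q g) 0 = eval_poly (torus_pt a) g" "poly (q g) 1 = eval_poly (torus_pt b) g" by (simp_all add: q)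
    then have "poly (q g) 0 \<noteq> 0 \<or> poly (q g) 1 \<noteq> 0" using a b that by auto
    then show ?thesis by auto
  qed
  then have "finite (\<Union>g\<in>insert f F. {s. poly (q g) s = 0})"
    using insert.hyps by (intro finite_UN_I) (auto intro: poly_roots_finite)
  then obtain s where "s \<notin> (\<Union>g\<in>insert f F. {s. poly (q g) s = 0})"
    using ex_new_if_finite[OF infinite_UNIV_char_0] by blast
  then show ?case by (intro exI[of _ "\<lambda>p. (1 - s) * a p + s * b p"]) (auto simp flip: q)
qed auto

text \<open>Vectors with entries 0 and 1 are extreme in the unit cube and hence in any smaller
  convex set containing them. Saturation is integral straightening with weight zero.\<close>

lemma lattice_config:
  assumes "\<L> \<subseteq> V" shows "lattice_config V \<L> v"
proof
  show "\<L> \<subseteq> V" by fact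
  show "\<L> \<noteq> {}" using top_ideal by blast
  show "v J \<in> integer_points" for J by (rule v_integer)
  show "{v J} face_of convex hull (v ` \<L>)" if J: "J \<in> \<L>" for J
    unfolding face_of_singleton extreme_point_of_def
  proof (intro conjI ballI notI)
    show "v J \<in> convex hull (v ` \<L>)" using J by (intro hull_inc) auto
    have box: "convex hull (v ` \<L>) \<subseteq> cbox 0 1"
      by (rule hull_minimal) (auto simp: mem_box_cart v_nth convex_box)
    fix a b assume ab: "a \<in> convex hull (v ` \<L>)" "b \<in> convex hull (v ` \<L>)" "v J \<in> open_segment a b"
    then obtain t where t: "0 < t" "t < 1" "v J = (1 - t) *\<^sub>R a + t *\<^sub>R b" "a \<noteq> b"
      by (auto simp: in_segment)
    have "a $ p = b $ p" for p
    proof -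
      have ab01: "0 \<le> a $ p" "a $ p \<le> 1" "0 \<le> b $ p" "b $ p \<le> 1"
        using box ab(1,2) by (auto simp: mem_box_cart subset_iff)
      have vp: "v J $ p = (1 - t) * a $ p + t * b $ p" using t(3) by simp
      show ?thesis
      proof (cases "p \<in> mx J")
        case True
        then have "(1 - t) * (1 - a $ p) + t * (1 - b $ p) = 0" using vp by (simp add: v_nth algebra_simps)
        moreover have "0 \<le> (1 - t) * (1 - a $ p)" "0 \<le> t * (1 - b $ p)" using ab01 t by auto
        ultimately have "(1 - t) * (1 - a $ p) = 0" "t * (1 - b $ p) = 0" by linarith+
        then show ?thesis using t by simp
      next
        case False
        then have "(1 - t) * a $ p + t * b $ p = 0" using vp by (simp add: v_nth)
        moreover have "0 \<le> (1 - t) * a $ p" "0 \<le> t * b $ p" using ab01 t by auto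
        ultimately have "(1 - t) * a $ p = 0" "t * b $ p = 0" by linarith+
        then show ?thesis using t by simp
      qed
    qed
    then show False using t(4) by (simp add: vec_eq_iff)
  qed
  fix c :: "'p set \<Rightarrow> real" and k
  assume c: "\<And>J. J \<in> \<L> \<Longrightarrow> 0 \<le> c J" "sum c \<L> = real k" "(\<Sum>J\<in>\<L>. c J *\<^sub>R v J) \<in> integer_points"
  obtain d where d: "d \<in> weights" "total d = sum c \<L>" "bary d = (\<Sum>J\<in>\<L>. c J *\<^sub>R v J)"
    using sum_nonneg_extend[of c] c(1) by metis
  have "total d = real k" "bary d \<in> integer_points" using d c by simp_all
  from straighten_nat[OF superadd_zero d(1) this] obtain m :: "'p set \<Rightarrow> nat"
    where m: "(\<lambda>J. real (m J)) \<in> weights" "sum m \<L> = k" "bary (\<lambda>J. real (m J)) = bary d" by blast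
  have s: "supp_in m \<L>" using m(1) by (auto simp: weights_def supp_in_def)
  have "real (mdeg m) = real k"
    using nat_weight_sums(1)[OF s] m(2) by (simp add: total_def flip: of_nat_sum)
  then show "\<exists>m. supp_in m \<L> \<and> mdeg m = k \<and> mvec v m = (\<Sum>J\<in>\<L>. c J *\<^sub>R v J)"
    using s m(3) d(3) nat_weight_sums(2)[OF s] by (intro exI[of _ m]) simp
qed

end

section \<open>Closedness and irreducibility of toric loci\<close>

text \<open>Neighbourhoods are described by finite sets of forms instead of single ones, so that an
  intersection is handled by a union of sets rather than by products.\<close>

lemma proj_zariski_basis:
  assumes "openin (proj_zariski V) U" "l \<in> U"
  shows "\<exists>F. finite F \<and> (\<forall>f\<in>F. f \<in> poly_ring V \<and> (\<exists>d. homogeneous d f)) \<and>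
    (\<forall>f\<in>F. l \<notin> zero_set V {f}) \<and> (\<forall>k\<in>proj_space V. (\<forall>f\<in>F. k \<notin> zero_set V {f}) \<longrightarrow> k \<in> U)"
proof -
  have "generate_topology_on {proj_space V - zero_set V {f} | f. f \<in> poly_ring V \<and> (\<exists>d. homogeneous d f)} U"
    using assms(1) unfolding proj_zariski_def openin_topology_generated_by_iff .
  then show ?thesis using assms(2)
  proof (induction arbitrary: l rule: generate_topology_on.induct)
    case (Int a b)
    obtain F where F: "finite F" "\<forall>f\<in>F. f \<in> poly_ring V \<and> (\<exists>d. homogeneous d f)" "\<forall>f\<in>F. l \<notin> zero_set V {f}"
      "\<forall>k\<in>proj_space V. (\<forall>f\<in>F. k \<notin> zero_set V {f}) \<longrightarrow> k \<in> a" using Int.IH(1)[of l] Int.prems by auto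
    obtain G where G: "finite G" "\<forall>f\<in>G. f \<in> poly_ring V \<and> (\<exists>d. homogeneous d f)" "\<forall>f\<in>G. l \<notin> zero_set V {f}"
      "\<forall>k\<in>proj_space V. (\<forall>f\<in>G. k \<notin> zero_set V {f}) \<longrightarrow> k \<in> b" using Int.IH(2)[of l] Int.prems by auto
    show ?case by (intro exI[of _ "F \<union> G"]) (use F G in auto)
  next
    case (UN K)
    then obtain k where k: "k \<in> K" "l \<in> k" by blast
    obtain F where F: "finite F" "\<forall>f\<in>F. f \<in> poly_ring V \<and> (\<exists>d. homogeneous d f)" "\<forall>f\<in>F. l \<notin> zero_set V {f}"
      "\<forall>j\<in>proj_space V. (\<forall>f\<in>F. j \<notin> zero_set V {f}) \<longrightarrow> j \<in> k" using UN.IH[OF k] by auto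
    show ?case by (intro exI[of _ F]) (use F k in auto)
  next
    case (Basis s)
    then obtain f where "s = proj_space V - zero_set V {f}" "f \<in> poly_ring V" "\<exists>d. homogeneous d f" by blast
    then show ?case using Basis.prems by (intro exI[of _ "{f}"]) auto
  qed simp
qed

context lattice_config
begin

text \<open>The binomials are forms because both exponents have the same degree. The family of
  equations may be infinite: the complement is the union of their nonvanishing sets.\<close>

lemma Y_closed: "closedin (proj_zariski V) Y"
  unfolding closedin_def topspace_proj_zariski
proof (intro conjI Y_subset)
  define H where "H = {binomial k k' | k k'. supp_in k M \<and> supp_in k' M \<and> mdeg k = mdeg k' \<and> mvec v k = mvec v k'}
    \<union> var_poly ` (V - M)"
  have H: "f \<in> poly_ring V \<and> (\<exists>d. homogeneous d f)" "l \<notin> Y_nonzero f" if "f \<in> H" for f l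
  proof -
    have "f \<in> poly_ring V \<and> (\<exists>d. homogeneous d f) \<and> (\<forall>x. toric_pt M v x \<longrightarrow> eval_poly x f = 0)"
      using that unfolding H_def
    proof
      assume "f \<in> {binomial k k' | k k'. supp_in k M \<and> supp_in k' M \<and> mdeg k = mdeg k' \<and> mvec v k = mvec v k'}"
      then obtain k k' where k: "f = binomial k k'" "supp_in k M" "supp_in k' M" "mdeg k = mdeg k'" "mvec v k = mvec v k'" by blast
      have "supp_in k V" "supp_in k' V" using k MV by (auto simp: supp_in_def)
      moreover have keys: "Poly_Mapping.lookup m = k \<or> Poly_Mapping.lookup m = k'" if "m \<in> Poly_Mapping.keys f" for m
      proof -
        have "m = pm k \<or> m = pm k'" using subsetD[OF keys_binomial_subset[of k k']] that unfolding k(1) by blast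
        then show ?thesis by (elim disjE) (simp_all only: lookup_pm, simp_all)
      qed
      ultimately have "f \<in> poly_ring V" "homogeneous (mdeg k) f"
        unfolding poly_ring_iff homogeneous_iff using k(4) by (metis, metis)
      note fH = this
      have "eval_poly x f = 0" if "toric_pt M v x" for x
      proof -
        have "monom_val x k = monom_val x k'" using that k(2-) unfolding toric_pt_def by blast
        then show ?thesis by (simp add: k(1) eval_binomial)
      qed
      then show ?thesis using fH by blast
    next
      assume "f \<in> var_poly ` (V - M)"
      then obtain J where J: "J \<in> V" "J \<notin> M" "f = var_poly J" by blast
      have "eval_poly x f = 0" if "toric_pt M v x" for x
        using that J by (simp add: toric_pt_def var_poly_props(3))
      then show ?thesis using var_poly_props(1)[OF J(1)] var_poly_props(2)[of J] unfolding J(3) by blast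
    qed
    then show "f \<in> poly_ring V \<and> (\<exists>d. homogeneous d f)" "l \<notin> Y_nonzero f"
    proof -
      assume f: "f \<in> poly_ring V \<and> (\<exists>d. homogeneous d f) \<and> (\<forall>x. toric_pt M v x \<longrightarrow> eval_poly x f = 0)"
      then show "f \<in> poly_ring V \<and> (\<exists>d. homogeneous d f)" by blast
      obtain d where d: "homogeneous d f" using f by blast
      show "l \<notin> Y_nonzero f"
      proof
        assume l: "l \<in> Y_nonzero f"
        then have lY: "l \<in> Y" by (simp add: Y_nonzero_def)
        then obtain x where x: "toric_pt M v x" "l = proj_point x" by (rule Y_cases)
        have "x \<in> l" unfolding x(2) by (rule proj_point_self)
        then show False using mem_Y_nonzero[OF lY _ d] l f x(1) by blast
      qed
    qed
  qed
  have "proj_space V - Y = (\<Union>f\<in>H. proj_space V - zero_set V {f})"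
  proof (intro equalityI subsetI)
    fix l assume l: "l \<in> proj_space V - Y"
    then obtain x where x: "\<And>J. J \<notin> V \<Longrightarrow> x J = 0" "x \<noteq> (\<lambda>_. 0)" "l = proj_point x" by (auto simp: proj_space_def)
    have "\<not> toric_pt M v x" using l x unfolding toric_locus_def by blast
    then consider J where "J \<notin> M" "x J \<noteq> 0" | k k' where "supp_in k M" "supp_in k' M" "mdeg k = mdeg k'" "mvec v k = mvec v k'" "monom_val x k \<noteq> monom_val x k'"
      unfolding toric_pt_def by blast
    then have "\<exists>f\<in>H. eval_poly x f \<noteq> 0"
    proof cases
      case 1
      then have "J \<in> V - M" using x(1) by blast
      then show ?thesis using 1 by (intro bexI[of _ "var_poly J"]) (auto simp: H_def var_poly_props(3))
    next
      case 2
      then show ?thesis by (intro bexI[of _ "binomial k k'"]) (auto simp: H_def eval_binomial)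
    qed
    then obtain f where "f \<in> H" "eval_poly x f \<noteq> 0" by blast
    then show "l \<in> (\<Union>f\<in>H. proj_space V - zero_set V {f})"
      using l x(3) proj_point_self[of x] by (auto simp: zero_set_def)
  next
    fix l assume "l \<in> (\<Union>f\<in>H. proj_space V - zero_set V {f})"
    then obtain f where "f \<in> H" "l \<in> proj_space V - zero_set V {f}" by blast
    then show "l \<in> proj_space V - Y" using H(2)[of f l] by (auto simp: Y_nonzero_def)
  qed
  moreover have "openin (proj_zariski V) (proj_space V - zero_set V {f})" if "f \<in> H" for f
    unfolding proj_zariski_def using H(1)[OF that] by (intro topology_generated_by_Basis) blast
  then have "openin (proj_zariski V) (\<Union>f\<in>H. proj_space V - zero_set V {f})"
    by (intro openin_Union) blast
  ultimately show "openin (proj_zariski V) (proj_space V - Y)" by (simp only:)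
qed

end

text \<open>If neither closed set contains the locus, each of them misses a neighbourhood given by
  finitely many forms. By density each form is nonzero at some parametrised point; a common such
  point lies on the locus but in neither closed set.\<close>

lemma (in relative_poset) toric_locus_irreducible:
  assumes V: "\<L> \<subseteq> V" and Z: "toric_locus \<L> v \<subseteq> Z" "Z \<subseteq> proj_space V"
  shows "irreducible_subset (subtopology (proj_zariski V) Z) (toric_locus \<L> v)"
proof -
  interpret lattice_config V \<L> v by (rule lattice_config[OF V])
  have xzY: "proj_point (torus_pt z) \<in> Y" for z using torus_pt_toric[of z] by (auto simp: toric_locus_def)
  have top: "topspace (subtopology (proj_zariski V) Z) = Z"
    using Z(2) by (auto simp: topspace_subtopology topspace_proj_zariski)
  show ?thesis
    unfolding irreducible_subset_def top
  proof (intro conjI allI impI Z(1))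
    show "Y \<noteq> {}" using xzY by blast
    fix A B assume AB: "closedin (subtopology (proj_zariski V) Z) A \<and> closedin (subtopology (proj_zariski V) Z) B \<and> Y \<subseteq> A \<union> B"
    obtain A' where A': "closedin (proj_zariski V) A'" "A = A' \<inter> Z" using AB by (auto simp: closedin_subtopology)
    obtain B' where B': "closedin (proj_zariski V) B'" "B = B' \<inter> Z" using AB by (auto simp: closedin_subtopology)
    have nonzero: "\<exists>F. finite F \<and> (\<forall>f\<in>F. (\<exists>d. homogeneous d f) \<and> (\<exists>z. eval_poly (torus_pt z) f \<noteq> 0)) \<and>
        (\<forall>k\<in>Y. (\<forall>f\<in>F. k \<notin> zero_set V {f}) \<longrightarrow> k \<notin> C)" if C: "closedin (proj_zariski V) C" and nC: "\<not> Y \<subseteq> C" for C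
    proof -
      obtain l where l: "l \<in> Y" "l \<notin> C" using nC by blast
      have op: "openin (proj_zariski V) (proj_space V - C)"
        using C unfolding closedin_def topspace_proj_zariski by blast
      have "l \<in> proj_space V - C" using l Y_subset by blast
      from proj_zariski_basis[OF op this] obtain F where F: "finite F" "\<forall>f\<in>F. f \<in> poly_ring V \<and> (\<exists>d. homogeneous d f)"
        "\<forall>f\<in>F. l \<notin> zero_set V {f}" "\<forall>k\<in>proj_space V. (\<forall>f\<in>F. k \<notin> zero_set V {f}) \<longrightarrow> k \<in> proj_space V - C" by blast
      have "\<exists>z. eval_poly (torus_pt z) f \<noteq> 0" if f: "f \<in> F" for f
      proof (rule ccontr)
        assume "\<not> ?thesis"
        then have z: "\<And>z. eval_poly (torus_pt z) f = 0" by blast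
        obtain d where d: "homogeneous d f" using F(2) f by blast
        have "eval_poly x f = 0" if "x \<in> l" for x using torus_pt_dense[OF d z mem_Y(1)[OF l(1) that]] .
        then have "l \<in> zero_set V {f}" using l(1) Y_subset by (auto simp: zero_set_def)
        then show False using F(3) f by blast
      qed
      then show ?thesis using F Y_subset by (intro exI[of _ F]) blast
    qed
    show "Y \<subseteq> A \<or> Y \<subseteq> B"
    proof (rule ccontr)
      assume "\<not> ?thesis"
      then have "\<not> Y \<subseteq> A'" "\<not> Y \<subseteq> B'" using A'(2) B'(2) Z(1) by auto
      obtain F where F: "finite F" "\<forall>f\<in>F. (\<exists>d. homogeneous d f) \<and> (\<exists>z. eval_poly (torus_pt z) f \<noteq> 0)"
        "\<forall>k\<in>Y. (\<forall>f\<in>F. k \<notin> zero_set V {f}) \<longrightarrow> k \<notin> A'" using nonzero[OF A'(1) \<open>\<not> Y \<subseteq> A'\<close>] by blast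
      obtain G where G: "finite G" "\<forall>f\<in>G. (\<exists>d. homogeneous d f) \<and> (\<exists>z. eval_poly (torus_pt z) f \<noteq> 0)"
        "\<forall>k\<in>Y. (\<forall>f\<in>G. k \<notin> zero_set V {f}) \<longrightarrow> k \<notin> B'" using nonzero[OF B'(1) \<open>\<not> Y \<subseteq> B'\<close>] by blast
      obtain z where z: "\<forall>f\<in>F \<union> G. eval_poly (torus_pt z) f \<noteq> 0"
        using torus_pt_common_nonzero[of "F \<union> G"] F(1,2) G(1,2) by blast
      have "proj_point (torus_pt z) \<notin> zero_set V {f}" if "f \<in> F \<union> G" for f
        using z that proj_point_self[of "torus_pt z"] by (auto simp: zero_set_def)
      then have "proj_point (torus_pt z) \<notin> A'" "proj_point (torus_pt z) \<notin> B'" using F(3) G(3) xzY by blast+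
      then show False using AB A'(2) B'(2) xzY[of z] by blast
    qed
  qed
qed

text \<open>The point with all coordinates in \<open>M\<close> equal to 1 satisfies every binomial
  equation, and its support is all of \<open>M\<close>.\<close>

lemma toric_locus_mono:
  assumes "toric_locus M v \<subseteq> toric_locus M' v" and "M \<noteq> {}"
  shows "M \<subseteq> M'"
proof
  fix J assume J: "J \<in> M"
  define x where "x K = (if K \<in> M then 1 else 0 :: complex)" for K
  have "monom_val x k = 1" if "supp_in k M" for k
    unfolding monom_val_def by (rule prod.neutral) (use that in \<open>auto simp: x_def supp_in_def\<close>)
  then have "toric_pt M v x" by (auto simp: toric_pt_def x_def)
  moreover have "x J = 1" using J by (simp add: x_def)
  moreover from this have "x \<noteq> (\<lambda>_. 0)" by (metis zero_neq_one)
  ultimately have "proj_point x \<in> toric_locus M v"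
    unfolding toric_locus_def by blast
  then obtain y where y: "toric_pt M' v y" "proj_point x = proj_point y"
    using assms(1) by (auto simp: toric_locus_def)
  have "x \<in> proj_point x" unfolding proj_point_def by (auto intro!: exI[of _ 1])
  then obtain c where "x = (\<lambda>K. c * y K)" unfolding y(2) by (auto simp: proj_point_def)
  then have "y J \<noteq> 0" using \<open>x J = 1\<close> by auto
  then show "J \<in> M'" using y(1) by (auto simp: toric_pt_def)
qed

section \<open>Irreducible components as cells\<close>

context relative_poset
begin

text \<open>With \<open>cell_order M\<close> in place of \<open>r\<close> a cell is a relative poset
  of its own, and \<open>v\<close> depends on \<open>r'\<close> only, so the results on full toric
  loci apply to it verbatim.\<close>

lemma cell_locus:
  assumes w: "superadd w" and M: "M \<in> cells w"
  shows "isomorphic_varieties (proj_variety \<L> (toric_locus M v)) (toric_variety (convex hull (v ` M)))"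
    and "closedin (proj_zariski \<L>) (toric_locus M v)" "toric_locus M v \<subseteq> proj_space \<L>"
    and "\<And>Z. toric_locus M v \<subseteq> Z \<Longrightarrow> Z \<subseteq> proj_space \<L> \<Longrightarrow>
      irreducible_subset (subtopology (proj_zariski \<L>) Z) (toric_locus M v)"
    and "is_rel_poset_polytope P (convex hull (v ` M))"
proof -
  obtain c0 u where C: "is_cell w M c0 u" using M by (auto simp: cells_def)
  have rel: "relative_orders P (cell_order M) r'" by (rule cell_relative_orders[OF w C])
  interpret cell: relative_poset P "cell_order M" r' by unfold_locales (rule rel)
  have M: "order_ideals P (cell_order M) = M" by (rule cell_order_ideals[OF w C])
  have MS: "M \<subseteq> \<L>" using C by (auto simp: is_cell_def)
  interpret config: lattice_config \<L> M v using cell.lattice_config[of \<L>] MS M by simp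
  show "isomorphic_varieties (proj_variety \<L> (toric_locus M v)) (toric_variety (convex hull (v ` M)))"
    by (rule config.isomorphic_toric_variety)
  show "closedin (proj_zariski \<L>) (toric_locus M v)" by (rule config.Y_closed)
  show "toric_locus M v \<subseteq> proj_space \<L>" by (rule config.Y_subset)
  show "irreducible_subset (subtopology (proj_zariski \<L>) Z) (toric_locus M v)"
    if "toric_locus M v \<subseteq> Z" "Z \<subseteq> proj_space \<L>" for Z
    using cell.toric_locus_irreducible[of \<L> Z] that MS M by simp
  show "is_rel_poset_polytope P (convex hull (v ` M))"
    unfolding is_rel_poset_polytope_def using rel hull_cell_eq[OF w C] by metis
qed

text \<open>An inclusion of loci gives an inclusion of cells by \<open>toric_locus_mono\<close>, and
  nested cells coincide by \<open>cell_maximal\<close>; so every cell contributes exactly one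
  component.\<close>

lemma components:
  assumes w: "superadd w"
  shows "bij_betw (\<lambda>M. toric_locus M v) (cells w)
    (irreducible_components (subtopology (proj_zariski \<L>) (zero_set \<L> (initial_ideal w (toric_ideal P r r')))))"
proof -
  define Z where "Z = (\<Union>M\<in>cells w. toric_locus M v)"
  have ZP: "Z \<subseteq> proj_space \<L>" using cell_locus(3)[OF w] by (auto simp: Z_def)
  have max: "M = M'" if "M \<in> cells w" "M' \<in> cells w" "toric_locus M v \<subseteq> toric_locus M' v" for M M'
  proof -
    note MM = that
    have "M \<noteq> {}" using that(1) cell_empty by (auto simp: cells_def)
    then have "M \<subseteq> M'" using toric_locus_mono that(3) by blast
    moreover obtain c0 u c1 u' where "is_cell w M c0 u" "is_cell w M' c1 u'"
      using MM(1,2) by (auto simp: cells_def)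
    ultimately show ?thesis using cell_maximal by blast
  qed
  have topP: "topspace (proj_zariski \<L>) = proj_space \<L>"
    by (rule lattice_config.topspace_proj_zariski[OF lattice_config[OF order_refl]])
  have "irreducible_components (subtopology (proj_zariski \<L>) Z) = (\<lambda>M. toric_locus M v) ` cells w"
  proof (rule irreducible_components_eq)
    show "topspace (subtopology (proj_zariski \<L>) Z) = \<Union>((\<lambda>M. toric_locus M v) ` cells w)"
      using ZP topP by (auto simp: topspace_subtopology Z_def)
    fix A assume "A \<in> (\<lambda>M. toric_locus M v) ` cells w"
    then obtain M where M: "M \<in> cells w" "A = toric_locus M v" by blast
    then have AZ: "A \<subseteq> Z" by (auto simp: Z_def)
    show "irreducible_subset (subtopology (proj_zariski \<L>) Z) A"
      using cell_locus(4)[OF w M(1)] AZ ZP M(2) by blast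
    show "closedin (subtopology (proj_zariski \<L>) Z) A"
      using cell_locus(2)[OF w M(1)] AZ M(2) by (intro closedin_subset_topspace) auto
  qed (use max in auto)
  moreover have "inj_on (\<lambda>M. toric_locus M v) (cells w)" using max by (auto intro!: inj_onI)
  ultimately show ?thesis
    unfolding zero_set_initial[OF w] Z_def[symmetric] by (simp add: bij_betw_def)
qed

end

theorem theoremA:
  fixes P :: "'p::finite set" and r r' :: "'p rel"
  assumes "partial_order_on P r" and "partial_order_on P r'"
    and "r' \<subseteq> r"
    and "\<forall>J1\<in>order_ideals P r. \<forall>J2\<in>order_ideals P r. ideal_star P r' J1 J2 \<in> order_ideals P r"
  shows "normal_polytope (rel_poset_polytope P r r') \<and>
    ehrhart_equivalent (rel_poset_polytope P r r') (order_polytope P r) \<and>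
    ehrhart_equivalent (rel_poset_polytope P r r') (chain_polytope P r) \<and>
    (\<forall>I. is_initial_ideal_of I (toric_ideal P r r') \<and>
         is_initial_ideal_of (incomparable_ideal P r) I \<longrightarrow>
       semitoric TYPE('p) (order_ideals P r) (zero_set (order_ideals P r) I) \<and>
       (\<exists>\<Theta>. polyhedral_subdivision (rel_poset_polytope P r r') \<Theta> \<and>
            (\<forall>Q\<in>\<Theta>. is_rel_poset_polytope P Q) \<and>
            (\<exists>C. bij_betw C \<Theta>
                   (irreducible_components
                     (subtopology (proj_zariski (order_ideals P r))
                       (zero_set (order_ideals P r) I))) \<and>
                 (\<forall>Q\<in>\<Theta>. isomorphic_varieties
                   (proj_variety (order_ideals P r) (C Q)) (toric_variety Q)))))"
proof -
  have rel: "relative_orders P r r'" using assms by (simp add: relative_orders_def)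
  interpret relative_poset P r r' by unfold_locales (rule rel)
  show ?thesis
  proof (intro conjI allI impI)
    show "normal_polytope (rel_poset_polytope P r r')" by (rule normal)
    show "ehrhart_equivalent (rel_poset_polytope P r r') (order_polytope P r)"
      unfolding order_polytope_eq[OF assms(1)]
      by (rule ehrhart_same_order[OF rel relative_orders_discrete[OF assms(1)]])
    show "ehrhart_equivalent (rel_poset_polytope P r r') (chain_polytope P r)"
      unfolding chain_polytope_eq[OF assms(1)]
      by (rule ehrhart_same_order[OF rel relative_orders_refl[OF assms(1)]])
    fix I assume "is_initial_ideal_of I (toric_ideal P r r') \<and> is_initial_ideal_of (incomparable_ideal P r) I"
    then obtain w w' where I: "I = initial_ideal w (toric_ideal P r r')" "incomparable_ideal P r = initial_ideal w' I"
      by (auto simp: is_initial_ideal_of_def)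
    have w: "superadd w" using superadd_if_initial I by simp
    note comp = components[OF w, folded I(1)]
    show "semitoric TYPE('p) \<L> (zero_set \<L> I)"
      unfolding semitoric_def
    proof
      fix C assume "C \<in> irreducible_components (subtopology (proj_zariski \<L>) (zero_set \<L> I))"
      then obtain M where M: "M \<in> cells w" "C = toric_locus M v"
        using bij_betw_imp_surj_on[OF comp] by blast
      have "lattice_polytope (convex hull (v ` M))"
        unfolding lattice_polytope_def by (intro exI[of _ "v ` M"]) (auto simp: v_integer)
      then show "\<exists>Q :: (real ^ 'p) set. lattice_polytope Q \<and> isomorphic_varieties (proj_variety \<L> C) (toric_variety Q)"
        using cell_locus(1)[OF w M(1)] M(2) by blast
    qed
    let ?h = "\<lambda>M. convex hull (v ` M)"
    have inj: "inj_on ?h (cells w)" using hull_cell_inj[OF w] by (intro inj_onI) auto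
    \<comment> \<open>The assignment must start from the part of the subdivision; the cell is
      recovered from its hull by \<open>hull_cell_inj\<close>.\<close>
    let ?C = "(\<lambda>M. toric_locus M v) \<circ> the_inv_into (cells w) ?h"
    have "bij_betw ?C (?h ` cells w) (irreducible_components (subtopology (proj_zariski \<L>) (zero_set \<L> I)))"
      using bij_betw_the_inv_into[OF inj_on_imp_bij_betw[OF inj]] comp by (rule bij_betw_trans)
    moreover have "\<forall>Q\<in>?h ` cells w. isomorphic_varieties (proj_variety \<L> (?C Q)) (toric_variety Q)"
      using cell_locus(1)[OF w] by (auto simp: the_inv_into_f_f[OF inj])
    moreover have "\<forall>Q\<in>?h ` cells w. is_rel_poset_polytope P Q" using cell_locus(5)[OF w] by auto
    ultimately show "\<exists>\<Theta>. polyhedral_subdivision (rel_poset_polytope P r r') \<Theta> \<and>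
            (\<forall>Q\<in>\<Theta>. is_rel_poset_polytope P Q) \<and>
            (\<exists>C. bij_betw C \<Theta> (irreducible_components (subtopology (proj_zariski \<L>) (zero_set \<L> I))) \<and>
                 (\<forall>Q\<in>\<Theta>. isomorphic_varieties (proj_variety \<L> (C Q)) (toric_variety Q)))"
      using cells_subdivision[OF w] by blast
  qed
qed

end
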